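(* Let $\Omega$ be a bounded hyperconvex domain in $\mathbb C^n$ containing the origin $0$, and let $\varphi\in\mathcal E(\Omega)$. Assume that $$\nu_{\varphi|_l}(0)=\nu_\varphi(0)>0$$ for every complex line $l$ passing through $0$, and that there exist constants $a,b>0$ such that $\varphi(z)\ge a\log\|z\|-b$ on $\Omega$. Then, for every real $t>-n$, $$c_t(\varphi)=\frac{t+n}{\nu_\varphi(0)}.$$
   Context: $\|z\|$ is the Euclidean norm on $\mathbb C^n$; plurisubharmonic functions are assumed not identically $-\infty$. The Lelong number is $\nu_\varphi(0):=\liminf_{z\to0}\frac{\varphi(z)}{\log\|z\|}$; for a complex line $l$ through $0$, $\varphi|_l$ is the restriction of $\varphi$ to $l\cap\Omega$, regarded as a function of one complex variable near $0$, and $\nu_{\varphi|_l}(0):=\liminf_{z\to0,\,z\in l}\frac{\varphi(z)}{\log\|z\|}$. For real $t>-n$, $c_t(\varphi):=\sup\{c\ge0:\ \|z\|^{2t}e^{-2c\varphi}\text{ is integrable (Lebesgue measure) in some neighborhood of }0\}$. A bounded domain $\Omega$ is hyperconvex if it admits a negative continuous plurisubharmonic exhaustion function. $\mathcal E_0(\Omega)$ is the class of bounded negative plurisubharmonic functions $u$ on $\Omega$ such that for every $\varepsilon>0$ the set $\{u<-\varepsilon\}$ is relatively compact in $\Omega$, and $\int_\Omega(dd^cu)^n<+\infty$. $\mathcal E(\Omega)$ (Cegrell class) is the class of negative plurisubharmonic functions $u$ on $\Omega$ such that for every open set $\omega\Subset\Omega$ there is a decreasing sequence $(u_j)\subset\mathcal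 E_0(\Omega)$ converging pointwise to $u$ on $\omega$ with $\sup_{j}\int_\Omega(dd^cu_j)^n<+\infty$. *)

theory Defs
  imports "HOL-Analysis.Analysis"
begin

text \<open>
  Functions that may take the value \<open>-\<infinity>\<close> are \<^typ>\<open>ereal\<close>-valued and total; only their values
  on the set under consideration are relevant. The type \<open>complex^'n\<close> carries the Euclidean
  (Hermitian) norm, and \<open>*s\<close> is multiplication by complex scalars.
\<close>

section \<open>Plurisubharmonic functions\<close>

text \<open>The integral of an extended real function is the integral of its positive part minus that
  of its negative part (\<^const>\<open>e2ennreal\<close> truncates negative values to 0). Below, the positive
  part is always bounded.\<close>

definition circle_mean :: "(complex \<Rightarrow> ereal) \<Rightarrow> complex \<Rightarrow> real \<Rightarrow> ereal" where
  "circle_mean v c r =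
     (enn2ereal (\<integral>\<^sup>+\<theta>\<in>{0..2*pi}. e2ennreal (v (c + rcis r \<theta>)) \<partial>lborel)
      - enn2ereal (\<integral>\<^sup>+\<theta>\<in>{0..2*pi}. e2ennreal (- v (c + rcis r \<theta>)) \<partial>lborel)) / ereal (2 * pi)"

definition usc_on :: "'a::topological_space set \<Rightarrow> ('a \<Rightarrow> ereal) \<Rightarrow> bool" where
  "usc_on S v \<longleftrightarrow> (\<forall>z\<in>S. v z < \<infinity>) \<and> (\<forall>c. openin (top_of_set S) {z\<in>S. v z < c})"

text \<open>The function constantly \<open>-\<infinity>\<close> counts as subharmonic here; it is excluded below for
  plurisubharmonic functions.\<close>

definition subharmonic_on :: "complex set \<Rightarrow> (complex \<Rightarrow> ereal) \<Rightarrow> bool" where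
  "subharmonic_on S v \<longleftrightarrow> usc_on S v \<and>
     (\<forall>c r. 0 < r \<longrightarrow> cball c r \<subseteq> S \<longrightarrow> v c \<le> circle_mean v c r)"

definition plurisubharmonic_on :: "(complex^'n) set \<Rightarrow> (complex^'n \<Rightarrow> ereal) \<Rightarrow> bool" where
  "plurisubharmonic_on \<Omega> u \<longleftrightarrow> usc_on \<Omega> u \<and> (\<exists>z\<in>\<Omega>. u z \<noteq> -\<infinity>) \<and>
     (\<forall>z w. subharmonic_on {\<zeta>. z + \<zeta> *s w \<in> \<Omega>} (\<lambda>\<zeta>. u (z + \<zeta> *s w)))"

definition relatively_compact_in :: "'a::topological_space set \<Rightarrow> 'a set \<Rightarrow> bool" where
  "relatively_compact_in \<Omega> S \<longleftrightarrow> compact (closure S) \<and> closure S \<subseteq> \<Omega>"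

definition bounded_hyperconvex_domain :: "(complex^'n) set \<Rightarrow> bool" where
  "bounded_hyperconvex_domain \<Omega> \<longleftrightarrow>
     open \<Omega> \<and> connected \<Omega> \<and> \<Omega> \<noteq> {} \<and> bounded \<Omega> \<and>
     (\<exists>\<rho>::complex^'n \<Rightarrow> real. continuous_on \<Omega> \<rho> \<and> plurisubharmonic_on \<Omega> (\<lambda>z. ereal (\<rho> z)) \<and>
        (\<forall>z\<in>\<Omega>. \<rho> z < 0) \<and> (\<forall>c<0. relatively_compact_in \<Omega> {z\<in>\<Omega>. \<rho> z < c}))"

section \<open>The Monge--Ampere measure of a bounded plurisubharmonic function\<close>

primrec Ck :: "nat \<Rightarrow> ('a::euclidean_space \<Rightarrow> 'b::real_normed_vector) \<Rightarrow> bool" where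
  "Ck 0 f \<longleftrightarrow> continuous_on UNIV f"
| "Ck (Suc k) f \<longleftrightarrow> (\<forall>x. f differentiable (at x)) \<and>
     (\<forall>v. Ck k (\<lambda>x. frechet_derivative f (at x) v))"

definition test_function :: "(complex^'n) set \<Rightarrow> (complex^'n \<Rightarrow> complex) \<Rightarrow> bool" where
  "test_function \<Omega> f \<longleftrightarrow> (\<forall>k. Ck k f) \<and> relatively_compact_in \<Omega> {z. f z \<noteq> 0}"

definition d_z :: "'n \<Rightarrow> (complex^'n \<Rightarrow> complex) \<Rightarrow> complex^'n \<Rightarrow> complex" where
  "d_z j f z = (frechet_derivative f (at z) (axis j 1)
                - \<i> * frechet_derivative f (at z) (axis j \<i>)) / 2"

definition d_zbar :: "'n \<Rightarrow> (complex^'n \<Rightarrow> complex) \<Rightarrow> complex^'n \<Rightarrow> complex" where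
  "d_zbar j f z = (frechet_derivative f (at z) (axis j 1)
                   + \<i> * frechet_derivative f (at z) (axis j \<i>)) / 2"

definition radon_on :: "(complex^'n) set \<Rightarrow> (complex^'n) measure \<Rightarrow> bool" where
  "radon_on \<Omega> \<sigma> \<longleftrightarrow> sets \<sigma> = sets (restrict_space borel \<Omega>) \<and>
     (\<forall>K\<subseteq>\<Omega>. compact K \<longrightarrow> emeasure \<sigma> K < \<infinity>)"

text \<open>A complex Radon measure on \<open>\<Omega>\<close> (not necessarily of finite total variation) is represented
  as \<open>h \<sigma>\<close> with a positive Radon measure \<open>\<sigma>\<close> and a locally integrable density \<open>h\<close>.\<close>

type_synonym 'n cmeasure = "(complex^'n) measure \<times> (complex^'n \<Rightarrow> complex)"

definition complex_radon_on :: "(complex^'n) set \<Rightarrow> 'n cmeasure \<Rightarrow> bool" where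
  "complex_radon_on \<Omega> m \<longleftrightarrow> radon_on \<Omega> (fst m) \<and> snd m \<in> borel_measurable (fst m) \<and>
     (\<forall>K\<subseteq>\<Omega>. compact K \<longrightarrow> set_integrable (fst m) K (snd m))"

definition cmeasure_integral :: "'n cmeasure \<Rightarrow> (complex^'n \<Rightarrow> complex) \<Rightarrow> complex" where
  "cmeasure_integral m f = (\<integral>z. f z * snd m z \<partial>(fst m))"

text \<open>
  A current of bidegree \<open>(k,k)\<close> with measure coefficients is represented by the family of its
  coefficients \<open>T J L\<close>, skew-symmetric in the entries of \<open>J\<close> and in those of \<open>L\<close>, where \<open>J\<close> and \<open>L\<close>
  are lists of \<open>k\<close> indices:
    \<open>T = \<Sum> T J L (i dz\<^bsub>J!0\<^esub> \<and> dzbar\<^bsub>L!0\<^esub>) \<and> \<dots> \<and> (i dz\<^bsub>J!(k-1)\<^esub> \<and> dzbar\<^bsub>L!(k-1)\<^esub>)\<close>,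
  summed over increasing \<open>J\<close> and \<open>L\<close> (for any linear order on the indices).
  With \<open>d\<^sup>c = i (dbar - d')\<close>, i.e. \<open>dd\<^sup>c = 2 i d' dbar\<close> (\<open>d'\<close> and \<open>dbar\<close> the Dolbeault operators), the coefficient \<open>(J, L)\<close> of \<open>dd\<^sup>c (u T)\<close> is
    \<open>2 \<Sum>\<^bsub>a,b\<^esub> (-1)\<^bsup>a+b\<^esup> d\<^sup>2/(dz\<^bsub>J!a\<^esub> dzbar\<^bsub>L!b\<^esub>) (u T (J without J!a) (L without L!b))\<close>,
  derivatives being taken in the sense of distributions.
\<close>

type_synonym 'n current = "'n list \<Rightarrow> 'n list \<Rightarrow> 'n cmeasure"

definition remove_nth :: "nat \<Rightarrow> 'a list \<Rightarrow> 'a list" where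
  "remove_nth a xs = take a xs @ drop (Suc a) xs"

definition is_ddc_mult ::
  "(complex^'n) set \<Rightarrow> (complex^'n \<Rightarrow> real) \<Rightarrow> nat \<Rightarrow> 'n current \<Rightarrow> 'n current \<Rightarrow> bool" where
  "is_ddc_mult \<Omega> u k T S \<longleftrightarrow>
     (\<forall>J L. length J = Suc k \<longrightarrow> length L = Suc k \<longrightarrow>
        complex_radon_on \<Omega> (S J L) \<and>
        (\<forall>f. test_function \<Omega> f \<longrightarrow>
           cmeasure_integral (S J L) f =
             2 * (\<Sum>a\<le>k. \<Sum>b\<le>k. (-1) ^ (a + b) *
               cmeasure_integral (T (remove_nth a J) (remove_nth b L))
                 (\<lambda>z. complex_of_real (u z) * d_z (J ! a) (d_zbar (L ! b) f) z))))"

text \<open>Bedford--Taylor powers: \<open>(dd\<^sup>c u)\<^bsup>k+1\<^esup> = dd\<^sup>c (u (dd\<^sup>c u)\<^bsup>k\<^esup>)\<close>, starting from the constant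
  function 1.\<close>

inductive ddc_power ::
  "(complex^'n) set \<Rightarrow> (complex^'n \<Rightarrow> real) \<Rightarrow> nat \<Rightarrow> 'n current \<Rightarrow> bool"
  for \<Omega> :: "(complex^'n) set" and u :: "complex^'n \<Rightarrow> real" where
  zero: "T [] [] = (restrict_space lborel \<Omega>, \<lambda>_. 1) \<Longrightarrow> ddc_power \<Omega> u 0 T"
| step: "ddc_power \<Omega> u k T \<Longrightarrow> is_ddc_mult \<Omega> u k T S \<Longrightarrow> ddc_power \<Omega> u (Suc k) S"

text \<open>In top degree, if \<open>J\<close> enumerates all indices, the basic form for \<open>(J, J)\<close> is \<open>2\<^sup>n\<close> times the
  Lebesgue volume form, because \<open>i dz \<and> dzbar = 2 dx \<and> dy\<close>. For smooth \<open>u\<close> this yields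
  \<open>4\<^sup>n n! det (d\<^sup>2u / dz\<^sub>j dzbar\<^sub>l)\<close> times Lebesgue measure.\<close>

definition is_monge_ampere ::
  "(complex^'n) set \<Rightarrow> (complex^'n \<Rightarrow> real) \<Rightarrow> (complex^'n) measure \<Rightarrow> bool" where
  "is_monge_ampere \<Omega> u \<mu> \<longleftrightarrow> radon_on \<Omega> \<mu> \<and>
     (\<exists>T. ddc_power \<Omega> u CARD('n) T \<and>
        (\<forall>J f. distinct J \<longrightarrow> set J = UNIV \<longrightarrow> test_function \<Omega> f \<longrightarrow>
           (\<integral>z. f z \<partial>\<mu>) = 2 ^ CARD('n) * cmeasure_integral (T J J) f))"

text \<open>For locally bounded plurisubharmonic \<open>u\<close> on an open set, such a measure exists by the theorem
  of Bedford and Taylor; it is unique because test functions determine Radon measures.\<close>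

definition monge_ampere :: "(complex^'n) set \<Rightarrow> (complex^'n \<Rightarrow> ereal) \<Rightarrow> (complex^'n) measure" where
  "monge_ampere \<Omega> u = (THE \<mu>. is_monge_ampere \<Omega> (\<lambda>z. real_of_ereal (u z)) \<mu>)"

section \<open>Cegrell classes\<close>

definition negative_psh_on :: "(complex^'n) set \<Rightarrow> (complex^'n \<Rightarrow> ereal) \<Rightarrow> bool" where
  "negative_psh_on \<Omega> u \<longleftrightarrow> plurisubharmonic_on \<Omega> u \<and> (\<forall>z\<in>\<Omega>. u z < 0)"

definition cegrell_E0 :: "(complex^'n) set \<Rightarrow> (complex^'n \<Rightarrow> ereal) set" where
  "cegrell_E0 \<Omega> = {u. negative_psh_on \<Omega> u \<and> (\<exists>M::real. \<forall>z\<in>\<Omega>. ereal (- M) \<le> u z) \<and>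
     (\<forall>\<epsilon>::real. \<epsilon> > 0 \<longrightarrow> relatively_compact_in \<Omega> {z\<in>\<Omega>. u z < ereal (- \<epsilon>)}) \<and>
     emeasure (monge_ampere \<Omega> u) \<Omega> < \<infinity>}"

definition cegrell_E :: "(complex^'n) set \<Rightarrow> (complex^'n \<Rightarrow> ereal) set" where
  "cegrell_E \<Omega> = {u. negative_psh_on \<Omega> u \<and>
     (\<forall>\<omega>. open \<omega> \<longrightarrow> relatively_compact_in \<Omega> \<omega> \<longrightarrow>
        (\<exists>v :: nat \<Rightarrow> complex^'n \<Rightarrow> ereal.
           (\<forall>j. v j \<in> cegrell_E0 \<Omega>) \<and>
           (\<forall>j. \<forall>z\<in>\<Omega>. v (Suc j) z \<le> v j z) \<and>
           (\<forall>z\<in>\<omega>. (\<lambda>j. v j z) \<longlonglongrightarrow> u z) \<and>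
           (SUP j. emeasure (monge_ampere \<Omega> (v j)) \<Omega>) < \<infinity>))}"

section \<open>Lelong numbers and weighted integrability thresholds at the origin\<close>

definition lelong_number :: "(complex^'n \<Rightarrow> ereal) \<Rightarrow> ereal" where
  "lelong_number \<phi> = Liminf (at 0) (\<lambda>z. \<phi> z / ereal (ln (norm z)))"

definition complex_line_through_0 :: "(complex^'n) set \<Rightarrow> bool" where
  "complex_line_through_0 l \<longleftrightarrow> (\<exists>w. w \<noteq> 0 \<and> l = range (\<lambda>\<zeta>. \<zeta> *s w))"

definition lelong_number_on_line :: "(complex^'n) set \<Rightarrow> (complex^'n \<Rightarrow> ereal) \<Rightarrow> ereal" where
  "lelong_number_on_line l \<phi> = Liminf (at 0 within l) (\<lambda>z. \<phi> z / ereal (ln (norm z)))"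

definition ereal_exp :: "ereal \<Rightarrow> ennreal" where
  "ereal_exp x = (if x = \<infinity> then \<infinity> else if x = -\<infinity> then 0 else ennreal (exp (real_of_ereal x)))"

text \<open>The conventions \<open>0 powr x = 0\<close> and \<open>0 * (-\<infinity>) = 0\<close> do no harm: the former concerns a single
  point, and the latter gives the weight \<open>\<parallel>z\<parallel>\<^bsup>2t\<^esup>\<close> for \<open>c = 0\<close>.\<close>

definition weighted_threshold :: "real \<Rightarrow> (complex^'n \<Rightarrow> ereal) \<Rightarrow> ereal" where
  "weighted_threshold t \<phi> = Sup {ereal c | c. c \<ge> 0 \<and>
     (\<exists>U. open U \<and> 0 \<in> U \<and>
        (\<integral>\<^sup>+z\<in>U. ennreal (norm z powr (2 * t)) * ereal_exp (ereal (- 2 * c) * \<phi> z) \<partial>lborel) < \<infinity>)}"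

end

theory Submission
  imports Defs "HOL-Complex_Analysis.Complex_Analysis"
begin

text \<open>
  Write \<open>\<nu>\<close> for the Lelong number; the logarithmic lower bound makes it finite. The inequality
  \<open>c \<le> (t + n) / \<nu>\<close> is elementary: for \<open>\<nu>' < \<nu>\<close> the function \<open>\<phi>\<close> lies below
  \<open>\<nu>' log \<bar>\<bar>z\<bar>\<bar>\<close> near the origin, and \<open>\<bar>\<bar>z\<bar>\<bar>\<close> to the power \<open>-2n\<close> is not integrable there
  (\<open>nn_integral_norm_power_diverges\<close>).

  For the opposite inequality let \<open>c \<nu> < t + n\<close> and choose \<open>\<mu> > \<nu>\<close> with \<open>c \<mu> < t + n\<close>. If
  \<open>\<phi>\<close> were above \<open>\<mu> log \<bar>\<bar>z\<bar>\<bar> - M\<close> everywhere, integrability would be clear; the point is that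
  the exceptional set is negligible at every exponential rate. On the shell where \<open>\<bar>\<bar>z\<bar>\<bar>\<close> is
  comparable with \<open>e^s\<close>, the volume of the points with \<open>\<phi> < \<mu> s - M\<close> is at most
  \<open>C e^(2 n s - B M)\<close>, for an arbitrarily large constant \<open>B\<close> and with \<open>C\<close> independent of \<open>s\<close> and
  \<open>M\<close> (\<open>shell_volume_estimate\<close>). Summing \<open>e^(-2 c \<phi>)\<close> over the levels \<open>M = M0 + j\<close> with
  \<open>B > 2 c\<close> and then over the shells \<open>s = s1 - k\<close> gives two convergent geometric series
  (\<open>shell_integral_estimate\<close>, \<open>integrable_near_0\<close>).

  The volume bound combines two applications of the maximum principle, both with comparison functions
  built from the logarithmic potential \<open>h\<close> of a planar set \<open>F\<close>: \<open>h\<close> is harmonic off \<open>F\<close>, lies between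
  0 and 1, vanishes on the unit circle and, on a disc around 0 that contains \<open>F\<close>, is bounded below in terms of
  the radius of the disc and the area of \<open>F\<close>
  (\<open>logarithmic_potential_of_open_set\<close>). Let \<open>U z\<close> be the maximum of \<open>\<phi>\<close> over the circle
  through \<open>z\<close> centred at 0 in the complex line of \<open>z\<close>; it is again plurisubharmonic.

  \<^item> Along the line of points \<open>\<zeta> w\<close> one has \<open>\<phi> \<le> \<nu> log \<bar>\<zeta>\<bar> + const\<close>. If the set of \<open>\<zeta>\<close> close to
    \<open>e^s\<close> with \<open>\<phi> < \<mu> s - M\<close> is not tiny, subtracting a multiple of its potential pushes
    \<open>\<phi>\<close> down on the whole circle of radius \<open>e^s\<close>: there \<open>U < \<mu>2 s - M'\<close> with some \<open>\<mu>2 > \<nu>\<close> and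
    \<open>M'\<close> proportional to \<open>M\<close> (\<open>line_estimate\<close>).

  \<^item> Transversally, consider the points \<open>e^s (w0 + x y)\<close> for a fixed direction \<open>w0\<close>, a fixed vector \<open>y\<close> and
    a small complex parameter \<open>x\<close>. If \<open>U < \<mu>2 s - M'\<close> on a set of parameters that is not tiny, let \<open>h\<close>
    be the potential of that set. The function \<open>x\<close> to \<open>U (e^(s h(x)) (w0 + x y))\<close> is
    subharmonic: locally \<open>h\<close> is the real part of a holomorphic \<open>f\<close>, and since \<open>U\<close> is invariant
    under rotation, \<open>e^(s h)\<close> can be replaced by the holomorphic factor \<open>e^(s f)\<close>. Convexity of \<open>U\<close> in \<open>s\<close>
    gives the boundary bound \<open>(\<mu>2 s - M') h\<close>, so the maximum principle bounds
    \<open>U (e^(s h(0)) w0)\<close> by \<open>(\<mu>2 s - M') h(0)\<close>. On the line of \<open>w0\<close>, however, the Lelong number is \<open>\<nu> < \<mu>2\<close>,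
    so \<open>U (e^s w0) \<ge> \<mu>2 s - K\<close> for all \<open>s \<le> 0\<close>; hence \<open>M' h(0) \<le> K\<close>. If the parameters
    range over a sufficiently small disc, the lower bound of \<open>h\<close> then forces the area of the set to be at most
    \<open>const e^(-B M')\<close> (\<open>transversal_estimate\<close>). This is where equality of the Lelong numbers along all lines is used.

  Integrating over \<open>\<zeta>\<close>, \<open>x\<close> and \<open>y\<close>, whose images \<open>\<zeta> (w0 + x y)\<close> sweep out a ball around \<open>e^s w0\<close>,
  yields the volume bound near one direction (\<open>volume_estimate_near_direction\<close>), and compactness
  of the set of directions yields the bound on the shell.
\<close>

section \<open>Lebesgue measure under isometries and complex dilations\<close>

text \<open>Both measures are translation invariant and finite on balls, hence proportional. The constant
  is 1 because an isometry fixes the unit ball. The proof of proportionality compares the two measures through a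
  double integral, in the manner of the uniqueness proof for Haar measure.\<close>
lemma distr_lborel_linear_isometry:
  fixes T :: "'a::euclidean_space \<Rightarrow> 'a"
  assumes lin: "linear T" and iso: "\<And>x. norm (T x) = norm x"
  shows "distr lborel borel T = lborel"
proof (rule measure_eqI)
  define \<mu> where "\<mu> = distr lborel borel T"
  interpret L: sigma_finite_measure "lborel :: 'a measure" by (rule sigma_finite_lborel)
  have T_meas[measurable]: "T \<in> borel_measurable borel"
    using lin by (intro borel_measurable_continuous_onI linear_continuous_on linear_conv_bounded_linear[THEN iffD1])
  have orth: "orthogonal_transformation T"
    using lin iso by (simp add: orthogonal_transformation)
  have surjT: "surj T" and injT: "inj T"
    using orth orthogonal_transformation_surj orthogonal_transformation_inj by blast+
  have sets_\<mu>[measurable_cong]: "sets \<mu> = sets borel" by (simp add: \<mu>_def)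
  have sfmu: "sigma_finite_measure \<mu>"
  proof
    show "\<exists>A. countable A \<and> A \<subseteq> sets \<mu> \<and> \<Union> A = space \<mu> \<and> (\<forall>a\<in>A. emeasure \<mu> a \<noteq> \<infinity>)"
    proof (intro exI[of _ "range (\<lambda>n::nat. ball 0 (real n))"] conjI)
      have "emeasure \<mu> (ball 0 (real n)) \<noteq> \<infinity>" for n
      proof -
        have "T -` ball 0 (real n) = ball 0 (real n)" using iso by auto
        then show ?thesis using emeasure_lborel_ball_finite[of "0::'a" "real n"]
          by (simp add: \<mu>_def emeasure_distr)
      qed
      then show "\<forall>a\<in>range (\<lambda>n::nat. ball 0 (real n)). emeasure \<mu> a \<noteq> \<infinity>" by auto
      show "\<Union> (range (\<lambda>n::nat. ball (0::'a) (real n))) = space \<mu>"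
        by (auto simp: \<mu>_def) (meson reals_Archimedean2)
    qed (auto simp: sets_\<mu>)
  qed
  then interpret M: sigma_finite_measure \<mu> .
  interpret P: pair_sigma_finite \<mu> "lborel :: 'a measure" ..
  have transl: "distr lborel borel (\<lambda>x. v + x) = (lborel :: 'a measure)" for v
    by (rule lborel_distr_plus)
  have transl_e: "emeasure lborel ((\<lambda>x. v + x) -` A) = emeasure lborel A"
    if "A \<in> sets borel" for v and A :: "'a set"
    using that emeasure_distr[of "\<lambda>x. v + x" lborel borel A] by (simp add: transl)
  have refl_e: "emeasure lborel ((\<lambda>x. v - x) -` A) = emeasure lborel A"
    if "A \<in> sets borel" for v and A :: "'a set"
  proof -
    have "(lborel :: 'a measure) = density (distr lborel borel (\<lambda>x. v + (-1) *\<^sub>R x)) (\<lambda>_. ennreal (\<bar>-1\<bar> ^ DIM('a)))"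
      by (rule lborel_affine) simp
    then have "lborel = distr lborel borel (\<lambda>x. v - x)" by (simp add: density_1)
    then show ?thesis
      using that emeasure_distr[of "\<lambda>x. v - x" lborel borel A] by simp
  qed
  have nn_shift: "(\<integral>\<^sup>+x. f (v + x) \<partial>\<mu>) = (\<integral>\<^sup>+x. f x \<partial>\<mu>)"
    if [measurable]: "f \<in> borel_measurable borel" for v :: 'a and f :: "'a \<Rightarrow> ennreal"
  proof -
    obtain v' where v': "v = T v'" using surjT by (metis surjD)
    have "(\<integral>\<^sup>+x. f (v + x) \<partial>\<mu>) = (\<integral>\<^sup>+x. f (T (v' + x)) \<partial>lborel)"
      unfolding \<mu>_def by (subst nn_integral_distr) (auto simp: v' linear_add[OF lin])
    also have "\<dots> = (\<integral>\<^sup>+x. f (T x) \<partial>distr lborel borel (\<lambda>x. v' + x))"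
      by (subst nn_integral_distr) auto
    also have "\<dots> = (\<integral>\<^sup>+x. f x \<partial>\<mu>)"
      unfolding transl \<mu>_def by (subst nn_integral_distr) auto
    finally show ?thesis .
  qed
  show "sets (distr lborel borel T) = sets lborel" by simp
  fix A assume "A \<in> sets (distr lborel borel T)"
  then have A[measurable]: "A \<in> sets borel" by simp
  define B where "B = ball (0::'a) 1"
  have B[measurable]: "B \<in> sets borel" by (simp add: B_def)
  \<comment> \<open>Both sides are \<open>\<integral>\<integral> 1\<^sub>A(x) 1\<^sub>B(x + y)\<close>, integrated in two orders.\<close>
  have "emeasure \<mu> A * emeasure lborel B
      = (\<integral>\<^sup>+x. indicator A x * emeasure lborel ((\<lambda>y. x + y) -` B) \<partial>\<mu>)"
    by (simp add: transl_e nn_integral_multc sets_\<mu>)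
  also have "\<dots> = (\<integral>\<^sup>+x. \<integral>\<^sup>+y. indicator A x * indicator B (x + y) \<partial>lborel \<partial>\<mu>)"
  proof (intro nn_integral_cong)
    fix x
    have "(\<integral>\<^sup>+y. indicator B (x + y) \<partial>lborel) = (\<integral>\<^sup>+y. indicator ((\<lambda>y. x + y) -` B) y \<partial>lborel)"
      by (intro nn_integral_cong) (auto simp: indicator_def)
    also have "\<dots> = emeasure lborel ((\<lambda>y. x + y) -` B)"
      by (rule nn_integral_indicator) (simp add: measurable_sets_borel[OF _ B])
    finally show "indicator A x * emeasure lborel ((\<lambda>y. x + y) -` B) =
          (\<integral>\<^sup>+y. indicator A x * indicator B (x + y) \<partial>lborel)"
      by (simp add: nn_integral_cmult)
  qed
  also have "\<dots> = (\<integral>\<^sup>+y. \<integral>\<^sup>+x. indicator A x * indicator B (x + y) \<partial>\<mu> \<partial>lborel)"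
    by (rule P.Fubini'[symmetric]) measurable
  also have "\<dots> = (\<integral>\<^sup>+y. \<integral>\<^sup>+x. indicator A (x - y) * indicator B x \<partial>\<mu> \<partial>lborel)"
  proof (rule nn_integral_cong)
    fix y :: 'a
    show "(\<integral>\<^sup>+x. indicator A x * indicator B (x + y) \<partial>\<mu>) = (\<integral>\<^sup>+x. indicator A (x - y) * indicator B x \<partial>\<mu>)"
      using nn_shift[of "\<lambda>x. indicator A (x - y) * indicator B x" y]
      by (simp add: add.commute)
  qed
  also have "\<dots> = (\<integral>\<^sup>+x. \<integral>\<^sup>+y. indicator A (x - y) * indicator B x \<partial>lborel \<partial>\<mu>)"
    by (rule P.Fubini') measurable
  also have "\<dots> = (\<integral>\<^sup>+x. emeasure lborel A * indicator B x \<partial>\<mu>)"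
  proof (intro nn_integral_cong)
    fix x
    have "(\<integral>\<^sup>+y. indicator A (x - y) \<partial>lborel) = (\<integral>\<^sup>+y. indicator ((\<lambda>y. x - y) -` A) y \<partial>lborel)"
      by (intro nn_integral_cong) (auto simp: indicator_def)
    also have "\<dots> = emeasure lborel ((\<lambda>y. x - y) -` A)"
      by (rule nn_integral_indicator) (simp add: measurable_sets_borel[OF _ A])
    finally show "(\<integral>\<^sup>+y. indicator A (x - y) * indicator B x \<partial>lborel) = emeasure lborel A * indicator B x"
      by (simp add: nn_integral_multc refl_e)
  qed
  also have "\<dots> = emeasure lborel A * emeasure \<mu> B"
    by (simp add: nn_integral_cmult sets_\<mu>)
  also have "emeasure \<mu> B = emeasure lborel B"
  proof -
    have "T -` B = B" using iso by (auto simp: B_def)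
    then show ?thesis by (simp add: \<mu>_def emeasure_distr)
  qed
  finally have "emeasure \<mu> A * emeasure lborel B = emeasure lborel A * emeasure lborel B" .
  moreover have "emeasure lborel B \<noteq> 0"
  proof
    assume "emeasure lborel B = 0"
    then have "measure lborel (ball (0::'a) 1) = 0" by (simp add: measure_def B_def)
    then show False using content_ball_pos[of 1 "0::'a"] by simp
  qed
  moreover have "emeasure lborel B \<noteq> \<infinity>"
    using emeasure_lborel_ball_finite[of "0::'a" 1] by (simp add: B_def)
  ultimately have "emeasure \<mu> A = emeasure lborel A"
    by (metis mult_divide_eq_ennreal infinity_ennreal_def)
  then show "emeasure (distr lborel borel T) A = emeasure lborel A"
    by (simp add: \<mu>_def)
qed

lemma isometry_vector_scalar:
  fixes c :: complex
  assumes "norm c = 1"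
  shows "linear (\<lambda>z::complex^'n. c *s z)" "norm (c *s (z::complex^'n)) = norm z"
proof -
  show "linear (\<lambda>z::complex^'n. c *s z)"
    by (rule linearI) (auto simp: vec_eq_iff algebra_simps)
  show "norm (c *s (z::complex^'n)) = norm z"
    using assms by (simp add: norm_vec_def L2_set_def norm_mult)
qed

lemma norm_vector_scalar [simp]: "norm (c *s (z::complex^'n)) = norm c * norm z"
  by (simp add: norm_vec_def norm_mult L2_set_def power_mult_distrib sum_distrib_left[symmetric] real_sqrt_mult)

text \<open>A dilation by the complex number \<open>c\<close> is an isometry followed by the real dilation by its modulus, on
  a space of real dimension \<open>2n\<close>.\<close>
lemma emeasure_lborel_vector_scalar_vimage:
  fixes E :: "(complex^'n) set"
  assumes E: "E \<in> sets borel" and c: "c \<noteq> 0"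
  shows "emeasure lborel E = ennreal (norm c ^ (2 * CARD('n))) * emeasure lborel ((\<lambda>y. v + c *s y) -` E)"
proof -
  define T where "T = (\<lambda>z::complex^'n. (c / norm c) *s z)"
  define S where "S = (\<lambda>x::complex^'n. v + norm c *\<^sub>R x)"
  have u: "norm (c / norm c) = 1" using c by (simp add: norm_divide)
  have comp: "(\<lambda>y. v + c *s y) = S \<circ> T"
    using c by (auto simp: S_def T_def fun_eq_iff vec_eq_iff) (simp add: scaleR_conv_of_real)
  have Sm: "S \<in> borel_measurable borel" unfolding S_def by measurable
  have SE: "S -` E \<in> sets borel" using measurable_sets_borel[OF Sm E] by simp
  have Tm: "T \<in> borel_measurable borel"
    unfolding T_def using isometry_vector_scalar(1)[OF u]
    by (intro borel_measurable_continuous_onI linear_continuous_on linear_conv_bounded_linear[THEN iffD1])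
  have dT: "distr lborel borel T = lborel"
    unfolding T_def by (rule distr_lborel_linear_isometry[OF isometry_vector_scalar[OF u]])
  have "emeasure lborel (T -` (S -` E)) = emeasure lborel (S -` E)"
    using emeasure_distr[of T lborel borel "S -` E"] SE Tm by (simp add: dT)
  moreover have "lborel = density (distr lborel borel S) (\<lambda>_. ennreal (\<bar>norm c\<bar> ^ DIM(complex^'n)))"
    unfolding S_def using c by (intro lborel_affine) auto
  then have "emeasure lborel E = emeasure (density (distr lborel borel S) (\<lambda>_. ennreal (norm c ^ DIM(complex^'n)))) E"
    by (metis abs_norm_cancel)
  then have "emeasure lborel E = (\<integral>\<^sup>+x. ennreal (norm c ^ DIM(complex^'n)) * indicator E x \<partial>distr lborel borel S)"
    using E by (simp add: emeasure_density)
  then have "emeasure lborel E = ennreal (norm c ^ DIM(complex^'n)) * emeasure (distr lborel borel S) E"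
    using E by (simp add: nn_integral_cmult)
  then have "emeasure lborel E = ennreal (norm c ^ (2 * CARD('n))) * emeasure lborel (S -` E)"
    using E Sm by (simp add: emeasure_distr mult.commute)
  ultimately show ?thesis by (simp add: comp vimage_comp[symmetric])
qed

section \<open>Subharmonicity by touching and the maximum principle\<close>

text \<open>Upper semicontinuity relative to a set, for a function whose values outside the set are
  irrelevant.\<close>
definition usc_real_on :: "'a::metric_space set \<Rightarrow> ('a \<Rightarrow> real) \<Rightarrow> bool" where
  "usc_real_on S V \<longleftrightarrow> (\<forall>x\<in>S. \<forall>c>V x. \<exists>d>0. \<forall>x'\<in>S. dist x' x < d \<longrightarrow> V x' < c)"

definition harmonic_at :: "(complex \<Rightarrow> real) \<Rightarrow> complex \<Rightarrow> bool" where
  "harmonic_at H x0 \<longleftrightarrow> (\<exists>r>0. \<exists>f. f holomorphic_on ball x0 r \<and> (\<forall>x\<in>ball x0 r. H x = Re (f x)))"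

text \<open>A weak form of subharmonicity at one point: no function of the form
  (harmonic quadratic polynomial) \<open>- \<delta> \<bar>x - x0\<bar>^2\<close> touches \<open>V\<close> strictly from above at \<open>x0\<close>. It follows from the
  sub-mean value inequality on small circles, survives composition with holomorphic curves for
  smooth functions, and is exactly what fails at an interior maximum of \<open>V - H + \<delta> \<bar>x\<bar>^2\<close> with harmonic \<open>H\<close>.\<close>
definition subharmonic_touching :: "(complex \<Rightarrow> real) \<Rightarrow> complex \<Rightarrow> bool" where
  "subharmonic_touching V x0 \<longleftrightarrow> (\<forall>\<alpha> \<beta> \<delta> r0. 0 < \<delta> \<longrightarrow> 0 < r0 \<longrightarrow>
     (\<exists>x. 0 < dist x x0 \<and> dist x x0 < r0 \<and>
        V x0 + Re (\<alpha> * (x - x0) + \<beta> * (x - x0)\<^sup>2) - \<delta> * (dist x x0)\<^sup>2 \<le> V x))"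

lemma usc_real_onD:
  "usc_real_on S V \<Longrightarrow> x \<in> S \<Longrightarrow> V x < c \<Longrightarrow> \<exists>d>0. \<forall>x'\<in>S. dist x' x < d \<longrightarrow> V x' < c"
  unfolding usc_real_on_def by blast

lemma usc_real_on_add_continuous:
  fixes V f :: "'a::metric_space \<Rightarrow> real"
  assumes V: "usc_real_on S V" and f: "continuous_on S f"
  shows "usc_real_on S (\<lambda>x. V x + f x)"
  unfolding usc_real_on_def
proof (intro ballI allI impI)
  fix x c assume x: "x \<in> S" and c: "V x + f x < c"
  define e where "e = (c - (V x + f x)) / 2"
  have e: "e > 0" using c by (simp add: e_def)
  obtain d1 where d1: "d1 > 0" "\<And>x'. x' \<in> S \<Longrightarrow> dist x' x < d1 \<Longrightarrow> V x' < V x + e"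
    using usc_real_onD[OF V x, of "V x + e"] e by auto
  obtain d2 where d2: "d2 > 0" "\<And>x'. x' \<in> S \<Longrightarrow> dist x' x < d2 \<Longrightarrow> dist (f x') (f x) < e"
    using f x e unfolding continuous_on_iff by meson
  show "\<exists>d>0. \<forall>x'\<in>S. dist x' x < d \<longrightarrow> V x' + f x' < c"
  proof (intro exI[of _ "min d1 d2"] conjI ballI impI)
    show "0 < min d1 d2" using d1 d2 by simp
    fix x' assume "x' \<in> S" "dist x' x < min d1 d2"
    then have "V x' < V x + e" "dist (f x') (f x) < e" using d1 d2 by auto
    then have "V x' < V x + e" "f x' < f x + e" by (auto simp: dist_real_def)
    then show "V x' + f x' < c" unfolding e_def by (simp add: field_simps)
  qed
qed

lemma usc_real_on_compose_continuous:
  assumes V: "usc_real_on T V" and q: "continuous_on S q" and sub: "q ` S \<subseteq> T"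
  shows "usc_real_on S (\<lambda>x. V (q x))"
  unfolding usc_real_on_def
proof (intro ballI allI impI)
  fix x c assume x: "x \<in> S" and c: "V (q x) < c"
  have "q x \<in> T" using x sub by auto
  then obtain d where d: "d > 0" "\<And>y. y \<in> T \<Longrightarrow> dist y (q x) < d \<Longrightarrow> V y < c"
    using usc_real_onD[OF V _ c] by blast
  obtain d' where "d' > 0" "\<And>x'. x' \<in> S \<Longrightarrow> dist x' x < d' \<Longrightarrow> dist (q x') (q x) < d"
    using q x d(1) unfolding continuous_on_iff by meson
  then show "\<exists>d>0. \<forall>x'\<in>S. dist x' x < d \<longrightarrow> V (q x') < c"
    using d sub by (meson image_subset_iff)
qed

lemma usc_real_on_attains_max:
  fixes V :: "'a::metric_space \<Rightarrow> real"
  assumes K: "compact K" "K \<noteq> {}" and V: "usc_real_on K V"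
  shows "\<exists>x\<in>K. \<forall>y\<in>K. V y \<le> V x"
proof (rule ccontr)
  assume neg: "\<not> ?thesis"
  have ex: "\<exists>y\<in>K. V x < V y" if "x \<in> K" for x
    using neg that by (meson not_le)
  obtain m where m: "\<And>x. x \<in> K \<Longrightarrow> m x \<in> K \<and> V x < V (m x)" using ex by metis
  have "\<exists>d>0. \<forall>x'\<in>K. dist x' x < d \<longrightarrow> V x' < V (m x)" if "x \<in> K" for x
    using usc_real_onD[OF V that] m[OF that] by blast
  then obtain d where d: "\<And>x. x \<in> K \<Longrightarrow> d x > 0 \<and> (\<forall>x'\<in>K. dist x' x < d x \<longrightarrow> V x' < V (m x))"
    by metis
  have "\<exists>F\<subseteq>K. finite F \<and> K \<subseteq> (\<Union>x\<in>F. ball x (d x))"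
  proof (rule compactE_image[OF K(1), of K "\<lambda>x. ball x (d x)"])
    show "K \<subseteq> (\<Union>x\<in>K. ball x (d x))" using d by force
  qed auto
  then obtain F where F: "F \<subseteq> K" "finite F" "K \<subseteq> (\<Union>x\<in>F. ball x (d x))" by blast
  have "F \<noteq> {}" using F K by auto
  then obtain x where x: "x \<in> F" "\<And>y. y \<in> F \<Longrightarrow> V (m y) \<le> V (m x)"
  proof -
    have "Max ((\<lambda>y. V (m y)) ` F) \<in> (\<lambda>y. V (m y)) ` F"
      using \<open>F \<noteq> {}\<close> F(2) by (intro Max_in) auto
    then obtain x where "x \<in> F" "V (m x) = Max ((\<lambda>y. V (m y)) ` F)" by auto
    then show thesis using that F(2) by auto
  qed
  have "m x \<in> K" using x F m by auto
  then obtain y where "y \<in> F" "m x \<in> ball y (d y)" using F by auto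
  then have "V (m x) < V (m y)" using d[of y] F \<open>m x \<in> K\<close> by (auto simp: dist_commute)
  then show False using x \<open>y \<in> F\<close> by force
qed

text \<open>The remainder of the power series after the quadratic term is a third power times a continuous
  function on a closed disc.\<close>
lemma holomorphic_Taylor_order_2:
  assumes f: "f holomorphic_on ball x0 r" and r: "0 < r"
  obtains \<alpha> \<beta> C where "0 \<le> C"
    "\<And>x. dist x x0 < r / 2 \<Longrightarrow> norm (f x - (f x0 + \<alpha> * (x - x0) + \<beta> * (x - x0)\<^sup>2)) \<le> C * norm (x - x0) ^ 3"
proof -
  let ?S = "cball x0 (r / 2)"
  have sub: "?S \<subseteq> ball x0 r" using r by auto
  have hol: "(deriv ^^ i) f holomorphic_on ball x0 r" for i
    using f by (rule holomorphic_higher_deriv) auto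
  have "continuous_on ?S ((deriv ^^ Suc 2) f)"
    using hol sub holomorphic_on_imp_continuous_on continuous_on_subset by blast
  then have "bounded ((deriv ^^ Suc 2) f ` ?S)"
    by (intro compact_imp_bounded compact_continuous_image) auto
  then obtain B where B: "\<And>x. x \<in> ?S \<Longrightarrow> norm ((deriv ^^ Suc 2) f x) \<le> B" "B > 0"
    unfolding bounded_pos by blast
  have T: "norm ((deriv ^^ 0) f x - (\<Sum>i\<le>2. (deriv ^^ i) f x0 * (x - x0) ^ i / fact i)) \<le> B * norm (x - x0) ^ (Suc 2) / fact 2"
    if "x \<in> ?S" for x
  proof (rule complex_Taylor[where S = ?S and f = "\<lambda>i. (deriv ^^ i) f"])
    fix i y assume "y \<in> ?S"
    then have y: "y \<in> ball x0 r" using sub by auto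
    have "((deriv ^^ i) f has_field_derivative deriv ((deriv ^^ i) f) y) (at y)"
      using hol[of i] y by (auto intro: holomorphic_derivI)
    then show "((deriv ^^ i) f has_field_derivative (deriv ^^ Suc i) f y) (at y within ?S)"
      by (simp add: has_field_derivative_at_within)
  next
    show "\<And>y. y \<in> ?S \<Longrightarrow> norm ((deriv ^^ Suc 2) f y) \<le> B" by (rule B(1))
    show "x0 \<in> ?S" using r by simp
  qed (use that in auto)
  show thesis
  proof (rule that[of "B / 2" "deriv f x0" "deriv (deriv f) x0 / 2"])
    show "0 \<le> B / 2" using B by simp
    fix x assume "dist x x0 < r / 2"
    then show "norm (f x - (f x0 + deriv f x0 * (x - x0) + deriv (deriv f) x0 / 2 * (x - x0)\<^sup>2)) \<le> B / 2 * norm (x - x0) ^ 3"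
    proof -
      have s: "(\<Sum>i\<le>2. a i) = a 0 + a 1 + a (2::nat)" for a :: "nat \<Rightarrow> complex"
        by (simp add: atMost_Suc numeral_2_eq_2)
      have "(deriv ^^ 2) f = deriv (deriv f)" by (simp add: numeral_2_eq_2)
      moreover have "x \<in> ?S" using \<open>dist x x0 < r / 2\<close> by (simp add: dist_commute)
      moreover have "B * norm (x - x0) ^ Suc 2 / fact 2 = B / 2 * norm (x - x0) ^ 3"
        by (simp add: fact_numeral)
      ultimately show ?thesis using T[of x] unfolding s by simp
    qed
  qed
qed

lemma harmonic_at_expansion:
  assumes "harmonic_at H x0"
  obtains \<alpha> \<beta> C r where "0 < r" "0 \<le> C"
    "\<And>x. dist x x0 < r \<Longrightarrow> \<bar>H x - (H x0 + Re (\<alpha> * (x - x0) + \<beta> * (x - x0)\<^sup>2))\<bar> \<le> C * dist x x0 ^ 3"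
proof -
  obtain r f where r: "r > 0" and f: "f holomorphic_on ball x0 r" "\<And>x. x \<in> ball x0 r \<Longrightarrow> H x = Re (f x)"
    using assms unfolding harmonic_at_def by blast
  obtain \<alpha> \<beta> C where C: "0 \<le> C"
    "\<And>x. dist x x0 < r / 2 \<Longrightarrow> norm (f x - (f x0 + \<alpha> * (x - x0) + \<beta> * (x - x0)\<^sup>2)) \<le> C * norm (x - x0) ^ 3"
    by (rule holomorphic_Taylor_order_2[OF f(1) r]) (rule that; assumption)
  show thesis
  proof (rule that[of "r / 2" C \<alpha> \<beta>])
    fix x assume x: "dist x x0 < r / 2"
    have "\<bar>Re (f x - (f x0 + \<alpha> * (x - x0) + \<beta> * (x - x0)\<^sup>2))\<bar> \<le> C * norm (x - x0) ^ 3"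
      using C(2)[OF x] abs_Re_le_cmod order_trans by blast
    moreover have "H x = Re (f x)" "H x0 = Re (f x0)" using f(2) x r by (auto simp: dist_commute)
    ultimately show "\<bar>H x - (H x0 + Re (\<alpha> * (x - x0) + \<beta> * (x - x0)\<^sup>2))\<bar> \<le> C * dist x x0 ^ 3"
      by (simp add: dist_norm add.assoc)
  qed (use r C in auto)
qed

lemma harmonic_at_const [simp]: "harmonic_at (\<lambda>_. c) x0"
  unfolding harmonic_at_def by (intro exI[of _ 1] conjI exI[of _ "\<lambda>_. of_real c"]) auto

lemma harmonic_at_add:
  assumes "harmonic_at G x0" "harmonic_at H x0"
  shows "harmonic_at (\<lambda>x. G x + H x) x0"
proof -
  obtain r f where r: "r > 0" "f holomorphic_on ball x0 r" "\<And>x. x \<in> ball x0 r \<Longrightarrow> G x = Re (f x)"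
    using assms(1) unfolding harmonic_at_def by blast
  obtain s g where s: "s > 0" "g holomorphic_on ball x0 s" "\<And>x. x \<in> ball x0 s \<Longrightarrow> H x = Re (g x)"
    using assms(2) unfolding harmonic_at_def by blast
  show ?thesis unfolding harmonic_at_def
  proof (intro exI[of _ "min r s"] exI[of _ "\<lambda>x. f x + g x"] conjI)
    show "(\<lambda>x. f x + g x) holomorphic_on ball x0 (min r s)"
      using r s by (intro holomorphic_on_add) (auto elim: holomorphic_on_subset)
  qed (use r s in auto)
qed

lemma harmonic_at_cmult:
  assumes "harmonic_at H x0"
  shows "harmonic_at (\<lambda>x. c * H x) x0"
proof -
  obtain r f where r: "r > 0" "f holomorphic_on ball x0 r" "\<And>x. x \<in> ball x0 r \<Longrightarrow> H x = Re (f x)"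
    using assms(1) unfolding harmonic_at_def by blast
  show ?thesis unfolding harmonic_at_def
    by (intro exI[of _ r] exI[of _ "\<lambda>x. of_real c * f x"] conjI) (use r in \<open>auto intro: holomorphic_intros\<close>)
qed

lemma harmonic_at_sum:
  assumes "finite I" "\<And>i. i \<in> I \<Longrightarrow> harmonic_at (H i) x0"
  shows "harmonic_at (\<lambda>x. \<Sum>i\<in>I. H i x) x0"
  using assms by (induction I rule: finite_induct) (auto intro: harmonic_at_add)

lemma harmonic_at_ln_norm:
  assumes f: "f holomorphic_on S" "open S" "x0 \<in> S" and nz: "f x0 \<noteq> 0"
  shows "harmonic_at (\<lambda>x. ln (norm (f x))) x0"
proof -
  have "continuous_on S (\<lambda>x. f x / f x0)"
    using f holomorphic_on_imp_continuous_on nz by (intro continuous_intros) auto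
  then obtain d where d: "d > 0" "\<And>x. x \<in> S \<Longrightarrow> dist x x0 < d \<Longrightarrow> dist (f x / f x0) (f x0 / f x0) < 1"
    using f(3) unfolding continuous_on_iff by (meson zero_less_one)
  obtain e where e: "e > 0" "ball x0 e \<subseteq> S" using f by (meson open_contains_ball)
  have pos: "f x / f x0 \<notin> \<real>\<^sub>\<le>\<^sub>0" if "x \<in> ball x0 (min d e)" for x
  proof -
    have "norm (f x / f x0 - 1) < 1"
    proof -
      have "x \<in> S" "dist x x0 < d" using that e by (auto simp: dist_commute)
      then show ?thesis using d(2)[of x] nz by (simp add: dist_norm)
    qed
    then have "Re (f x / f x0) > 0" using abs_Re_le_cmod[of "f x / f x0 - 1"] by auto
    then show ?thesis by (auto simp: complex_nonpos_Reals_iff)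
  qed
  show ?thesis unfolding harmonic_at_def
  proof (intro exI[of _ "min d e"] exI[of _ "\<lambda>x. Ln (f x / f x0) + of_real (ln (norm (f x0)))"] conjI ballI)
    show "(\<lambda>x. Ln (f x / f x0) + of_real (ln (norm (f x0)))) holomorphic_on ball x0 (min d e)"
    proof -
      have "ball x0 (min d e) \<subseteq> S" using e by auto
      then have "f holomorphic_on ball x0 (min d e)" using f(1) by (rule holomorphic_on_subset[rotated])
      then show ?thesis using pos nz by (intro holomorphic_intros) auto
    qed
    fix x assume x: "x \<in> ball x0 (min d e)"
    have "f x \<noteq> 0" using pos[OF x] nz by auto
    then show "ln (norm (f x)) = Re (Ln (f x / f x0) + of_real (ln (norm (f x0))))"
      using nz by (simp add: Re_Ln norm_divide ln_div)
  qed (use d e in auto)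
qed

text \<open>Otherwise \<open>V - H + \<delta> \<bar>x\<bar>^2\<close> with small \<open>\<delta>\<close> has its maximum at an interior
  point \<open>x0\<close>. Near \<open>x0\<close> the function \<open>H - \<delta> \<bar>x\<bar>^2\<close> is a harmonic quadratic polynomial minus
  \<open>\<delta> \<bar>x - x0\<bar>^2\<close>, up to cubic terms, so touching with the constant \<open>\<delta>/4\<close> produces a larger value
  nearby.\<close>
lemma maximum_principle:
  assumes X: "open X" "bounded X"
    and V: "usc_real_on (closure X) V"
    and H: "continuous_on (closure X) H"
    and bdry: "\<And>x. x \<in> closure X \<Longrightarrow> x \<notin> X \<Longrightarrow> V x \<le> H x"
    and sub: "\<And>x. x \<in> X \<Longrightarrow> subharmonic_touching V x"
    and harm: "\<And>x. x \<in> X \<Longrightarrow> harmonic_at H x"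
    and x: "x \<in> X"
  shows "V x \<le> H x"
proof (rule ccontr)
  assume "\<not> V x \<le> H x"
  then have pos: "V x - H x > 0" by simp
  obtain R where R: "R > 0" "\<And>y. y \<in> closure X \<Longrightarrow> norm y \<le> R"
    using X(2) bounded_closure[of X] unfolding bounded_pos by blast
  \<comment> \<open>The perturbation by \<open>\<delta> \<bar>y\<bar>^2\<close> costs at most half of \<open>V x - H x\<close>, so the maximum cannot move to the boundary.\<close>
  define \<delta> where "\<delta> = (V x - H x) / (2 * R\<^sup>2)"
  have \<delta>: "\<delta> > 0" using pos R by (simp add: \<delta>_def)
  define g where "g = (\<lambda>y. V y + (- H y + \<delta> * (norm y)\<^sup>2))"
  have usc_g: "usc_real_on (closure X) g"
    unfolding g_def by (intro usc_real_on_add_continuous V continuous_intros H)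
  have comp: "compact (closure X)" using X(2) by (simp add: compact_closure)
  have xX: "x \<in> closure X" using x closure_subset by auto
  then have ne: "closure X \<noteq> {}" by auto
  obtain x0 where x0: "x0 \<in> closure X" "\<And>y. y \<in> closure X \<Longrightarrow> g y \<le> g x0"
    using usc_real_on_attains_max[OF comp ne usc_g] by (elim bexE) blast
  have "x0 \<in> X"
  proof (rule ccontr)
    assume "x0 \<notin> X"
    then have "V x0 \<le> H x0" using bdry x0 by blast
    moreover have "\<delta> * (norm x0)\<^sup>2 \<le> \<delta> * R\<^sup>2"
      using R(2)[OF x0(1)] \<delta> by (intro mult_left_mono power_mono) auto
    moreover have "\<delta> * R\<^sup>2 = (V x - H x) / 2" using R by (simp add: \<delta>_def)
    moreover have "0 \<le> \<delta> * (norm x)\<^sup>2" using \<delta> by simp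
    ultimately show False using x0(2)[OF xX] pos by (simp add: g_def)
  qed
  obtain \<alpha> \<beta> C r where E: "0 < r" "0 \<le> C"
    "\<And>y. dist y x0 < r \<Longrightarrow> \<bar>H y - (H x0 + Re (\<alpha> * (y - x0) + \<beta> * (y - x0)\<^sup>2))\<bar> \<le> C * dist y x0 ^ 3"
    by (rule harmonic_at_expansion[OF harm[OF \<open>x0 \<in> X\<close>]]) (rule that; assumption)
  obtain e where e: "e > 0" "ball x0 e \<subseteq> X" using \<open>x0 \<in> X\<close> X(1) by (meson open_contains_ball)
  define r' where "r' = min (min r e) (\<delta> / (4 * (C + 1)))"
  have r': "r' > 0" using E e \<delta> by (simp add: r'_def)
  obtain y where y: "0 < dist y x0" "dist y x0 < r'"
    "V x0 + Re ((\<alpha> - 2 * of_real \<delta> * cnj x0) * (y - x0) + \<beta> * (y - x0)\<^sup>2) - \<delta> / 4 * (dist y x0)\<^sup>2 \<le> V y"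
    using sub[OF \<open>x0 \<in> X\<close>, unfolded subharmonic_touching_def, rule_format,
        of "\<delta> / 4" r' "\<alpha> - 2 * of_real \<delta> * cnj x0" \<beta>] r' \<delta> by auto
  let ?d = "dist y x0"
  have yX: "y \<in> closure X" using y(2) e closure_subset by (force simp: r'_def dist_commute)
  have "C * ?d \<le> \<delta> / 4"
  proof -
    have "C * ?d \<le> (C + 1) * (\<delta> / (4 * (C + 1)))"
      using y E by (intro mult_mono) (auto simp: r'_def)
    also have "\<dots> = \<delta> / 4" using E(2) by (simp add: divide_simps)
    finally show ?thesis .
  qed
  then have "C * ?d * ?d\<^sup>2 \<le> \<delta> / 4 * ?d\<^sup>2" by (intro mult_right_mono) auto
  then have "C * ?d ^ 3 \<le> \<delta> / 4 * ?d\<^sup>2" by (simp add: power3_eq_cube power2_eq_square)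
  then have Hy: "H y \<le> H x0 + Re (\<alpha> * (y - x0) + \<beta> * (y - x0)\<^sup>2) + \<delta> / 4 * ?d\<^sup>2"
    using E(3)[of y] y(2) by (simp add: r'_def abs_le_iff del: times_complex.sel plus_complex.sel)
  have ny: "(norm y)\<^sup>2 = (norm x0)\<^sup>2 + 2 * Re (cnj x0 * (y - x0)) + ?d\<^sup>2"
    by (simp add: dist_norm cmod_power2) (simp add: power2_eq_square algebra_simps)
  have "Re ((\<alpha> - 2 * of_real \<delta> * cnj x0) * (y - x0) + \<beta> * (y - x0)\<^sup>2)
      = Re (\<alpha> * (y - x0) + \<beta> * (y - x0)\<^sup>2) - 2 * \<delta> * Re (cnj x0 * (y - x0))"
    by (simp add: algebra_simps)
  then have "g y \<ge> g x0 + \<delta> / 2 * ?d\<^sup>2"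
    using y(3) Hy unfolding g_def ny by (simp add: algebra_simps)
  moreover have "\<delta> / 2 * ?d\<^sup>2 > 0" using \<delta> y by simp
  ultimately show False using x0(2)[OF yX] by simp
qed

section \<open>The logarithmic potential of a planar set\<close>

lemma measure_cball_complex: "0 \<le> r \<Longrightarrow> measure lborel (cball (c::complex) r) = pi * r\<^sup>2"
  using content_cball[of r c] by (simp add: unit_ball_vol_2)

text \<open>The Vitali covering theorem fills the open set by disjoint discs up to a null set; finitely many
  of them already carry half of the area.\<close>
lemma finite_disjoint_discs_in_open_set:
  fixes F :: "complex set"
  assumes F: "open F" "bounded F" and m: "0 < measure lborel F"
  obtains I :: "(complex \<times> real) set"
  where "finite I" "\<And>y r. (y, r) \<in> I \<Longrightarrow> 0 < r \<and> cball y r \<subseteq> F"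
    "disjoint_family_on (\<lambda>(y, r). cball y r) I"
    "measure lborel F / 2 < (\<Sum>(y, r)\<in>I. pi * r\<^sup>2)"
proof -
  define K where "K = {(y, r). 0 < r \<and> cball y r \<subseteq> F}"
  define D where "D = (\<lambda>i::complex \<times> real. cball (fst i) (snd i))"
  have fin: "emeasure lborel F < \<infinity>" using F(2) emeasure_bounded_finite by blast
  obtain C where C: "countable C" "C \<subseteq> K"
     "pairwise (\<lambda>i j. disjnt (cball (fst i) (snd i)) (cball (fst j) (snd j))) C"
     "negligible (F - (\<Union>i \<in> C. cball (fst i) (snd i)))"
  proof (rule Vitali_covering_theorem_cballs[of K snd F fst])
    show "0 < snd i" if "i \<in> K" for i using that by (auto simp: K_def)
    fix x and d :: real assume x: "x \<in> F" and d: "0 < d"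
    obtain e where e: "e > 0" "cball x e \<subseteq> F" using F(1) x by (meson open_contains_cball)
    show "\<exists>i. i \<in> K \<and> x \<in> cball (fst i) (snd i) \<and> snd i < d"
    proof (intro exI[of _ "(x, min e (d / 2))"] conjI)
      have "cball x (min e (d / 2)) \<subseteq> cball x e" by auto
      then show "(x, min e (d / 2)) \<in> K" using e d by (auto simp: K_def)
    qed (use e d in auto)
  qed (rule that; assumption)
  have Cne: "C \<noteq> {}"
  proof
    assume "C = {}"
    then have "negligible F" using C(4) by simp
    then have "measure lebesgue F = 0" by (rule negligible_imp_measure0)
    then have "measure lborel F = 0" using F(1) by simp
    then show False using m by simp
  qed
  define e where "e = from_nat_into C"
  have eC: "range e = C" unfolding e_def using Cne C(1) by (rule range_from_nat_into)
  define A where "A = (\<lambda>n::nat. \<Union>k\<le>n. D (e k))"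
  have Ameas: "range A \<subseteq> sets lborel" by (auto simp: A_def D_def)
  have inc: "incseq A" unfolding A_def incseq_def by force
  have UA: "(\<Union>n. A n) = (\<Union>i\<in>C. D i)" unfolding A_def eC[symmetric] by auto
  have Um: "(\<Union>i\<in>C. D i) \<in> sets borel"
    using C(1) by (intro sets.countable_UN') (auto simp: D_def)
  have "emeasure lborel F \<le> emeasure lborel ((F - (\<Union>i\<in>C. D i)) \<union> (\<Union>i\<in>C. D i))"
    using F(1) Um by (intro emeasure_mono) auto
  also have "\<dots> \<le> emeasure lborel (F - (\<Union>i\<in>C. D i)) + emeasure lborel (\<Union>i\<in>C. D i)"
    using F(1) Um by (intro emeasure_subadditive) auto
  also have "emeasure lborel (F - (\<Union>i\<in>C. D i)) = 0"
  proof -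
    have "F - (\<Union>i\<in>C. D i) \<in> null_sets lebesgue"
      using C(4) by (simp add: D_def negligible_iff_null_sets)
    moreover have "F - (\<Union>i\<in>C. D i) \<in> sets lborel" using F(1) Um by auto
    ultimately show ?thesis
      using emeasure_completion[of "F - (\<Union>i\<in>C. D i)" lborel] by (simp add: null_sets_def)
  qed
  finally have le: "emeasure lborel F \<le> emeasure lborel (\<Union>n. A n)" by (simp add: UA)
  have eF: "emeasure lborel F = ennreal (measure lborel F)"
    using fin by (simp add: emeasure_eq_ennreal_measure)
  have "(\<lambda>n. emeasure lborel (A n)) \<longlonglongrightarrow> emeasure lborel (\<Union>n. A n)"
    using Ameas inc by (rule Lim_emeasure_incseq)
  moreover have "ennreal (measure lborel F / 2) < emeasure lborel (\<Union>n. A n)"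
    using le m by (rule_tac less_le_trans[OF _ le]) (simp add: eF ennreal_less_iff)
  ultimately have "eventually (\<lambda>n. ennreal (measure lborel F / 2) < emeasure lborel (A n)) sequentially"
    by (rule order_tendstoD(1))
  then obtain n where n: "ennreal (measure lborel F / 2) < emeasure lborel (A n)"
    by (meson eventually_sequentially order_refl)
  define I where "I = e ` {..n}"
  have IC: "I \<subseteq> C" using eC by (auto simp: I_def)
  have disj: "disjoint_family_on D I"
    using C(3) IC unfolding disjoint_family_on_def pairwise_def disjnt_def D_def by (meson subsetD)
  have AI: "A n = (\<Union>i\<in>I. D i)" by (auto simp: A_def I_def)
  have "measure lborel (A n) = (\<Sum>i\<in>I. measure lborel (D i))"
    unfolding AI using disj emeasure_lborel_cball_finite
    by (intro measure_finite_Union) (auto simp: I_def D_def less_top[symmetric])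
  also have "\<dots> = (\<Sum>(y, r)\<in>I. pi * r\<^sup>2)"
    using IC C(2) by (intro sum.cong) (auto simp: D_def K_def measure_cball_complex less_imp_le dest!: subsetD)
  finally have mA: "measure lborel (A n) = (\<Sum>(y, r)\<in>I. pi * r\<^sup>2)" .
  have "A n \<subseteq> F" using IC C(2) by (force simp: AI D_def K_def)
  then have "emeasure lborel (A n) < \<infinity>" 
    using fin F(1) emeasure_mono[of "A n" F lborel] by (simp add: order_le_less_trans)
  then have "emeasure lborel (A n) = ennreal (measure lborel (A n))"
    by (simp add: emeasure_eq_ennreal_measure)
  then have "measure lborel F / 2 < measure lborel (A n)"
    using n m by (simp add: ennreal_less_iff)
  then show thesis
  proof (intro that[of I])
    show "0 < r \<and> cball y r \<subseteq> F" if "(y, r) \<in> I" for y r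
      using that IC C(2) unfolding K_def by blast
    show "disjoint_family_on (\<lambda>(y, r). cball y r) I"
      using disj by (simp add: D_def case_prod_unfold)
  qed (use mA in \<open>auto simp: I_def\<close>)
qed

text \<open>Each halving of \<open>\<delta>\<close> that stays above \<open>d\<close> contributes 1 to the right-hand side and at most \<open>ln 2 < 1\<close>
  to the left-hand side.\<close>
lemma ln_ratio_le_dyadic_count:
  fixes \<delta> d :: real
  assumes "0 < \<delta>" "0 < d" "\<delta> / 2 ^ N \<le> d"
  shows "ln (\<delta> / d) \<le> (\<Sum>k<N. if d < \<delta> / 2 ^ k then 1 else 0)"
  using assms
proof (induction N)
  case 0
  then show ?case by simp
next
  case (Suc N)
  show ?case
  proof (cases "\<delta> / 2 ^ N \<le> d")
    case True
    then show ?thesis using Suc.IH[OF Suc.prems(1,2) True] by simp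
  next
    case False
    have small: "d < \<delta> / 2 ^ k" if "k < Suc N" for k
    proof -
      have "(2::real) ^ k \<le> 2 ^ N" using that by (intro power_increasing) auto
      then have "\<delta> / 2 ^ N \<le> \<delta> / 2 ^ k" using Suc.prems by (simp add: frac_le)
      then show ?thesis using False by simp
    qed
    have "\<delta> / d \<le> 2 ^ Suc N" using Suc.prems by (simp add: divide_simps mult.commute)
    then have "ln (\<delta> / d) \<le> ln (2 ^ Suc N)" using Suc.prems by (simp del: power_Suc)
    also have "\<dots> = real (Suc N) * ln 2" by (rule ln_realpow)
    also have "\<dots> \<le> real (Suc N)" using ln_2_less_1 by (simp add: mult_left_le)
    also have "\<dots> = (\<Sum>k<Suc N. if d < \<delta> / 2 ^ k then 1 else 0)"
      using small by simp
    finally show ?thesis .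
  qed
qed

text \<open>A disjoint family of discs has, up to a constant, no larger logarithmic potential than a
  single disc of the same total area. The discs whose centres lie within distance \<open>t\<close> of \<open>x\<close> have total
  area at most \<open>4 \<pi> t^2\<close>, because \<open>x\<close> is outside all of them and they are contained in the disc of radius
  \<open>2 t\<close>. Summing this over the dyadic scales \<open>t = \<delta> / 2^k\<close> gives a convergent geometric series.\<close>
lemma potential_of_disjoint_discs_le:
  fixes I :: "(complex \<times> real) set"
  assumes I: "finite I" and pos: "\<And>y r. (y, r) \<in> I \<Longrightarrow> 0 < r"
    and disj: "disjoint_family_on (\<lambda>(y, r). cball y r) I"
    and out: "\<And>y r. (y, r) \<in> I \<Longrightarrow> r \<le> dist x y"
    and \<delta>: "0 < \<delta>" "(\<Sum>(y, r)\<in>I. r\<^sup>2) = \<delta>\<^sup>2"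
  shows "(\<Sum>(y, r)\<in>I. r\<^sup>2 * ln (1 / dist x y)) \<le> \<delta>\<^sup>2 * (ln (1 / \<delta>) + 6)"
proof -
  have area: "(\<Sum>i\<in>{i \<in> I. dist x (fst i) < t}. (snd i)\<^sup>2) \<le> 4 * t\<^sup>2" if t: "0 < t" for t
  proof -
    let ?J = "{i \<in> I. dist x (fst i) < t}"
    let ?D = "\<lambda>i::complex \<times> real. cball (fst i) (snd i)"
    have "disjoint_family_on ?D ?J"
      using disj unfolding disjoint_family_on_def by (auto simp: case_prod_unfold)
    then have "measure lborel (\<Union>i\<in>?J. ?D i) = (\<Sum>i\<in>?J. measure lborel (?D i))"
      using I emeasure_lborel_cball_finite
      by (intro measure_finite_Union) (auto simp: less_top[symmetric])
    also have "\<dots> = (\<Sum>i\<in>?J. pi * (snd i)\<^sup>2)"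
      using pos by (intro sum.cong) (auto simp: measure_cball_complex less_imp_le)
    finally have eq: "measure lborel (\<Union>i\<in>?J. ?D i) = pi * (\<Sum>i\<in>?J. (snd i)\<^sup>2)"
      by (simp add: sum_distrib_left)
    have sub: "(\<Union>i\<in>?J. ?D i) \<subseteq> cball x (2 * t)"
    proof clarsimp
      fix y r z assume a: "(y, r) \<in> I" "dist x y < t" "dist y z \<le> r"
      have "dist x z \<le> dist x y + dist y z" by (rule dist_triangle)
      then show "dist x z \<le> 2 * t" using a out[OF a(1)] by linarith
    qed
    have "measure lborel (\<Union>i\<in>?J. ?D i) \<le> measure lborel (cball x (2 * t))"
      using I sub emeasure_lborel_cball_finite
      by (intro measure_mono_fmeasurable sub) (auto simp: fmeasurable_def)
    also have "\<dots> = pi * (4 * t\<^sup>2)" using t by (simp add: measure_cball_complex power_mult_distrib)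
    finally show ?thesis unfolding eq by (simp add: mult_le_cancel_left_pos)
  qed
  have dpos: "0 < dist x (fst i)" if "i \<in> I" for i
    using pos out that by (metis less_le_trans prod.collapse)
  have "eventually (\<lambda>N. \<forall>i\<in>I. \<delta> / 2 ^ N \<le> dist x (fst i)) sequentially"
  proof (intro eventually_ball_finite I ballI)
    fix i assume "i \<in> I"
    have "(\<lambda>N. \<delta> * (1 / 2) ^ N) \<longlonglongrightarrow> \<delta> * 0"
      by (intro tendsto_intros LIMSEQ_power_zero) auto
    then have "eventually (\<lambda>N. \<delta> * (1 / 2) ^ N < dist x (fst i)) sequentially"
      using dpos[OF \<open>i \<in> I\<close>] by (intro order_tendstoD(2)) auto
    then show "eventually (\<lambda>N. \<delta> / 2 ^ N \<le> dist x (fst i)) sequentially"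
      by eventually_elim (simp add: power_divide)
  qed
  then obtain N where N: "\<And>i. i \<in> I \<Longrightarrow> \<delta> / 2 ^ N \<le> dist x (fst i)"
    by (auto simp: eventually_sequentially)
  have "(\<Sum>i\<in>I. (snd i)\<^sup>2 * ln (\<delta> / dist x (fst i)))
     \<le> (\<Sum>i\<in>I. (snd i)\<^sup>2 * (\<Sum>k<N. if dist x (fst i) < \<delta> / 2 ^ k then 1 else 0))"
    by (intro sum_mono mult_left_mono ln_ratio_le_dyadic_count \<delta> dpos N) auto
  also have "\<dots> = (\<Sum>k<N. \<Sum>i\<in>I. if dist x (fst i) < \<delta> / 2 ^ k then (snd i)\<^sup>2 else 0)"
    unfolding sum_distrib_left by (subst sum.swap) (auto intro!: sum.cong)
  also have "\<dots> = (\<Sum>k<N. \<Sum>i\<in>{i \<in> I. dist x (fst i) < \<delta> / 2 ^ k}. (snd i)\<^sup>2)"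
    by (rule sum.cong[OF refl]) (rule sum.inter_filter[OF I, symmetric])
  also have "\<dots> \<le> (\<Sum>k<N. 4 * (\<delta> / 2 ^ k)\<^sup>2)"
    using \<delta> by (intro sum_mono area) auto
  also have "\<dots> = 4 * \<delta>\<^sup>2 * (\<Sum>k<N. (1 / 4) ^ k)"
    by (simp add: sum_distrib_left power_divide power_mult[symmetric] mult.commute[of _ 2])
      (simp add: power_mult)
  also have "\<dots> \<le> 4 * \<delta>\<^sup>2 * (3 / 2)"
  proof (intro mult_left_mono)
    have "(\<Sum>k<N. (1 / 4 :: real) ^ k) \<le> 4 / 3"
    proof -
      have "(\<Sum>k<N. (1 / 4 :: real) ^ k) = ((1 / 4) ^ N - 1) / (1 / 4 - 1)"
        by (rule geometric_sum) simp
      also have "\<dots> = 4 / 3 * (1 - (1 / 4) ^ N)" by (simp add: field_simps)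
      finally show ?thesis by simp
    qed
    then show "(\<Sum>k<N. (1 / 4 :: real) ^ k) \<le> 3 / 2" by linarith
  qed simp
  finally have 1: "(\<Sum>i\<in>I. (snd i)\<^sup>2 * ln (\<delta> / dist x (fst i))) \<le> 6 * \<delta>\<^sup>2" by simp
  have "(\<Sum>(y, r)\<in>I. r\<^sup>2 * ln (1 / dist x y))
      = (\<Sum>i\<in>I. (snd i)\<^sup>2 * ln (\<delta> / dist x (fst i)) + (snd i)\<^sup>2 * ln (1 / \<delta>))"
    unfolding case_prod_unfold using dpos \<delta>
    by (intro sum.cong refl) (simp add: ln_div ring_distribs[symmetric] del: dist_pos_lt)
  also have "\<dots> = (\<Sum>i\<in>I. (snd i)\<^sup>2 * ln (\<delta> / dist x (fst i))) + \<delta>\<^sup>2 * ln (1 / \<delta>)"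
    using \<delta>(2) by (simp add: sum.distrib sum_distrib_right[symmetric] case_prod_unfold)
  finally show ?thesis using 1 by (simp add: ring_distribs)
qed

text \<open>The function \<open>h\<close> is the normalised Green potential of the area measure on disjoint discs that fill
  half of \<open>F\<close>. Each disc is replaced by a point mass at its centre, weighted by the squared radius; \<open>Q\<close> and
  \<open>Y\<close> are the unions of the open and closed discs, so \<open>h\<close> is used only outside \<open>Q\<close> and the poles do
  no harm. The upper bound 1 is the potential estimate for disjoint discs: the exponent \<open>R\<close> controls the
  logarithm of the total radius, and 7 absorbs the absolute constants. The lower bound on the disc of radius
  \<open>\<rho>\<close> holds because all masses lie in that disc, at distance at most \<open>2 \<rho>\<close>.\<close>
lemma logarithmic_potential_of_open_set:
  fixes F :: "complex set" and \<rho> R :: real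
  assumes F: "open F" "F \<subseteq> ball 0 \<rho>" and \<rho>: "0 < \<rho>" "\<rho> \<le> 1 / 2"
    and area: "2 * pi * exp (- 2 * R) \<le> measure lborel F"
  obtains Q Y h where "open Q" "closed Y" "Q \<subseteq> Y" "Y \<subseteq> F"
    "continuous_on (cball 0 1 - Q) h"
    "\<And>x. x \<in> ball 0 1 - Y \<Longrightarrow> harmonic_at h x"
    "\<And>x. x \<in> cball 0 1 - Q \<Longrightarrow> 0 \<le> h x \<and> h x \<le> 1"
    "\<And>x. norm x = 1 \<Longrightarrow> h x = 0"
    "\<And>x. norm x \<le> \<rho> \<Longrightarrow> x \<notin> Q \<Longrightarrow> (ln (1 / \<rho>) - 2) / (R + 7) \<le> h x"
    "ln (1 / \<rho>) < R"
proof -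
  have bF: "bounded F" using F(2) bounded_subset by blast
  have "0 < 2 * pi * exp (- 2 * R)" by simp
  then have m0: "0 < measure lborel F" using area by linarith
  obtain I :: "(complex \<times> real) set" where I: "finite I"
    "\<And>y r. (y, r) \<in> I \<Longrightarrow> 0 < r \<and> cball y r \<subseteq> F"
    "disjoint_family_on (\<lambda>(y, r). cball y r) I"
    "measure lborel F / 2 < (\<Sum>(y, r)\<in>I. pi * r\<^sup>2)"
    by (rule finite_disjoint_discs_in_open_set[OF F(1) bF m0]) (rule that; assumption)
  define S where "S = (\<Sum>(y, r)\<in>I. r\<^sup>2)"
  have piS: "(\<Sum>(y, r)\<in>I. pi * r\<^sup>2) = pi * S"
    by (simp add: S_def sum_distrib_left case_prod_unfold)
  have "pi * exp (- 2 * R) < pi * S" using I(4) area unfolding piS by linarith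
  then have Sgt: "exp (- 2 * R) < S" by simp
  then have S0: "0 < S" using exp_gt_zero less_trans by blast
  define \<delta> where "\<delta> = sqrt S"
  have \<delta>0: "0 < \<delta>" and \<delta>2: "\<delta>\<^sup>2 = S" using S0 by (auto simp: \<delta>_def)
  have "(exp (- R))\<^sup>2 < \<delta>\<^sup>2" using Sgt unfolding \<delta>2 by (simp add: exp_double[symmetric])
  then have "exp (- R) < \<delta>" using \<delta>0 by (rule power2_less_imp_less[OF _ less_imp_le])
  then have "ln (exp (- R)) < ln \<delta>" using \<delta>0 by (subst ln_less_cancel_iff) auto
  then have ln\<delta>: "ln (1 / \<delta>) < R" using \<delta>0 by (simp add: ln_div)
  \<comment> \<open>Comparing areas, the lower bound on the area of \<open>F\<close> forces \<open>e^(-R) < \<rho>\<close>.\<close>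
  have "measure lborel F \<le> measure lborel (cball (0::complex) \<rho>)"
    using F(2) F(1) ball_subset_cball emeasure_lborel_cball_finite[of "0::complex" \<rho>]
    by (intro measure_mono_fmeasurable) (auto simp: fmeasurable_def)
  also have "\<dots> = pi * \<rho>\<^sup>2" using \<rho> by (intro measure_cball_complex) simp
  finally have "pi * (2 * exp (- 2 * R)) \<le> pi * \<rho>\<^sup>2" using area by linarith
  then have "2 * exp (- 2 * R) \<le> \<rho>\<^sup>2" by (rule mult_left_le_imp_le) simp
  then have "exp (- 2 * R) < \<rho>\<^sup>2" using exp_gt_zero[of "- 2 * R"] by linarith
  then have "(exp (- R))\<^sup>2 < \<rho>\<^sup>2" by (simp add: exp_double[symmetric])
  then have "exp (- R) < \<rho>" using \<rho> by (rule_tac power2_less_imp_less) auto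
  then have "ln (exp (- R)) < ln \<rho>" using \<rho> by (subst ln_less_cancel_iff) auto
  then have R1: "ln (1 / \<rho>) < R" using \<rho> by (simp add: ln_div)
  have "0 \<le> ln (1 / \<rho>)" using \<rho> by (intro ln_ge_zero) auto
  then have R0: "0 < R" using R1 by linarith
  \<comment> \<open>The Blaschke factor: \<open>- ln \<bar>b y x\<bar>\<close> is the Green function of the unit disc with pole \<open>y\<close>.\<close>
  define b where "b = (\<lambda>y x::complex. (x - y) / (1 - cnj y * x))"
  define h where "h = (\<lambda>x. (\<Sum>(y, r)\<in>I. r\<^sup>2 * (- ln (norm (b y x)))) / (S * (R + 7)))"
  define Q where "Q = (\<Union>(y, r)\<in>I. ball y r)"
  define Y where "Y = (\<Union>(y, r)\<in>I. cball y r)"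
  have YF: "Y \<subseteq> F" unfolding Y_def using I(2) by blast
  have QY: "Q \<subseteq> Y" unfolding Q_def Y_def by (intro UN_mono) auto
  have ny: "norm y < \<rho>" if "(y, r) \<in> I" for y r
    using I(2)[OF that] F(2) by (auto simp: subset_iff)
  have ny1: "norm y < 1" if "(y, r) \<in> I" for y r using ny[OF that] \<rho> by simp
  have den: "1 - cnj y * x \<noteq> 0" if "norm y < 1" "norm x \<le> 1" for x y
  proof
    assume "1 - cnj y * x = 0"
    then have "norm (cnj y * x) = 1" by (metis eq_iff_diff_eq_0 norm_one)
    moreover have "norm (cnj y * x) \<le> norm y * 1" using that by (simp add: norm_mult mult_left_le)
    ultimately show False using that by simp
  qed
  have ident: "(norm (1 - cnj y * x))\<^sup>2 - (norm (x - y))\<^sup>2 = (1 - (norm x)\<^sup>2) * (1 - (norm y)\<^sup>2)" for x y :: complex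
    by (simp only: cmod_power2) (simp add: power2_eq_square algebra_simps)
  have bnz: "b y x \<noteq> 0" if "(y, r) \<in> I" "norm x \<le> 1" "x \<noteq> y" for y r x
    using den[OF ny1[OF that(1)] that(2)] that(3) by (simp add: b_def)
  have outQ: "r \<le> dist x y" if "x \<notin> Q" "(y, r) \<in> I" for x y r
  proof (rule ccontr)
    assume "\<not> r \<le> dist x y"
    then have "x \<in> ball y r" by (simp add: dist_commute)
    then show False using that unfolding Q_def by blast
  qed
  have neqQ: "x \<noteq> y" if "x \<notin> Q" "(y, r) \<in> I" for x y r
    using outQ[OF that] I(2)[OF that(2)] by auto
  have nb_le: "norm (b y x) \<le> 1" if "(y, r) \<in> I" "norm x \<le> 1" for y r x
  proof -
    have "0 \<le> (1 - (norm x)\<^sup>2) * (1 - (norm y)\<^sup>2)"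
      using ny1[OF that(1)] that(2) by (intro mult_nonneg_nonneg) (auto simp: abs_square_le_1[symmetric] power_le_one)
    then have "(norm (x - y))\<^sup>2 \<le> (norm (1 - cnj y * x))\<^sup>2" using ident[of y x] by linarith
    then have "norm (x - y) \<le> norm (1 - cnj y * x)" by (rule power2_le_imp_le) simp
    then show ?thesis using den[OF ny1[OF that(1)] that(2)] by (simp add: b_def norm_divide divide_le_eq)
  qed
  show thesis
  proof (rule that[of Q Y h])
    show "open Q" by (auto simp: Q_def)
    show "closed Y" using I(1) by (auto simp: Y_def)
    show "Q \<subseteq> Y" by (rule QY)
    show "Y \<subseteq> F" by (rule YF)
    show "ln (1 / \<rho>) < R" by (rule R1)
    show "continuous_on (cball 0 1 - Q) h"
      unfolding h_def case_prod_unfold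
    proof (intro continuous_intros)
      fix i assume i: "i \<in> I"
      then have i': "(fst i, snd i) \<in> I" by simp
      show "continuous_on (cball 0 1 - Q) (b (fst i))"
        unfolding b_def using den[OF ny1[OF i']] by (intro continuous_intros) auto
      show "\<forall>x\<in>cball 0 1 - Q. norm (b (fst i) x) \<noteq> 0"
        using bnz[OF i'] neqQ[OF _ i'] by auto
    qed (use S0 R0 in auto)
    show "harmonic_at h x" if x: "x \<in> ball 0 1 - Y" for x
    proof -
      have "harmonic_at (\<lambda>x. 1 / (S * (R + 7)) * (\<Sum>i\<in>I. - ((snd i)\<^sup>2) * ln (norm (b (fst i) x)))) x"
      proof (intro harmonic_at_cmult harmonic_at_sum I(1))
        fix i assume "i \<in> I"
        then have i': "(fst i, snd i) \<in> I" by simp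
        show "harmonic_at (\<lambda>x. ln (norm (b (fst i) x))) x"
        proof (rule harmonic_at_ln_norm)
          show "b (fst i) holomorphic_on ball 0 1"
            unfolding b_def using den[OF ny1[OF i']] by (intro holomorphic_intros) auto
          show "b (fst i) x \<noteq> 0" using x QY by (intro bnz[OF i'] neqQ[OF _ i']) auto
        qed (use x in auto)
      qed
      then show ?thesis by (simp add: h_def case_prod_unfold)
    qed
    show "h x = 0" if x: "norm x = 1" for x
    proof -
      have "norm (b y x) = 1" if "(y, r) \<in> I" for y r
      proof -
        have "(norm (x - y))\<^sup>2 = (norm (1 - cnj y * x))\<^sup>2" using ident[of y x] x by simp
        then have "norm (x - y) = norm (1 - cnj y * x)" by (simp add: power2_eq_iff_nonneg)
        then show ?thesis using den[OF ny1[OF that]] x by (simp add: b_def norm_divide)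
      qed
      then have "(\<Sum>(y, r)\<in>I. r\<^sup>2 * (- ln (norm (b y x)))) = 0"
        by (intro sum.neutral) (auto simp: case_prod_unfold)
      then show ?thesis by (simp add: h_def)
    qed
    show "0 \<le> h x \<and> h x \<le> 1" if x: "x \<in> cball 0 1 - Q" for x
    proof
      have nx: "norm x \<le> 1" and xQ: "x \<notin> Q" using x by auto
      have "0 \<le> (\<Sum>(y, r)\<in>I. r\<^sup>2 * (- ln (norm (b y x))))"
      proof (intro sum_nonneg, clarify)
        fix y r assume i: "(y, r) \<in> I"
        have "ln (norm (b y x)) \<le> 0"
          using nb_le[OF i nx] bnz[OF i nx neqQ[OF xQ i]] by (intro ln_le_zero_iff[THEN iffD2]) auto
        then show "0 \<le> r\<^sup>2 * (- ln (norm (b y x)))" by (simp add: mult_nonneg_nonpos)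
      qed
      then show "0 \<le> h x" unfolding h_def using S0 R0 by (intro divide_nonneg_nonneg) auto
      have "(\<Sum>(y, r)\<in>I. r\<^sup>2 * (- ln (norm (b y x)))) \<le> (\<Sum>(y, r)\<in>I. r\<^sup>2 * (ln (1 / dist x y) + 1))"
      proof (intro sum_mono, clarify)
        fix y r assume i: "(y, r) \<in> I"
        have "norm (1 - cnj y * x) \<le> norm (1::complex) + norm (cnj y * x)" by (rule norm_triangle_ineq4)
        also have "norm (cnj y * x) \<le> 1"
          using ny1[OF i] nx by (simp add: norm_mult mult_le_one)
        finally have "norm (1 - cnj y * x) \<le> 2" by simp
        then have "ln (norm (1 - cnj y * x)) \<le> ln 2" using den[OF ny1[OF i] nx] by (subst ln_le_cancel_iff) auto
        also have "ln 2 \<le> (1::real)" using ln_2_less_1 by simp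
        finally have "- ln (norm (b y x)) \<le> ln (1 / dist x y) + 1"
          using den[OF ny1[OF i] nx] neqQ[OF xQ i] by (simp add: b_def norm_divide ln_div dist_norm)
        then show "r\<^sup>2 * (- ln (norm (b y x))) \<le> r\<^sup>2 * (ln (1 / dist x y) + 1)"
          by (rule mult_left_mono) simp
      qed
      also have "\<dots> = (\<Sum>(y, r)\<in>I. r\<^sup>2 * ln (1 / dist x y)) + S"
        by (simp add: S_def case_prod_unfold ring_distribs sum.distrib)
      also have "\<dots> \<le> \<delta>\<^sup>2 * (ln (1 / \<delta>) + 6) + S"
      proof (intro add_right_mono potential_of_disjoint_discs_le)
        show "(\<Sum>(y, r)\<in>I. r\<^sup>2) = \<delta>\<^sup>2" by (simp add: \<delta>2 S_def)
      qed (use I outQ[OF xQ] \<delta>0 in auto)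
      also have "\<dots> = S * (ln (1 / \<delta>) + 7)" by (simp add: \<delta>2 ring_distribs)
      also have "\<dots> \<le> S * (R + 7)" using S0 ln\<delta> by (intro mult_left_mono) auto
      finally show "h x \<le> 1" unfolding h_def using S0 R0 by (simp add: divide_le_eq)
    qed
    show "(ln (1 / \<rho>) - 2) / (R + 7) \<le> h x" if nx: "norm x \<le> \<rho>" and xQ: "x \<notin> Q" for x
    proof -
      have nx1: "norm x \<le> 1" using nx \<rho> by simp
      have "(ln (1 / \<rho>) - 2) * S = (\<Sum>(y, r)\<in>I. r\<^sup>2 * (ln (1 / \<rho>) - 2))"
        by (simp add: S_def case_prod_unfold sum_distrib_left mult.commute)
      also have "\<dots> \<le> (\<Sum>(y, r)\<in>I. r\<^sup>2 * (- ln (norm (b y x))))"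
      proof (intro sum_mono, clarify)
        fix y r assume i: "(y, r) \<in> I"
        have yx: "norm (cnj y * x) \<le> 1 / 4"
        proof -
          have "norm (cnj y * x) \<le> (1 / 2) * (1 / 2)"
            unfolding norm_mult using ny[OF i] nx \<rho> by (intro mult_mono) auto
          then show ?thesis by simp
        qed
        have "norm (1::complex) \<le> norm (1 - cnj y * x) + norm (cnj y * x)"
          by (metis diff_add_cancel norm_triangle_ineq)
        then have d34: "3 / 4 \<le> norm (1 - cnj y * x)" using yx by simp
        have "norm (x - y) \<le> norm x + norm y" by (rule norm_triangle_ineq4)
        then have n2: "norm (x - y) \<le> 2 * \<rho>" using nx ny[OF i] by linarith
        have e3: "8 / 3 \<le> exp (2::real)" using exp_ge_add_one_self[of "2::real"] by linarith
        have "norm (b y x) \<le> (2 * \<rho>) / (3 / 4)"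
          unfolding b_def norm_divide using n2 d34 \<rho> by (intro frac_le) auto
        also have "\<dots> = \<rho> * (8 / 3)" by simp
        also have "\<dots> \<le> \<rho> * exp 2" using \<rho> e3 by (intro mult_left_mono) auto
        finally have "ln (norm (b y x)) \<le> ln (\<rho> * exp 2)"
          using bnz[OF i nx1 neqQ[OF xQ i]] \<rho> by (subst ln_le_cancel_iff) auto
        then have "ln (1 / \<rho>) - 2 \<le> - ln (norm (b y x))"
          using \<rho> by (simp add: ln_mult ln_div)
        then show "r\<^sup>2 * (ln (1 / \<rho>) - 2) \<le> r\<^sup>2 * (- ln (norm (b y x)))"
          by (rule mult_left_mono) simp
      qed
      finally have "(ln (1 / \<rho>) - 2) * S \<le> (\<Sum>(y, r)\<in>I. r\<^sup>2 * (- ln (norm (b y x))))" .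
      then have "(ln (1 / \<rho>) - 2) * S / (S * (R + 7)) \<le> h x"
        unfolding h_def using S0 R0 by (intro divide_right_mono) auto
      then show ?thesis using S0 by simp
    qed
  qed
qed

section \<open>Locally bounded plurisubharmonic functions and circular maxima\<close>

text \<open>Plurisubharmonicity with locally bounded real values. The sub-mean value inequality is
  required only on unit discs of affine lines, since scaling \<open>v\<close> gives all radii.\<close>
definition bounded_psh_on :: "(complex^'n) set \<Rightarrow> (complex^'n \<Rightarrow> real) \<Rightarrow> bool" where
  "bounded_psh_on G u \<longleftrightarrow> usc_real_on G u \<and>
     (\<forall>K\<subseteq>G. compact K \<longrightarrow> (\<exists>N. \<forall>z\<in>K. \<bar>u z\<bar> \<le> N)) \<and>
     (\<forall>z v. (\<forall>x\<in>cball 0 1. z + x *s v \<in> G) \<longrightarrow>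
        u z \<le> (LINT \<theta>:{0..2*pi}|lborel. u (z + cis \<theta> *s v)) / (2 * pi))"

lemma bounded_psh_on_mean:
  assumes "bounded_psh_on G u" "\<And>x. norm x \<le> 1 \<Longrightarrow> z + x *s v \<in> G"
  shows "u z \<le> (LINT \<theta>:{0..2*pi}|lborel. u (z + cis \<theta> *s v)) / (2 * pi)"
  using assms unfolding bounded_psh_on_def by auto

lemma set_integrable_of_bounded:
  fixes f :: "'a::euclidean_space \<Rightarrow> real"
  assumes A: "A \<in> sets borel" "emeasure lborel A < \<infinity>"
    and m: "(\<lambda>x. indicator A x * f x) \<in> borel_measurable borel"
    and b: "\<And>x. x \<in> A \<Longrightarrow> \<bar>f x\<bar> \<le> N"
  shows "set_integrable lborel A f"
  unfolding set_integrable_def real_scaleR_def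
proof (rule integrableI_bounded_set[where A = A and B = N])
  show "(\<lambda>x. indicator A x * f x) \<in> borel_measurable lborel" using m by simp
  show "AE x\<in>A in lborel. norm (indicator A x * f x) \<le> N" using b by auto
qed (use A in \<open>auto simp: indicator_def\<close>)

lemma usc_real_on_borel_measurable:
  fixes u :: "'a::euclidean_space \<Rightarrow> real"
  assumes G: "open G" and u: "usc_real_on G u"
  shows "(\<lambda>z. indicator G z * u z) \<in> borel_measurable borel"
proof (rule borel_measurableI_less)
  fix c :: real
  have "open {z \<in> G. u z < c}"
    unfolding open_dist
  proof (intro ballI)
    fix z assume z: "z \<in> {z \<in> G. u z < c}"
    obtain d where d: "d > 0" "\<And>z'. z' \<in> G \<Longrightarrow> dist z' z < d \<Longrightarrow> u z' < c"
      using usc_real_onD[OF u, of z c] z by blast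
    obtain e where e: "e > 0" "\<And>z'. dist z' z < e \<Longrightarrow> z' \<in> G"
      using G z unfolding open_dist by blast
    show "\<exists>e>0. \<forall>y. dist y z < e \<longrightarrow> y \<in> {z \<in> G. u z < c}"
      by (rule exI[of _ "min d e"]) (use d e in auto)
  qed
  moreover have "{z \<in> space borel. indicator G z * u z < c} = {z \<in> G. u z < c} \<union> (if 0 < c then - G else {})"
    by (auto simp: indicator_def split: if_splits)
  ultimately show "{z \<in> space borel. indicator G z * u z < c} \<in> sets borel"
    using G by auto
qed

text \<open>The exponentials with frequencies 1 and 2 have mean zero over a period.\<close>
lemma trigonometric_mean_zero:
  "(LINT \<theta>:{0..2*pi}|lborel. c + Re (\<alpha> * cis \<theta> + \<beta> * cis (2 * \<theta>))) = 2 * pi * c"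
  "set_integrable lborel {0..2*pi} (\<lambda>\<theta>. c + Re (\<alpha> * cis \<theta> + \<beta> * cis (2 * \<theta>)))"
proof -
  let ?f = "\<lambda>\<theta>. c + (Re \<alpha> * cos \<theta> - Im \<alpha> * sin \<theta>) + (Re \<beta> * cos (2 * \<theta>) - Im \<beta> * sin (2 * \<theta>))"
  let ?F = "\<lambda>\<theta>. c * \<theta> + (Re \<alpha> * sin \<theta> + Im \<alpha> * cos \<theta>) + (Re \<beta> * (sin (2 * \<theta>) / 2) + Im \<beta> * (cos (2 * \<theta>) / 2))"
  have eq: "c + Re (\<alpha> * cis \<theta> + \<beta> * cis (2 * \<theta>)) = ?f \<theta>" for \<theta> by simp
  have D: "DERIV ?F \<theta> :> ?f \<theta>" for \<theta>
    by (auto intro!: derivative_eq_intros)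
  have "(LINT \<theta>|lborel. ?f \<theta> * indicator {0..2*pi} \<theta>) = ?F (2*pi) - ?F 0"
    by (rule integral_FTC_Icc_real[OF _ D]) (auto intro!: continuous_intros)
  also have "\<dots> = 2 * pi * c"
    using sin_npi[of 4] cos_npi[of 4] by (simp add: mult.commute)
  finally show "(LINT \<theta>:{0..2*pi}|lborel. c + Re (\<alpha> * cis \<theta> + \<beta> * cis (2 * \<theta>))) = 2 * pi * c"
    unfolding eq set_lebesgue_integral_def by (simp add: mult.commute)
  show "set_integrable lborel {0..2*pi} (\<lambda>\<theta>. c + Re (\<alpha> * cis \<theta> + \<beta> * cis (2 * \<theta>)))"
    unfolding eq by (intro borel_integrable_atLeastAtMost' continuous_intros)
qed

text \<open>If the trigonometric polynomial, whose mean is \<open>c\<close>, exceeded \<open>g\<close> by \<open>e\<close> everywhere, then the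
  mean of \<open>g\<close> would be below \<open>c\<close>.\<close>
lemma circle_mean_touching:
  fixes g :: "real \<Rightarrow> real"
  assumes g: "set_integrable lborel {0..2*pi} g"
    and c: "c \<le> (LINT \<theta>:{0..2*pi}|lborel. g \<theta>) / (2 * pi)" and e: "0 < e"
  shows "\<exists>\<theta>. c + Re (\<alpha> * cis \<theta> + \<beta> * cis (2 * \<theta>)) - e \<le> g \<theta>"
proof (rule ccontr)
  assume "\<not> ?thesis"
  then have less: "g \<theta> \<le> (c - e) + Re (\<alpha> * cis \<theta> + \<beta> * cis (2 * \<theta>))" for \<theta>
    by (metis add_diff_eq diff_add_eq linorder_not_le nless_le)
  have "(LINT \<theta>:{0..2*pi}|lborel. g \<theta>) \<le> (LINT \<theta>:{0..2*pi}|lborel. (c - e) + Re (\<alpha> * cis \<theta> + \<beta> * cis (2 * \<theta>)))"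
    by (intro set_integral_mono g trigonometric_mean_zero(2) less)
  also have "\<dots> = 2 * pi * (c - e)" by (rule trigonometric_mean_zero)
  finally have "(LINT \<theta>:{0..2*pi}|lborel. g \<theta>) / (2 * pi) \<le> c - e"
    by (simp add: pos_divide_le_eq mult.commute)
  then show False using c e by linarith
qed

lemma usc_circle_integrable:
  assumes G: "open G" and u: "usc_real_on G u"
    and bd: "\<And>K. K \<subseteq> G \<Longrightarrow> compact K \<Longrightarrow> \<exists>N. \<forall>z\<in>K. \<bar>u z\<bar> \<le> N"
    and sub: "\<And>\<theta>. z + cis \<theta> *s v \<in> G"
  shows "set_integrable lborel {0..2*pi} (\<lambda>\<theta>. u (z + cis \<theta> *s v))"
proof -
  have cont: "continuous_on UNIV (\<lambda>\<theta>. z + cis \<theta> *s v)"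
    by (intro continuous_intros continuous_on_vec_lambda) (auto simp: vector_scalar_mult_def intro!: continuous_intros)
  define K where "K = (\<lambda>\<theta>. z + cis \<theta> *s v) ` {0..2*pi}"
  have "compact K" unfolding K_def
    by (intro compact_continuous_image continuous_on_subset[OF cont]) auto
  moreover have "K \<subseteq> G" using sub by (auto simp: K_def)
  ultimately obtain N where N: "\<And>z. z \<in> K \<Longrightarrow> \<bar>u z\<bar> \<le> N" using bd by meson
  have m: "(\<lambda>z. indicator G z * u z) \<in> borel_measurable borel"
    using G u by (rule usc_real_on_borel_measurable)
  have "(\<lambda>\<theta>. indicator G (z + cis \<theta> *s v) * u (z + cis \<theta> *s v)) \<in> borel_measurable borel"
    by (rule measurable_compose[OF borel_measurable_continuous_onI[OF cont] m])
  then have "(\<lambda>\<theta>. u (z + cis \<theta> *s v)) \<in> borel_measurable borel" using sub by simp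
  then show ?thesis
  proof (intro set_integrable_of_bounded[where N = N])
    show "\<bar>u (z + cis \<theta> *s v)\<bar> \<le> N" if "\<theta> \<in> {0..2*pi}" for \<theta>
    proof (rule N)
      show "z + cis \<theta> *s v \<in> K"
        unfolding K_def by (rule image_eqI[OF refl that])
    qed
  qed auto
qed

lemma bounded_psh_on_circle_integrable:
  assumes G: "open G" and u: "bounded_psh_on G u" and sub: "\<And>\<theta>. z + cis \<theta> *s v \<in> G"
  shows "set_integrable lborel {0..2*pi} (\<lambda>\<theta>. u (z + cis \<theta> *s v))"
  by (rule usc_circle_integrable[OF G _ _ sub]) (use u in \<open>auto simp: bounded_psh_on_def\<close>)

text \<open>On the circle of radius \<open>s\<close> around \<open>x0\<close> a harmonic quadratic polynomial is a trigonometric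
  polynomial in the angle, so the sub-mean value inequality on a small circle suffices.\<close>
lemma subharmonic_touching_on_line:
  assumes G: "open G" and u: "bounded_psh_on G u" and x0: "p + x0 *s w \<in> G"
  shows "subharmonic_touching (\<lambda>x. u (p + x *s w)) x0"
  unfolding subharmonic_touching_def
proof (intro allI impI)
  fix \<alpha> \<beta> :: complex and \<delta> r0 :: real assume \<delta>: "0 < \<delta>" and r0: "0 < r0"
  obtain e where e: "e > 0" "ball (p + x0 *s w) e \<subseteq> G" using G x0 by (meson open_contains_ball)
  define r where "r = min (r0 / 2) (e / (2 * (norm w + 1)))"
  have r: "0 < r" using r0 e by (simp add: r_def add_nonneg_pos)
  have rr0: "r < r0" using r0 by (simp add: r_def)
  have "r * norm w \<le> e / (2 * (norm w + 1)) * (norm w + 1)"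
    using e by (intro mult_mono) (auto simp: r_def)
  also have "\<dots> = e / 2"
  proof -
    have half: "e / (2 * q) * q = e / 2" if "0 < q" for q :: real using that by simp
    show ?thesis by (rule half) (simp add: add_nonneg_pos)
  qed
  finally have rw: "r * norm w \<le> e / 2" .
  let ?z = "p + x0 *s w" and ?v = "complex_of_real r *s w"
  have inG: "?z + x *s ?v \<in> G" if "norm x \<le> 1" for x
  proof -
    have "norm (x *s ?v) \<le> 1 * (e / 2)"
      using that rw r by (simp only: norm_vector_scalar) (intro mult_mono, auto)
    then have "?z + x *s ?v \<in> ball ?z e" using e by (simp add: dist_norm)
    then show ?thesis using e by blast
  qed
  have "u ?z \<le> (LINT \<theta>:{0..2*pi}|lborel. u (?z + cis \<theta> *s ?v)) / (2 * pi)"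
    by (rule bounded_psh_on_mean[OF u inG])
  moreover have "set_integrable lborel {0..2*pi} (\<lambda>\<theta>. u (?z + cis \<theta> *s ?v))"
    by (intro bounded_psh_on_circle_integrable[OF G u] inG) simp
  moreover have "0 < \<delta> * r\<^sup>2" using \<delta> r by simp
  ultimately obtain \<theta> where \<theta>: "u ?z + Re ((\<alpha> * r) * cis \<theta> + (\<beta> * r\<^sup>2) * cis (2 * \<theta>)) - \<delta> * r\<^sup>2 \<le> u (?z + cis \<theta> *s ?v)"
    using circle_mean_touching by blast
  define x where "x = x0 + rcis r \<theta>"
  have dx: "dist x x0 = r" using r by (simp add: x_def dist_norm)
  have pt: "p + x *s w = ?z + cis \<theta> *s ?v"
    by (simp add: x_def rcis_def vec_eq_iff algebra_simps)
  have sq: "(cis \<theta>)\<^sup>2 = cis (2 * \<theta>)" by (simp add: power2_eq_square cis_mult)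
  have "\<alpha> * (x - x0) + \<beta> * (x - x0)\<^sup>2 = (\<alpha> * r) * cis \<theta> + (\<beta> * r\<^sup>2) * cis (2 * \<theta>)"
    unfolding sq[symmetric] by (simp add: x_def rcis_def power_mult_distrib)
  then show "\<exists>x. 0 < dist x x0 \<and> dist x x0 < r0 \<and>
        u (p + x0 *s w) + Re (\<alpha> * (x - x0) + \<beta> * (x - x0)\<^sup>2) - \<delta> * (dist x x0)\<^sup>2 \<le> u (p + x *s w)"
    using \<theta> r rr0 by (intro exI[of _ x]) (simp add: dx pt)
qed

lemma continuous_on_scalar_vector [continuous_intros]:
  fixes f :: "'a::topological_space \<Rightarrow> complex" and g :: "'a \<Rightarrow> complex^'n"
  assumes "continuous_on S f" "continuous_on S g"
  shows "continuous_on S (\<lambda>x. f x *s g x)"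
  unfolding vector_scalar_mult_def
  by (intro continuous_on_vec_lambda continuous_intros assms)

text \<open>The maximum over the circle orbit of \<open>z\<close>. It replaces the function by one that depends on the scalar
  factor only through its modulus.\<close>
definition circle_max :: "(complex^'n \<Rightarrow> real) \<Rightarrow> complex^'n \<Rightarrow> real" where
  "circle_max u z = (SUP \<theta>. u (cis \<theta> *s z))"

lemma circle_max:
  assumes u: "usc_real_on G u" and circ: "\<And>\<theta>. cis \<theta> *s z \<in> G"
  shows circle_max_attained: "\<exists>\<theta>. circle_max u z = u (cis \<theta> *s z)"
    and circle_max_ge: "u (cis \<theta> *s z) \<le> circle_max u z"
proof -
  have cont: "continuous_on UNIV (\<lambda>\<theta>. cis \<theta> *s z)" by (intro continuous_intros)
  have "usc_real_on {0..2*pi} (\<lambda>\<theta>. u (cis \<theta> *s z))"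
    using circ by (intro usc_real_on_compose_continuous[OF u] continuous_on_subset[OF cont]) auto
  then have "\<exists>\<theta>0\<in>{0..2*pi}. \<forall>\<theta>\<in>{0..2*pi}. u (cis \<theta> *s z) \<le> u (cis \<theta>0 *s z)"
    by (intro usc_real_on_attains_max) auto
  then obtain \<theta>0 where \<theta>0: "\<And>\<theta>. \<theta> \<in> {0..2*pi} \<Longrightarrow> u (cis \<theta> *s z) \<le> u (cis \<theta>0 *s z)" by blast
  have le: "u (cis \<theta> *s z) \<le> u (cis \<theta>0 *s z)" for \<theta>
  proof -
    obtain \<theta>' where "\<theta>' \<in> {0..2*pi}" "cis \<theta>' = cis \<theta>"
    proof -
      have "cis \<theta> = cis (Arg2pi (cis \<theta>))" using Arg2pi_eq[of "cis \<theta>"] by (simp add: cis_conv_exp)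
      then show thesis using that[of "Arg2pi (cis \<theta>)"] Arg2pi_ge_0 Arg2pi_lt_2pi less_imp_le by auto
    qed
    then show ?thesis using \<theta>0 by metis
  qed
  have "circle_max u z = u (cis \<theta>0 *s z)"
    unfolding circle_max_def by (intro cSup_eq_maximum) (use le in auto)
  then show "\<exists>\<theta>. circle_max u z = u (cis \<theta> *s z)" "u (cis \<theta> *s z) \<le> circle_max u z"
    using le by auto
qed

lemma circle_max_rotate:
  assumes "norm c = 1"
  shows "circle_max u (c *s z) = circle_max u z"
proof -
  have c: "c = cis (Arg c)" using assms by (metis cis_Arg norm_zero sgn_eq zero_neq_one div_by_1 of_real_1)
  have "range (\<lambda>\<theta>. u (cis \<theta> *s (c *s z))) = range (\<lambda>\<theta>. u (cis \<theta> *s z))"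
  proof (intro equalityI subsetI)
    fix t assume "t \<in> range (\<lambda>\<theta>. u (cis \<theta> *s (c *s z)))"
    then obtain \<theta> where "t = u (cis \<theta> *s (c *s z))" by auto
    then have "t = u (cis (\<theta> + Arg c) *s z)" using c by (metis cis_mult vector_smult_assoc)
    then show "t \<in> range (\<lambda>\<theta>. u (cis \<theta> *s z))" by auto
  next
    fix t assume "t \<in> range (\<lambda>\<theta>. u (cis \<theta> *s z))"
    then obtain \<theta> where "t = u (cis \<theta> *s z)" by auto
    moreover have "cis \<theta> *s z = cis (\<theta> - Arg c) *s (c *s z)"
      using c by (metis cis_mult vector_smult_assoc diff_add_cancel)
    ultimately show "t \<in> range (\<lambda>\<theta>. u (cis \<theta> *s (c *s z)))" by auto
  qed
  then show ?thesis by (simp add: circle_max_def)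
qed

text \<open>A supremum of plurisubharmonic functions satisfies the sub-mean value inequality; upper
  semicontinuity is preserved because the circle is compact.\<close>
lemma bounded_psh_on_circle_max:
  assumes G: "open G" and u: "bounded_psh_on G u"
    and circ: "\<And>z c. z \<in> G \<Longrightarrow> norm c = 1 \<Longrightarrow> c *s z \<in> G"
  shows "bounded_psh_on G (circle_max u)"
proof -
  have usc: "usc_real_on G u" using u by (simp add: bounded_psh_on_def)
  have circ': "cis \<theta> *s z \<in> G" if "z \<in> G" for z \<theta> using circ[OF that, of "cis \<theta>"] by simp
  have cont: "continuous_on UNIV (\<lambda>(\<theta>, z). cis \<theta> *s (z::complex^'n))"
    unfolding case_prod_unfold by (intro continuous_intros)
  have bd: "\<exists>N. \<forall>z\<in>K. \<bar>circle_max u z\<bar> \<le> N" if K: "K \<subseteq> G" "compact K" for K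
  proof -
    have "compact ((\<lambda>(\<theta>, z). cis \<theta> *s z) ` ({0..2*pi} \<times> K))"
      by (intro compact_continuous_image continuous_on_subset[OF cont] compact_Times K(2)) auto
    moreover have "(\<lambda>(\<theta>, z). cis \<theta> *s z) ` ({0..2*pi} \<times> K) \<subseteq> G" using K circ' by auto
    ultimately obtain N where N: "\<And>z. z \<in> (\<lambda>(\<theta>, z). cis \<theta> *s z) ` ({0..2*pi} \<times> K) \<Longrightarrow> \<bar>u z\<bar> \<le> N"
      using u unfolding bounded_psh_on_def by meson
    show ?thesis
    proof (intro exI[of _ N] ballI)
      fix z assume z: "z \<in> K"
      then have zG: "z \<in> G" using K by auto
      obtain \<theta> where \<theta>: "circle_max u z = u (cis \<theta> *s z)" using circle_max_attained[OF usc circ'[OF zG]] by blast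
      have "cis \<theta> = cis (Arg2pi (cis \<theta>))" using Arg2pi_eq[of "cis \<theta>"] by (simp add: cis_conv_exp)
      then have "\<bar>u (cis (Arg2pi (cis \<theta>)) *s z)\<bar> \<le> N"
        using z Arg2pi_ge_0[of "cis \<theta>"] Arg2pi_lt_2pi[of "cis \<theta>"]
        by (intro N) (auto intro!: image_eqI[where x = "(Arg2pi (cis \<theta>), z)"])
      then show "\<bar>circle_max u z\<bar> \<le> N" using \<theta> \<open>cis \<theta> = _\<close> by simp
    qed
  qed
  have usc': "usc_real_on G (circle_max u)"
    unfolding usc_real_on_def
  proof (intro ballI allI impI)
    fix z c assume z: "z \<in> G" and c: "circle_max u z < c"
    have "\<exists>d>0. \<forall>\<theta>'\<in>{0..2*pi}. \<forall>z'\<in>G. dist \<theta>' \<theta> < d \<longrightarrow> dist z' z < d \<longrightarrow> u (cis \<theta>' *s z') < c"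
      if \<theta>: "\<theta> \<in> {0..2*pi}" for \<theta>
    proof -
      have "u (cis \<theta> *s z) < c" using circle_max_ge[OF usc circ'[OF z]] c by (rule le_less_trans)
      then obtain d where d: "d > 0" "\<And>z'. z' \<in> G \<Longrightarrow> dist z' (cis \<theta> *s z) < d \<Longrightarrow> u z' < c"
        using usc_real_onD[OF usc circ'[OF z]] by blast
      obtain d' where d': "d' > 0" "\<And>y. dist y (\<theta>, z) < d' \<Longrightarrow> dist ((\<lambda>(\<theta>, z). cis \<theta> *s z) y) (cis \<theta> *s z) < d"
        using cont d(1) unfolding continuous_on_iff by (metis UNIV_I case_prod_conv)
      show ?thesis
      proof (intro exI[of _ "d' / 2"] conjI ballI impI)
        fix \<theta>' z' assume a: "z' \<in> G" "dist \<theta>' \<theta> < d' / 2" "dist z' z < d' / 2"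
        have "dist (\<theta>', z') (\<theta>, z) \<le> dist \<theta>' \<theta> + dist z' z"
          unfolding dist_prod_def by (simp add: sqrt_sum_squares_le_sum)
        then show "u (cis \<theta>' *s z') < c" using a d'(2)[of "(\<theta>', z')"] d(2)[OF circ'[OF a(1)]] by simp
      qed (use d' in auto)
    qed
    then obtain d where d: "\<And>\<theta>. \<theta> \<in> {0..2*pi} \<Longrightarrow> d \<theta> > 0 \<and> (\<forall>\<theta>'\<in>{0..2*pi}. \<forall>z'\<in>G. dist \<theta>' \<theta> < d \<theta> \<longrightarrow> dist z' z < d \<theta> \<longrightarrow> u (cis \<theta>' *s z') < c)"
      by metis
    have "\<exists>F\<subseteq>{0..2*pi}. finite F \<and> {0..2*pi} \<subseteq> (\<Union>\<theta>\<in>F. ball \<theta> (d \<theta>))"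
    proof (rule compactE_image[of "{0..2*pi}" "{0..2*pi}" "\<lambda>\<theta>. ball \<theta> (d \<theta>)"])
      show "{0..2*pi} \<subseteq> (\<Union>\<theta>\<in>{0..2*pi}. ball \<theta> (d \<theta>))" using d by force
    qed auto
    then obtain F where F: "F \<subseteq> {0..2*pi}" "finite F" "{0..2*pi} \<subseteq> (\<Union>\<theta>\<in>F. ball \<theta> (d \<theta>))" by blast
    have Fne: "F \<noteq> {}" using F(3) by auto
    show "\<exists>d>0. \<forall>z'\<in>G. dist z' z < d \<longrightarrow> circle_max u z' < c"
    proof (intro exI[of _ "Min (d ` F)"] conjI ballI impI)
      show "0 < Min (d ` F)" using F Fne d by (subst Min_gr_iff) auto
      fix z' assume z': "z' \<in> G" "dist z' z < Min (d ` F)"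
      obtain \<theta>1 where \<theta>1: "circle_max u z' = u (cis \<theta>1 *s z')" using circle_max_attained[OF usc circ'[OF z'(1)]] by blast
      define \<theta>' where "\<theta>' = Arg2pi (cis \<theta>1)"
      have c1: "cis \<theta>1 = cis \<theta>'" using Arg2pi_eq[of "cis \<theta>1"] by (simp add: \<theta>'_def cis_conv_exp)
      have \<theta>'I: "\<theta>' \<in> {0..2*pi}" using Arg2pi_ge_0 Arg2pi_lt_2pi less_imp_le by (auto simp: \<theta>'_def)
      then obtain \<theta> where \<theta>: "\<theta> \<in> F" "\<theta>' \<in> ball \<theta> (d \<theta>)" using F(3) by blast
      have "dist z' z < d \<theta>" using z'(2) F(2) \<theta>(1) by (simp add: Min_gr_iff[OF _ ] less_le_trans[OF _ Min_le])
      then show "circle_max u z' < c" using d[of \<theta>] \<theta> \<theta>'I F(1) z'(1) \<theta>1 c1 by (auto simp: dist_commute)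
    qed
  qed
  have sm: "circle_max u z \<le> (LINT \<theta>:{0..2*pi}|lborel. circle_max u (z + cis \<theta> *s v)) / (2 * pi)"
    if sub: "\<forall>x\<in>cball 0 1. z + x *s v \<in> G" for z v
  proof -
    have zG: "z \<in> G" using sub by (metis add.right_neutral centre_in_cball vector_smult_lzero zero_le_one)
    obtain \<theta>0 where \<theta>0: "circle_max u z = u (cis \<theta>0 *s z)" using circle_max_attained[OF usc circ'[OF zG]] by blast
    have in1: "z + cis \<theta> *s v \<in> G" for \<theta> using sub by auto
    have distr: "cis \<theta>0 *s z + x *s (cis \<theta>0 *s v) = cis \<theta>0 *s (z + x *s v)" for x
      by (simp add: vec_eq_iff algebra_simps)
    have "u (cis \<theta>0 *s z) \<le> (LINT \<theta>:{0..2*pi}|lborel. u (cis \<theta>0 *s z + cis \<theta> *s (cis \<theta>0 *s v))) / (2 * pi)"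
      using u sub circ' unfolding bounded_psh_on_def by (metis distr)
    also have "(LINT \<theta>:{0..2*pi}|lborel. u (cis \<theta>0 *s z + cis \<theta> *s (cis \<theta>0 *s v)))
        \<le> (LINT \<theta>:{0..2*pi}|lborel. circle_max u (z + cis \<theta> *s v))"
    proof (intro set_integral_mono)
      show "set_integrable lborel {0..2*pi} (\<lambda>\<theta>. u (cis \<theta>0 *s z + cis \<theta> *s (cis \<theta>0 *s v)))"
      proof (rule bounded_psh_on_circle_integrable[OF G u])
        show "cis \<theta>0 *s z + cis \<theta> *s (cis \<theta>0 *s v) \<in> G" for \<theta>
          unfolding distr by (rule circ'[OF in1])
      qed
      have cont_v: "continuous_on UNIV (\<lambda>\<theta>. z + cis \<theta> *s v)" by (intro continuous_intros)
      have "(\<lambda>\<theta>. indicator G (z + cis \<theta> *s v) * circle_max u (z + cis \<theta> *s v)) \<in> borel_measurable borel"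
        by (rule measurable_compose[OF borel_measurable_continuous_onI[OF cont_v]
              usc_real_on_borel_measurable[OF G usc']])
      then have m: "(\<lambda>\<theta>. circle_max u (z + cis \<theta> *s v)) \<in> borel_measurable borel" using in1 by simp
      have "compact ((\<lambda>\<theta>. z + cis \<theta> *s v) ` {0..2*pi})"
        by (intro compact_continuous_image continuous_intros) auto
      then obtain N where N: "\<And>w. w \<in> (\<lambda>\<theta>. z + cis \<theta> *s v) ` {0..2*pi} \<Longrightarrow> \<bar>circle_max u w\<bar> \<le> N"
        using bd[of "(\<lambda>\<theta>. z + cis \<theta> *s v) ` {0..2*pi}"] in1 by blast
      then show "set_integrable lborel {0..2*pi} (\<lambda>\<theta>. circle_max u (z + cis \<theta> *s v))"
        using m
      proof (intro set_integrable_of_bounded[where N = N])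
        show "\<bar>circle_max u (z + cis \<theta> *s v)\<bar> \<le> N" if "\<theta> \<in> {0..2*pi}" for \<theta>
          by (rule N, rule image_eqI[OF refl that])
      qed auto
      show "u (cis \<theta>0 *s z + cis \<theta> *s (cis \<theta>0 *s v)) \<le> circle_max u (z + cis \<theta> *s v)" for \<theta>
        unfolding distr by (rule circle_max_ge[OF usc circ'[OF in1]])
    qed
    finally show ?thesis using \<theta>0 by (simp add: divide_right_mono)
  qed
  show ?thesis unfolding bounded_psh_on_def using usc' bd sm by blast
qed

section \<open>Mollification on a spherical shell\<close>

lemma integral_lborel_rotation:
  fixes f :: "complex^'n \<Rightarrow> real"
  assumes c: "norm c = 1" and f: "f \<in> borel_measurable borel"
  shows "(\<integral>v. f (c *s v) \<partial>lborel) = (\<integral>v. f v \<partial>lborel)"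
proof -
  have "continuous_on UNIV (\<lambda>v::complex^'n. c *s v)" by (intro continuous_intros)
  then have "(\<lambda>v::complex^'n. c *s v) \<in> borel_measurable borel" by (rule borel_measurable_continuous_onI)
  then have "integral\<^sup>L (distr lborel borel (\<lambda>v::complex^'n. c *s v)) f = (\<integral>v. f (c *s v) \<partial>lborel)"
    using f by (intro integral_distr) auto
  then show ?thesis
    by (simp add: distr_lborel_linear_isometry[OF isometry_vector_scalar[OF c]])
qed

lemma integral_lborel_translation:
  fixes f :: "'a::euclidean_space \<Rightarrow> real"
  assumes f: "f \<in> borel_measurable borel"
  shows "(\<integral>v. f (z + v) \<partial>lborel) = (\<integral>v. f v \<partial>lborel)"
proof -
  have "integral\<^sup>L (distr lborel borel (\<lambda>v. z + v)) f = (\<integral>v. f (z + v) \<partial>lborel)"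
    using f by (intro integral_distr) auto
  then show ?thesis by (simp add: lborel_distr_plus)
qed

text \<open>A radial bump function of class C^1 with Lipschitz derivative, not normalised. Second order
  smoothness in this weak sense is all that is needed below, and the explicit polynomial form gives explicit
  constants.\<close>
definition bump :: "real \<Rightarrow> 'a::real_inner \<Rightarrow> real" where
  "bump \<epsilon> v = (max 0 (\<epsilon>\<^sup>2 - (norm v)\<^sup>2))\<^sup>2"

lemma bump_nonneg: "0 \<le> bump \<epsilon> v" by (simp add: bump_def)

lemma bump_eq_0: "0 \<le> \<epsilon> \<Longrightarrow> \<epsilon> \<le> norm v \<Longrightarrow> bump \<epsilon> v = 0"
  by (simp add: bump_def power_mono)

lemma bump_le_1:
  assumes "0 < \<epsilon>" "\<epsilon> \<le> 1"
  shows "bump \<epsilon> v \<le> 1"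
proof -
  have "\<epsilon>\<^sup>2 \<le> 1" using assms by (simp add: power_le_one)
  then have "max 0 (\<epsilon>\<^sup>2 - (norm v)\<^sup>2) \<le> 1" using zero_le_power2[of "norm v"] by linarith
  then show ?thesis unfolding bump_def by (intro power_le_one) auto
qed

lemma continuous_on_bump [continuous_intros]:
  "continuous_on S f \<Longrightarrow> continuous_on S (\<lambda>x. bump \<epsilon> (f x))"
  unfolding bump_def by (intro continuous_intros)

lemma bump_measurable [measurable]: "bump \<epsilon> \<in> borel_measurable borel"
  by (intro borel_measurable_continuous_onI continuous_intros)

lemma square_positive_part_Taylor:
  fixes s t :: real
  shows "\<bar>(max 0 s)\<^sup>2 - (max 0 t)\<^sup>2 - 2 * max 0 t * (s - t)\<bar> \<le> (s - t)\<^sup>2"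
proof (cases "0 \<le> s"; cases "0 \<le> t")
  assume a: "\<not> 0 \<le> s" "0 \<le> t"
  have "t\<^sup>2 - 2 * s * t = t * (t - 2 * s)" by (simp add: power2_eq_square algebra_simps)
  also have "\<dots> \<ge> 0" using a by (intro mult_nonneg_nonneg) auto
  finally show ?thesis using a by (simp add: power2_eq_square algebra_simps abs_le_iff)
next
  assume a: "0 \<le> s" "\<not> 0 \<le> t"
  have "s * s \<le> (s - t) * (s - t)" using a by (intro mult_mono) auto
  then show ?thesis using a by (simp add: power2_eq_square)
next
  assume a: "0 \<le> s" "0 \<le> t"
  have "s\<^sup>2 - t\<^sup>2 - 2 * t * (s - t) = (s - t)\<^sup>2" by (simp add: power2_eq_square algebra_simps)
  then show ?thesis using a by simp
qed simp

text \<open>The first order expansion at \<open>v\<close>, evaluated at two nearby points \<open>v - m\<close> and \<open>v - m - k\<close>. The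
  error is \<open>\<bar>k\<bar>\<close> times the distance to the base point, which expresses that the derivative is Lipschitz.
  The constant is a crude bound.\<close>
lemma bump_Taylor:
  fixes v m k :: "'a::real_inner"
  assumes \<epsilon>: "0 < \<epsilon>" "\<epsilon> \<le> 1" and b: "norm v \<le> 4" "norm m \<le> 1" "norm k \<le> 1"
  shows "\<bar>bump \<epsilon> (v - m - k) - bump \<epsilon> (v - m) - 4 * max 0 (\<epsilon>\<^sup>2 - (norm v)\<^sup>2) * (v \<bullet> k)\<bar>
     \<le> 150 * norm k * (norm k + norm m)"
proof -
  define t where "t = \<epsilon>\<^sup>2 - (norm (v - m))\<^sup>2"
  define s where "s = \<epsilon>\<^sup>2 - (norm (v - m - k))\<^sup>2"
  define t0 where "t0 = \<epsilon>\<^sup>2 - (norm v)\<^sup>2"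
  have e1: "\<epsilon>\<^sup>2 \<le> 1" using \<epsilon> by (simp add: power_le_one)
  have nvm: "norm (v - m) \<le> 5" using norm_triangle_ineq4[of v m] b by linarith
  have st: "s - t = 2 * ((v - m) \<bullet> k) - (norm k)\<^sup>2"
    unfolding s_def t_def by (simp add: power2_norm_eq_inner inner_diff_left inner_diff_right inner_commute)
  have ip: "\<bar>(v - m) \<bullet> k\<bar> \<le> 5 * norm k"
    using Cauchy_Schwarz_ineq2[of "v - m" k] nvm by (meson mult_right_mono norm_ge_zero order_trans)
  have k2: "(norm k)\<^sup>2 \<le> norm k" using b by (simp add: power2_eq_square mult_left_le)
  have "\<bar>s - t\<bar> \<le> 11 * norm k" 
    unfolding st using ip k2 zero_le_power2[of "norm k"] norm_ge_zero[of k] by linarith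
  then have "(s - t)\<^sup>2 \<le> (11 * norm k)\<^sup>2" by (metis abs_ge_zero power2_abs power_mono)
  then have 1: "\<bar>(max 0 s)\<^sup>2 - (max 0 t)\<^sup>2 - 2 * max 0 t * (s - t)\<bar> \<le> 121 * (norm k)\<^sup>2"
    using square_positive_part_Taylor[of s t] by (simp add: power_mult_distrib)
  have mt: "0 \<le> max 0 t" "max 0 t \<le> 1"
    using e1 zero_le_power2[of "norm (v - m)"] unfolding t_def by linarith+
  have 2: "\<bar>2 * max 0 t * (norm k)\<^sup>2\<bar> \<le> 2 * (norm k)\<^sup>2"
    using mt by (simp add: mult_left_le_one_le abs_mult)
  have d0: "\<bar>max 0 t - max 0 t0\<bar> \<le> 9 * norm m"
  proof -
    have "\<bar>max 0 t - max 0 t0\<bar> \<le> \<bar>t - t0\<bar>" by simp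
    also have "t - t0 = 2 * (v \<bullet> m) - (norm m)\<^sup>2"
      unfolding t0_def t_def by (simp add: power2_norm_eq_inner inner_diff_left inner_diff_right inner_commute)
    also have "\<bar>2 * (v \<bullet> m) - (norm m)\<^sup>2\<bar> \<le> 2 * \<bar>v \<bullet> m\<bar> + (norm m)\<^sup>2"
      using zero_le_power2[of "norm m"] by linarith
    also have "\<bar>v \<bullet> m\<bar> \<le> 4 * norm m"
      using Cauchy_Schwarz_ineq2[of v m] b by (meson mult_right_mono norm_ge_zero order_trans)
    also have "(norm m)\<^sup>2 \<le> norm m" using b by (simp add: power2_eq_square mult_left_le)
    finally show ?thesis by linarith
  qed
  have "max 0 t * ((v - m) \<bullet> k) - max 0 t0 * (v \<bullet> k) = (max 0 t - max 0 t0) * (v \<bullet> k) - max 0 t * (m \<bullet> k)"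
    by (simp add: inner_diff_left algebra_simps)
  also have "\<bar>\<dots>\<bar> \<le> \<bar>max 0 t - max 0 t0\<bar> * \<bar>v \<bullet> k\<bar> + max 0 t * \<bar>m \<bullet> k\<bar>"
    using mt(1) by (intro order_trans[OF abs_triangle_ineq4]) (simp add: abs_mult)
  also have "\<dots> \<le> (9 * norm m) * (4 * norm k) + 1 * (norm m * norm k)"
  proof (intro add_mono mult_mono)
    show "\<bar>v \<bullet> k\<bar> \<le> 4 * norm k"
      using Cauchy_Schwarz_ineq2[of v k] b by (meson mult_right_mono norm_ge_zero order_trans)
  qed (use mt d0 Cauchy_Schwarz_ineq2 in auto)
  finally have 3: "\<bar>max 0 t * ((v - m) \<bullet> k) - max 0 t0 * (v \<bullet> k)\<bar> \<le> 37 * (norm m * norm k)" by (simp add: mult.commute[of "norm m"])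
  have "(max 0 s)\<^sup>2 - (max 0 t)\<^sup>2 - 4 * max 0 t0 * (v \<bullet> k)
      = ((max 0 s)\<^sup>2 - (max 0 t)\<^sup>2 - 2 * max 0 t * (s - t)) - 2 * max 0 t * (norm k)\<^sup>2
        + 4 * (max 0 t * ((v - m) \<bullet> k) - max 0 t0 * (v \<bullet> k))"
    unfolding st by (simp add: algebra_simps)
  moreover have tri: "\<bar>a - b + 4 * c\<bar> \<le> A + B + 4 * C" if "\<bar>a\<bar> \<le> A" "\<bar>b\<bar> \<le> B" "\<bar>c\<bar> \<le> C"
    for a b c A B C :: real using that by linarith
  ultimately have "\<bar>(max 0 s)\<^sup>2 - (max 0 t)\<^sup>2 - 4 * max 0 t0 * (v \<bullet> k)\<bar>
      \<le> 121 * (norm k)\<^sup>2 + 2 * (norm k)\<^sup>2 + 4 * (37 * (norm m * norm k))"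
    using tri[OF 1 2 3] by (simp only:)
  also have "\<dots> \<le> 150 * norm k * (norm k + norm m)"
    by (simp add: power2_eq_square algebra_simps)
  finally show ?thesis by (simp add: bump_def s_def t_def t0_def)
qed

text \<open>The convolution of \<open>W\<close>, cut off to \<open>S\<close>, with the normalised bump. The integration variable sits in
  \<open>W\<close>, so the regularity of the bump passes to the result by differentiation under the integral.\<close>
definition mollify :: "(complex^'n) set \<Rightarrow> (complex^'n \<Rightarrow> real) \<Rightarrow> real \<Rightarrow> complex^'n \<Rightarrow> real" where
  "mollify S W \<epsilon> z = (\<integral>u. indicator S u * W u * bump \<epsilon> (u - z) \<partial>lborel) / (\<integral>v. bump \<epsilon> (v::complex^'n) \<partial>lborel)"

text \<open>The closed shell \<open>S\<close> stays away from the origin, where the function may be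
  unbounded. The constant \<open>Z\<close> is the normalising factor of the bump.\<close>
locale shell_mollifier =
  fixes W :: "complex^'n \<Rightarrow> real" and S :: "(complex^'n) set" and r1 r2 \<epsilon> N Z :: real
  assumes S_def: "S = {z. r1 \<le> norm z \<and> norm z \<le> r2}"
    and r2: "r2 \<le> 2" and \<epsilon>: "0 < \<epsilon>" "\<epsilon> \<le> 1"
    and Z_eq: "Z = (\<integral>v. bump \<epsilon> (v::complex^'n) \<partial>lborel)"
    and meas: "(\<lambda>u. indicator S u * W u) \<in> borel_measurable borel"
    and bound: "\<And>u. u \<in> S \<Longrightarrow> \<bar>W u\<bar> \<le> N"
    and mean: "\<And>z v. (\<And>x. norm x \<le> 1 \<Longrightarrow> z + x *s v \<in> S) \<Longrightarrow>
        W z \<le> (LINT \<theta>:{0..2*pi}|lborel. W (z + cis \<theta> *s v)) / (2 * pi)"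
begin

abbreviation "W0 \<equiv> \<lambda>u. indicator S u * W u"

lemma W0_bound: "\<bar>W0 u\<bar> \<le> \<bar>N\<bar>"
  using bound[of u] by (auto simp: indicator_def)

lemma bump_W0_integrable:
  fixes q :: "complex^'n \<Rightarrow> complex^'n"
  assumes q: "q \<in> borel_measurable borel"
  shows "integrable lborel (\<lambda>v. bump \<epsilon> v * W0 (q v))"
proof (rule integrableI_bounded_set[where A = "ball 0 \<epsilon>" and B = "\<bar>N\<bar>"])
  have "(\<lambda>v. W0 (q v)) \<in> borel_measurable borel" by (rule measurable_compose[OF q meas])
  then show "(\<lambda>v. bump \<epsilon> v * W0 (q v)) \<in> borel_measurable lborel" by simp
  show "AE v\<in>ball 0 \<epsilon> in lborel. norm (bump \<epsilon> v * W0 (q v)) \<le> \<bar>N\<bar>"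
  proof (intro AE_I2 impI)
    fix v :: "complex^'n"
    have "\<bar>bump \<epsilon> v\<bar> * \<bar>W0 (q v)\<bar> \<le> 1 * \<bar>N\<bar>"
      using bump_nonneg[of \<epsilon> v] bump_le_1[OF \<epsilon>, of v] W0_bound by (intro mult_mono) auto
    then show "norm (bump \<epsilon> v * W0 (q v)) \<le> \<bar>N\<bar>" by (simp add: abs_mult)
  qed
  show "emeasure lborel (ball (0::complex^'n) \<epsilon>) < \<infinity>" by (rule emeasure_lborel_ball_finite)
  show "AE x in lborel. x \<notin> ball 0 \<epsilon> \<longrightarrow> bump \<epsilon> x * W0 (q x) = 0"
    using \<epsilon> by (intro AE_I2) (auto simp: bump_eq_0)
qed auto

lemma bump_integrable: "integrable lborel (bump \<epsilon> :: complex^'n \<Rightarrow> real)"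
proof (rule integrableI_bounded_set[where A = "ball 0 \<epsilon>" and B = 1])
  show "emeasure lborel (ball (0::complex^'n) \<epsilon>) < \<infinity>" by (rule emeasure_lborel_ball_finite)
qed (use \<epsilon> bump_le_1[OF \<epsilon>] in \<open>auto simp: bump_eq_0 abs_of_nonneg[OF bump_nonneg]\<close>)

lemma Z_pos: "0 < Z"
proof -
  have "0 \<le> Z" unfolding Z_eq by (intro integral_nonneg_AE AE_I2 bump_nonneg)
  moreover have "Z \<noteq> 0"
  proof
    assume "Z = 0"
    then have "AE v in lborel. bump \<epsilon> (v::complex^'n) = 0"
      using integral_nonneg_eq_0_iff_AE[OF bump_integrable] bump_nonneg by (auto simp: Z_eq)
    then have "AE v in lborel. v \<notin> ball (0::complex^'n) \<epsilon>"
    proof (rule AE_mp, intro AE_I2 impI)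
      fix v :: "complex^'n" assume "bump \<epsilon> v = 0"
      then have "\<not> (norm v)\<^sup>2 < \<epsilon>\<^sup>2" by (simp add: bump_def max_def split: if_splits)
      then show "v \<notin> ball 0 \<epsilon>" using power_strict_mono[of "norm v" \<epsilon> 2] by auto
    qed
    then have "ball (0::complex^'n) \<epsilon> \<in> null_sets lborel" by (subst AE_iff_null_sets) auto
    then have "emeasure lborel (ball (0::complex^'n) \<epsilon>) = 0" by (rule null_setsD1)
    then have "measure lborel (ball (0::complex^'n) \<epsilon>) = 0" by (simp add: measure_def)
    then show False using content_ball_pos[OF \<epsilon>(1), of "0::complex^'n"] by simp
  qed
  ultimately show ?thesis by simp
qed

lemma mollify_shift: "mollify S W \<epsilon> z = (\<integral>v. bump \<epsilon> v * W0 (z + v) \<partial>lborel) / Z"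
proof -
  have m: "(\<lambda>u. W0 u * bump \<epsilon> (u - z)) \<in> borel_measurable borel" using meas by measurable
  show ?thesis
    using integral_lborel_translation[OF m, of z] by (simp add: mollify_def Z_eq mult.commute)
qed

text \<open>Boundedness of the cut-off function makes the integrand absolutely integrable, so averaging over
  the bump and averaging over a circle commute.\<close>
lemma bump_mean_Fubini:
  fixes q :: "complex^'n \<Rightarrow> real \<Rightarrow> complex^'n"
  assumes q: "(\<lambda>(v, \<theta>). q v \<theta>) \<in> borel_measurable borel"
  shows "(\<integral>v. bump \<epsilon> v * (LINT \<theta>:{0..2*pi}|lborel. W0 (q v \<theta>)) \<partial>lborel)
       = (LINT \<theta>:{0..2*pi}|lborel. \<integral>v. bump \<epsilon> v * W0 (q v \<theta>) \<partial>lborel)" (is ?eq)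
    and "integrable lborel (\<lambda>v. bump \<epsilon> v * (LINT \<theta>:{0..2*pi}|lborel. W0 (q v \<theta>)))" (is ?int)
    and "set_integrable lborel {0..2*pi} (\<lambda>\<theta>. \<integral>v. bump \<epsilon> v * W0 (q v \<theta>) \<partial>lborel)" (is ?int2)
proof -
  let ?F = "\<lambda>(v, \<theta>). bump \<epsilon> v * W0 (q v \<theta>) * indicator {0..2*pi} \<theta>"
  have sets: "sets (lborel \<Otimes>\<^sub>M lborel) = sets (borel :: ((complex^'n) \<times> real) measure)"
    unfolding borel_prod[symmetric] by (intro sets_pair_measure_cong) simp_all
  have m1: "(\<lambda>x. W0 (q (fst x) (snd x))) \<in> borel_measurable borel"
    using measurable_compose[OF q meas] by (simp add: case_prod_unfold)
  have "?F \<in> borel_measurable (borel :: ((complex^'n) \<times> real) measure)"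
    unfolding case_prod_unfold
  proof (rule borel_measurable_times[OF borel_measurable_times[OF _ m1]])
    show "(\<lambda>x. bump \<epsilon> (fst x :: complex^'n)) \<in> borel_measurable (borel :: ((complex^'n) \<times> real) measure)"
      by (intro borel_measurable_continuous_onI continuous_intros)
    have "(snd :: (complex^'n) \<times> real \<Rightarrow> real) \<in> borel_measurable borel"
      by (intro borel_measurable_continuous_onI continuous_intros)
    then show "(\<lambda>x. indicator {0..2*pi} (snd x :: real)) \<in> borel_measurable (borel :: ((complex^'n) \<times> real) measure)"
      by measurable
  qed
  then have mF: "?F \<in> borel_measurable (lborel \<Otimes>\<^sub>M lborel)"
    by (simp add: measurable_cong_sets[OF sets refl])
  have int: "integrable (lborel \<Otimes>\<^sub>M lborel) ?F"
  proof (rule integrableI_bounded_set[where A = "ball 0 \<epsilon> \<times> {0..2*pi}" and B = "\<bar>N\<bar>"])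
    show "ball (0::complex^'n) \<epsilon> \<times> {0..2*pi} \<in> sets (lborel \<Otimes>\<^sub>M lborel)" by simp
    show "?F \<in> borel_measurable (lborel \<Otimes>\<^sub>M lborel)" by (rule mF)
    show "emeasure (lborel \<Otimes>\<^sub>M lborel) (ball (0::complex^'n) \<epsilon> \<times> {0..2*pi}) < \<infinity>"
      using emeasure_lborel_ball_finite[of "0::complex^'n" \<epsilon>]
      by (subst lborel.emeasure_pair_measure_Times) (auto simp: ennreal_mult_less_top)
    show "AE x\<in>ball 0 \<epsilon> \<times> {0..2 * pi} in lborel \<Otimes>\<^sub>M lborel. norm (?F x) \<le> \<bar>N\<bar>"
    proof (intro AE_I2 impI)
      fix x :: "(complex^'n) \<times> real"
      have "\<bar>bump \<epsilon> (fst x)\<bar> * \<bar>W0 (q (fst x) (snd x))\<bar> * \<bar>indicator {0..2*pi} (snd x)\<bar> \<le> 1 * \<bar>N\<bar> * 1"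
        using bump_nonneg[of \<epsilon> "fst x"] bump_le_1[OF \<epsilon>, of "fst x"] W0_bound
        by (intro mult_mono) (auto simp: indicator_def)
      then show "norm (?F x) \<le> \<bar>N\<bar>" by (simp add: case_prod_unfold abs_mult)
    qed
    show "AE x in lborel \<Otimes>\<^sub>M lborel. x \<notin> ball 0 \<epsilon> \<times> {0..2 * pi} \<longrightarrow> ?F x = 0"
    proof (intro AE_I2 impI)
      fix x :: "(complex^'n) \<times> real" assume "x \<notin> ball 0 \<epsilon> \<times> {0..2 * pi}"
      then have "\<epsilon> \<le> norm (fst x) \<or> snd x \<notin> {0..2*pi}" by (cases x) auto
      then show "?F x = 0" using \<epsilon> bump_eq_0[of \<epsilon> "fst x"] by (auto simp: case_prod_unfold)
    qed
  qed
  have in1: "(\<integral>\<theta>. ?F (v, \<theta>) \<partial>lborel) = bump \<epsilon> v * (LINT \<theta>:{0..2*pi}|lborel. W0 (q v \<theta>))" for v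
  proof -
    have "(\<lambda>\<theta>. ?F (v, \<theta>)) = (\<lambda>\<theta>. bump \<epsilon> v * (indicator {0..2*pi} \<theta> *\<^sub>R W0 (q v \<theta>)))"
      unfolding fun_eq_iff prod.case real_scaleR_def by (intro allI) (rule mult.commute[THEN trans], rule mult.left_commute)
    then show ?thesis unfolding set_lebesgue_integral_def by (simp only: integral_mult_right_zero)
  qed
  have in2: "(\<integral>v. ?F (v, \<theta>) \<partial>lborel) = indicator {0..2*pi} \<theta> *\<^sub>R (\<integral>v. bump \<epsilon> v * W0 (q v \<theta>) \<partial>lborel)" for \<theta>
  proof -
    have "(\<lambda>v. ?F (v, \<theta>)) = (\<lambda>v. indicator {0..2*pi} \<theta> * (bump \<epsilon> v * W0 (q v \<theta>)))"
      unfolding fun_eq_iff prod.case by (intro allI) (rule mult.commute)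
    then show ?thesis unfolding real_scaleR_def by (simp only: integral_mult_right_zero)
  qed
  have "(\<integral>\<theta>. \<integral>v. ?F (v, \<theta>) \<partial>lborel \<partial>lborel) = (\<integral>v. \<integral>\<theta>. ?F (v, \<theta>) \<partial>lborel \<partial>lborel)"
    by (rule lborel_pair.Fubini_integral) (use int in \<open>simp add: case_prod_unfold\<close>)
  then show ?eq unfolding in1 in2 set_lebesgue_integral_def by (rule sym)
  show ?int using lborel_pair.integrable_fst'[OF int] unfolding in1 .
  have "integrable lborel (\<lambda>\<theta>. \<integral>v. ?F (v, \<theta>) \<partial>lborel)"
    by (rule lborel_pair.integrable_snd) (use int in \<open>simp add: case_prod_unfold\<close>)
  then show ?int2 unfolding in2 set_integrable_def .
qed

text \<open>Since the bump is radial, averaging over \<open>v\<close> is the same as averaging over the rotated vectors \<open>cis \<theta> v\<close>;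
  averaging over \<open>\<theta>\<close> as well turns the integral into circle means, each of which is at least \<open>W z\<close>.\<close>
lemma mollify_ge:
  assumes z: "r1 + \<epsilon> \<le> norm z" "norm z \<le> r2 - \<epsilon>"
  shows "W z \<le> mollify S W \<epsilon> z"
proof -
  have cont: "continuous_on UNIV (\<lambda>(v, \<theta>). z + cis \<theta> *s (v::complex^'n))"
    unfolding case_prod_unfold by (intro continuous_intros)
  have q: "(\<lambda>(v, \<theta>). z + cis \<theta> *s (v::complex^'n)) \<in> borel_measurable borel"
    by (rule borel_measurable_continuous_onI[OF cont])
  note F = bump_mean_Fubini[OF q]
  have inS: "z + x *s v \<in> S" if "norm v < \<epsilon>" "norm x \<le> 1" for x v
  proof -
    have "norm (x *s v) \<le> 1 * \<epsilon>" unfolding norm_vector_scalar using that by (intro mult_mono) auto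
    then show ?thesis
      using z norm_triangle_ineq[of z "x *s v"] norm_diff_ineq[of z "x *s v"] unfolding S_def by auto
  qed
  have "W z * Z = (\<integral>v. bump \<epsilon> (v::complex^'n) * W z \<partial>lborel)" by (simp add: Z_eq)
  also have "\<dots> \<le> (\<integral>v. bump \<epsilon> v * (LINT \<theta>:{0..2*pi}|lborel. W0 (z + cis \<theta> *s v)) / (2 * pi) \<partial>lborel)"
  proof (intro integral_mono integrable_divide F(2))
    show "integrable lborel (\<lambda>v::complex^'n. bump \<epsilon> v * W z)" using bump_integrable by simp
    fix v :: "complex^'n"
    show "bump \<epsilon> v * W z \<le> bump \<epsilon> v * (LINT \<theta>:{0..2*pi}|lborel. W0 (z + cis \<theta> *s v)) / (2 * pi)"
    proof (cases "norm v < \<epsilon>")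
      case True
      have eq: "W0 (z + cis \<theta> *s v) = W (z + cis \<theta> *s v)" for \<theta> using inS[OF True, of "cis \<theta>"] by simp
      have "W z \<le> (LINT \<theta>:{0..2*pi}|lborel. W0 (z + cis \<theta> *s v)) / (2 * pi)"
        unfolding eq by (rule mean) (rule inS[OF True])
      then have "bump \<epsilon> v * W z \<le> bump \<epsilon> v * ((LINT \<theta>:{0..2*pi}|lborel. W0 (z + cis \<theta> *s v)) / (2 * pi))"
        by (rule mult_left_mono[OF _ bump_nonneg])
      then show ?thesis by simp
    qed (use \<epsilon> in \<open>simp add: bump_eq_0\<close>)
  qed
  also have "\<dots> = (LINT \<theta>:{0..2*pi}|lborel. \<integral>v. bump \<epsilon> v * W0 (z + cis \<theta> *s v) \<partial>lborel) / (2 * pi)"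
    using F(1) by simp
  also have "(\<lambda>\<theta>. \<integral>v. bump \<epsilon> v * W0 (z + cis \<theta> *s v) \<partial>lborel) = (\<lambda>\<theta>. Z * mollify S W \<epsilon> z)"
  proof
    fix \<theta>
    have m: "(\<lambda>v. bump \<epsilon> v * W0 (z + v)) \<in> borel_measurable borel"
      using measurable_compose[OF _ meas, of "\<lambda>v. z + v" borel] by measurable
    have "bump \<epsilon> (cis \<theta> *s v) = bump \<epsilon> v" for v :: "complex^'n" by (simp add: bump_def)
    then have "(\<integral>v. bump \<epsilon> v * W0 (z + cis \<theta> *s v) \<partial>lborel) = (\<integral>v. bump \<epsilon> v * W0 (z + v) \<partial>lborel)"
      using integral_lborel_rotation[OF _ m, of "cis \<theta>"] by simp
    then show "(\<integral>v. bump \<epsilon> v * W0 (z + cis \<theta> *s v) \<partial>lborel) = Z * mollify S W \<epsilon> z"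
      using Z_pos by (simp add: mollify_shift)
  qed
  also have "(LINT \<theta>:{0..2*pi}|lborel. Z * mollify S W \<epsilon> z) / (2 * pi) = mollify S W \<epsilon> z * Z"
    unfolding set_lebesgue_integral_def by simp
  finally show ?thesis using Z_pos by simp
qed

lemma mollify_rotate:
  assumes c: "norm c = 1" and rot: "\<And>u. u \<in> S \<Longrightarrow> W (c *s u) = W u"
  shows "mollify S W \<epsilon> (c *s z) = mollify S W \<epsilon> z"
proof -
  have m: "(\<lambda>v. bump \<epsilon> v * W0 (c *s z + v)) \<in> borel_measurable borel"
    using measurable_compose[OF _ meas, of "\<lambda>v. c *s z + v" borel] by measurable
  have "(\<integral>v. bump \<epsilon> v * W0 (c *s z + v) \<partial>lborel) = (\<integral>v. bump \<epsilon> (c *s v) * W0 (c *s z + c *s v) \<partial>lborel)"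
    using integral_lborel_rotation[OF c m] by simp
  also have "\<dots> = (\<integral>v. bump \<epsilon> v * W0 (z + v) \<partial>lborel)"
  proof (intro Bochner_Integration.integral_cong refl)
    fix v
    have 1: "c *s z + c *s v = c *s (z + v)" by (simp add: vec_eq_iff algebra_simps)
    have "norm (c *s (z + v)) = norm (z + v)" using norm_vector_scalar[of c "z + v"] c by simp
    then have "c *s (z + v) \<in> S \<longleftrightarrow> z + v \<in> S" unfolding S_def mem_Collect_eq by (simp only:)
    then have "W0 (c *s (z + v)) = W0 (z + v)" using rot[of "z + v"] by (auto simp: indicator_def)
    then show "bump \<epsilon> (c *s v) * W0 (c *s z + c *s v) = bump \<epsilon> v * W0 (z + v)"
      unfolding 1 using c by (simp add: bump_def)
  qed
  finally show ?thesis by (simp add: mollify_shift)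
qed

text \<open>Mollification is an average of translates, each of which has the sub-mean value property.\<close>
lemma mollify_mean:
  assumes sub: "\<And>x. norm x \<le> 1 \<Longrightarrow> r1 + \<epsilon> \<le> norm (z + x *s w) \<and> norm (z + x *s w) \<le> r2 - \<epsilon>"
  shows "mollify S W \<epsilon> z \<le> (LINT \<theta>:{0..2*pi}|lborel. mollify S W \<epsilon> (z + cis \<theta> *s w)) / (2 * pi)"
    and "set_integrable lborel {0..2*pi} (\<lambda>\<theta>. mollify S W \<epsilon> (z + cis \<theta> *s w))"
proof -
  have cont: "continuous_on UNIV (\<lambda>(v, \<theta>). z + cis \<theta> *s w + (v::complex^'n))"
    unfolding case_prod_unfold by (intro continuous_intros)
  have q: "(\<lambda>(v, \<theta>). z + cis \<theta> *s w + (v::complex^'n)) \<in> borel_measurable borel"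
    by (rule borel_measurable_continuous_onI[OF cont])
  note F = bump_mean_Fubini[OF q]
  have inS: "z + v + x *s w \<in> S" if "norm v < \<epsilon>" "norm x \<le> 1" for x v
    using that sub[OF that(2)] norm_triangle_ineq[of "z + x *s w" v] norm_diff_ineq[of "z + x *s w" v]
    unfolding S_def by (auto simp: add_ac)
  have "Z * mollify S W \<epsilon> z = (\<integral>v. bump \<epsilon> v * W0 (z + v) \<partial>lborel)"
    using Z_pos by (simp add: mollify_shift)
  also have "\<dots> \<le> (\<integral>v. bump \<epsilon> v * (LINT \<theta>:{0..2*pi}|lborel. W0 (z + cis \<theta> *s w + v)) / (2 * pi) \<partial>lborel)"
  proof (intro integral_mono integrable_divide F(2))
    show "integrable lborel (\<lambda>v::complex^'n. bump \<epsilon> v * W0 (z + v))" by (intro bump_W0_integrable) measurable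
    fix v :: "complex^'n"
    show "bump \<epsilon> v * W0 (z + v) \<le> bump \<epsilon> v * (LINT \<theta>:{0..2*pi}|lborel. W0 (z + cis \<theta> *s w + v)) / (2 * pi)"
    proof (cases "norm v < \<epsilon>")
      case True
      have eq1: "W0 (z + cis \<theta> *s w + v) = W (z + v + cis \<theta> *s w)" for \<theta>
        using inS[OF True, of "cis \<theta>"] by (simp add: add_ac)
      have eq2: "W0 (z + v) = W (z + v)" using inS[OF True, of 0] by simp
      have "W0 (z + v) \<le> (LINT \<theta>:{0..2*pi}|lborel. W0 (z + cis \<theta> *s w + v)) / (2 * pi)"
        unfolding eq1 eq2 by (rule mean) (rule inS[OF True])
      then have "bump \<epsilon> v * W0 (z + v) \<le> bump \<epsilon> v * ((LINT \<theta>:{0..2*pi}|lborel. W0 (z + cis \<theta> *s w + v)) / (2 * pi))"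
        by (rule mult_left_mono[OF _ bump_nonneg])
      then show ?thesis by simp
    qed (use \<epsilon> in \<open>simp add: bump_eq_0\<close>)
  qed
  also have "\<dots> = (LINT \<theta>:{0..2*pi}|lborel. \<integral>v. bump \<epsilon> v * W0 (z + cis \<theta> *s w + v) \<partial>lborel) / (2 * pi)"
    using F(1) by simp
  also have "(\<lambda>\<theta>. \<integral>v. bump \<epsilon> v * W0 (z + cis \<theta> *s w + v) \<partial>lborel) = (\<lambda>\<theta>. Z * mollify S W \<epsilon> (z + cis \<theta> *s w))"
    using Z_pos by (simp add: mollify_shift)
  also have "(LINT \<theta>:{0..2*pi}|lborel. Z * mollify S W \<epsilon> (z + cis \<theta> *s w))
      = Z * (LINT \<theta>:{0..2*pi}|lborel. mollify S W \<epsilon> (z + cis \<theta> *s w))"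
    unfolding set_lebesgue_integral_def real_scaleR_def mult.left_commute[of _ Z]
    by (rule integral_mult_right_zero)
  finally have "Z * mollify S W \<epsilon> z \<le> Z * ((LINT \<theta>:{0..2*pi}|lborel. mollify S W \<epsilon> (z + cis \<theta> *s w)) / (2 * pi))"
    by simp
  then show "mollify S W \<epsilon> z \<le> (LINT \<theta>:{0..2*pi}|lborel. mollify S W \<epsilon> (z + cis \<theta> *s w)) / (2 * pi)"
    using Z_pos by (rule mult_left_le_imp_le)
  have "set_integrable lborel {0..2*pi} (\<lambda>\<theta>. (\<integral>v. bump \<epsilon> v * W0 (z + cis \<theta> *s w + v) \<partial>lborel) / Z)"
    using F(3) by (rule set_integrable_divide)
  then show "set_integrable lborel {0..2*pi} (\<lambda>\<theta>. mollify S W \<epsilon> (z + cis \<theta> *s w))"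
    by (simp add: mollify_shift)
qed

lemma mollify_le:
  assumes z: "r1 + \<epsilon> \<le> norm z" "norm z \<le> r2 - \<epsilon>" and le: "\<And>u. dist u z < \<epsilon> \<Longrightarrow> W u \<le> \<beta>"
  shows "mollify S W \<epsilon> z \<le> \<beta>"
proof -
  have "(\<integral>v. bump \<epsilon> v * W0 (z + v) \<partial>lborel) \<le> (\<integral>v. bump \<epsilon> (v::complex^'n) * \<beta> \<partial>lborel)"
  proof (intro integral_mono)
    show "integrable lborel (\<lambda>v. bump \<epsilon> v * W0 (z + v))" by (intro bump_W0_integrable) measurable
    show "integrable lborel (\<lambda>v::complex^'n. bump \<epsilon> v * \<beta>)" using bump_integrable by simp
    fix v
    show "bump \<epsilon> v * W0 (z + v) \<le> bump \<epsilon> v * \<beta>"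
    proof (cases "norm v < \<epsilon>")
      case True
      then have "z + v \<in> S"
        using z norm_triangle_ineq[of z v] norm_diff_ineq[of z v] unfolding S_def by auto
      then show ?thesis using le[of "z + v"] True bump_nonneg[of \<epsilon> v] by (intro mult_left_mono) (auto simp: dist_norm)
    qed (use \<epsilon> in \<open>simp add: bump_eq_0\<close>)
  qed
  also have "\<dots> = \<beta> * Z" by (simp add: Z_eq)
  finally show ?thesis using Z_pos by (simp add: mollify_shift divide_le_eq)
qed

text \<open>The mollification is continuously differentiable with Lipschitz derivative,
  uniformly in base points \<open>p\<close> of norm at most 2: the expansion of the bump is integrated against the bounded
  function \<open>W\<close>.\<close>
lemma mollify_strict_derivative:
  obtains C where "0 \<le> C"
    "\<And>p. norm p \<le> 2 \<Longrightarrow> \<exists>L. linear L \<and> (\<forall>m k. norm m \<le> 1 \<longrightarrow> norm k \<le> 1 \<longrightarrow>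
       \<bar>mollify S W \<epsilon> (p + m + k) - mollify S W \<epsilon> (p + m) - L k\<bar> \<le> C * norm k * (norm k + norm m))"
proof -
  define V where "V = measure lborel S"
  define C where "C = \<bar>N\<bar> * V * 150 / Z"
  have Sball: "S \<subseteq> cball 0 2" using r2 by (auto simp: S_def)
  have Sclosed: "closed S" unfolding S_def
    by (intro closed_Collect_conj closed_Collect_le continuous_intros)
  then have Sb: "S \<in> sets borel" by simp
  have Sfin: "emeasure lborel S < \<infinity>"
    using emeasure_mono[OF Sball, of lborel] emeasure_lborel_cball_finite[of "0::complex^'n" 2] by (simp add: order_le_less_trans)
  have I: "integrable lborel (\<lambda>u. W0 u * g u)"
    if g: "continuous_on UNIV g" for g :: "complex^'n \<Rightarrow> real"
  proof -
    have "compact (g ` cball 0 2)" by (intro compact_continuous_image continuous_on_subset[OF g]) auto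
    then have "bounded (g ` cball 0 2)" by (rule compact_imp_bounded)
    then obtain B where B: "\<And>u. u \<in> cball 0 2 \<Longrightarrow> \<bar>g u\<bar> \<le> B" unfolding bounded_iff real_norm_def by blast
    show ?thesis
    proof (rule integrableI_bounded_set[where A = S and B = "\<bar>N\<bar> * B"])
      show "(\<lambda>u. W0 u * g u) \<in> borel_measurable lborel"
        using meas borel_measurable_continuous_onI[OF g] by measurable
      show "AE u\<in>S in lborel. norm (W0 u * g u) \<le> \<bar>N\<bar> * B"
      proof (intro AE_I2 impI)
        fix u assume "u \<in> S"
        then have "\<bar>W0 u\<bar> * \<bar>g u\<bar> \<le> \<bar>N\<bar> * B" using Sball by (intro mult_mono W0_bound B) auto
        then show "norm (W0 u * g u) \<le> \<bar>N\<bar> * B" by (simp add: abs_mult)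
      qed
    qed (use Sb Sfin in \<open>auto simp: less_top[symmetric]\<close>)
  qed
  show thesis
  proof (rule that[of C])
    show "0 \<le> C" using Z_pos by (simp add: C_def V_def)
    fix p :: "complex^'n" assume p: "norm p \<le> 2"
    define d where "d = (\<lambda>u k::complex^'n. 4 * max 0 (\<epsilon>\<^sup>2 - (norm (u - p))\<^sup>2) * ((u - p) \<bullet> k))"
    define L where "L = (\<lambda>k. (\<integral>u. W0 u * d u k \<partial>lborel) / Z)"
    have dI: "integrable lborel (\<lambda>u. W0 u * d u k)" for k
      unfolding d_def by (intro I continuous_intros)
    have "linear L"
    proof (rule linearI)
      fix k k' :: "complex^'n" and c :: real
      have "W0 u * d u (k + k') = W0 u * d u k + W0 u * d u k'" for u
        by (simp add: d_def inner_add_right algebra_simps)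
      then show "L (k + k') = L k + L k'" by (simp add: L_def dI add_divide_distrib)
      have "(\<lambda>u. W0 u * d u (c *\<^sub>R k)) = (\<lambda>u. c * (W0 u * d u k))" by (simp add: d_def fun_eq_iff)
      then show "L (c *\<^sub>R k) = c *\<^sub>R L k" unfolding L_def by (simp only:) simp
    qed
    moreover have "\<bar>mollify S W \<epsilon> (p + m + k) - mollify S W \<epsilon> (p + m) - L k\<bar> \<le> C * norm k * (norm k + norm m)"
      if mk: "norm m \<le> 1" "norm k \<le> 1" for m k
    proof -
      define E where "E = (\<lambda>u. W0 u * (bump \<epsilon> (u - p - m - k) - bump \<epsilon> (u - p - m) - d u k))"
      have bI: "integrable lborel (\<lambda>u. W0 u * bump \<epsilon> (u - x))" for x
        by (intro I continuous_intros)
      have "(\<integral>u. E u \<partial>lborel) = (\<integral>u. W0 u * bump \<epsilon> (u - (p + m + k)) - W0 u * bump \<epsilon> (u - (p + m)) - W0 u * d u k \<partial>lborel)"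
        by (simp add: E_def algebra_simps)
      also have "\<dots> = Z * (mollify S W \<epsilon> (p + m + k) - mollify S W \<epsilon> (p + m) - L k)"
        using Z_pos bI dI by (simp add: mollify_def L_def Z_eq[symmetric] right_diff_distrib)
      finally have eq: "(\<integral>u. E u \<partial>lborel) = Z * (mollify S W \<epsilon> (p + m + k) - mollify S W \<epsilon> (p + m) - L k)" .
      let ?B = "\<bar>N\<bar> * (150 * norm k * (norm k + norm m))"
      have "\<bar>\<integral>u. E u \<partial>lborel\<bar> \<le> (\<integral>u. \<bar>E u\<bar> \<partial>lborel)" by (rule integral_abs_bound)
      also have "\<dots> \<le> (\<integral>u. indicator S u * ?B \<partial>lborel)"
      proof (intro integral_mono)
        show "integrable lborel (\<lambda>u. \<bar>E u\<bar>)"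
          unfolding E_def d_def by (intro integrable_abs I continuous_intros)
        show "integrable lborel (\<lambda>u. indicator S u * ?B)" using Sb Sfin by simp
        fix u
        show "\<bar>E u\<bar> \<le> indicator S u * ?B"
        proof (cases "u \<in> S")
          case True
          then have "norm (u - p) \<le> 4" using Sball p norm_triangle_ineq4[of u p] by auto
          then have "\<bar>bump \<epsilon> (u - p - m - k) - bump \<epsilon> (u - p - m) - d u k\<bar> \<le> 150 * norm k * (norm k + norm m)"
            unfolding d_def by (intro bump_Taylor \<epsilon> mk)
          then have "\<bar>W0 u\<bar> * \<bar>bump \<epsilon> (u - p - m - k) - bump \<epsilon> (u - p - m) - d u k\<bar> \<le> ?B"
            by (intro mult_mono W0_bound) auto
          then show ?thesis using True by (simp add: E_def abs_mult)
        qed (simp add: E_def)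
      qed
      also have "\<dots> = V * ?B" using Sb Sfin by (simp add: V_def)
      finally have "Z * \<bar>mollify S W \<epsilon> (p + m + k) - mollify S W \<epsilon> (p + m) - L k\<bar> \<le> V * ?B"
        unfolding eq using Z_pos by (simp add: abs_mult)
      then show ?thesis unfolding C_def using Z_pos by (simp add: field_simps)
    qed
    ultimately show "\<exists>L. linear L \<and> (\<forall>m k. norm m \<le> 1 \<longrightarrow> norm k \<le> 1 \<longrightarrow>
       \<bar>mollify S W \<epsilon> (p + m + k) - mollify S W \<epsilon> (p + m) - L k\<bar> \<le> C * norm k * (norm k + norm m))"
      by blast
  qed
qed

end

section \<open>The maximum principle along holomorphic curves\<close>

text \<open>The curve is \<open>x\<close> to \<open>g(x) (w0 + x y)\<close>. A smooth plurisubharmonic function is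
  subharmonic along holomorphic curves, and this is the case at hand. At \<open>x0\<close> the curve is
  \<open>p + \<xi> A + \<xi>^2 B\<close> up to third order. The linear part is a complex line, on which the sub-mean value
  inequality for \<open>M\<close> applies. The displacement by \<open>\<xi>^2 B\<close> changes \<open>M\<close>, to second order, by
  \<open>L (\<xi>^2 B)\<close>, which is a harmonic quadratic polynomial in \<open>\<xi>\<close> because \<open>L\<close> is real linear; it is absorbed
  into the test polynomial.\<close>
lemma mollifier_composed_with_curve:
  fixes M :: "complex^'n \<Rightarrow> real"
  assumes r: "0 < r" and g: "g holomorphic_on ball x0 r"
    and strict: "\<And>p. norm p \<le> 2 \<Longrightarrow> \<exists>L. linear L \<and> (\<forall>m k. norm m \<le> 1 \<longrightarrow> norm k \<le> 1 \<longrightarrow>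
       \<bar>M (p + m + k) - M (p + m) - L k\<bar> \<le> C * norm k * (norm k + norm m))"
    and C: "0 \<le> C"
    and mean: "\<And>z w. (\<And>x. norm x \<le> 1 \<Longrightarrow> \<rho>1 \<le> norm (z + x *s w) \<and> norm (z + x *s w) \<le> \<rho>2) \<Longrightarrow>
         M z \<le> (LINT \<theta>:{0..2*pi}|lborel. M (z + cis \<theta> *s w)) / (2 * pi) \<and>
         set_integrable lborel {0..2*pi} (\<lambda>\<theta>. M (z + cis \<theta> *s w))"
    and p: "\<rho>1 < norm (g x0 *s (w0 + x0 *s y))" "norm (g x0 *s (w0 + x0 *s y)) < \<rho>2" "\<rho>2 \<le> 2"
  shows "subharmonic_touching (\<lambda>x. M (g x *s (w0 + x *s y))) x0"
  unfolding subharmonic_touching_def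
proof (intro allI impI)
  fix \<alpha> \<beta> :: complex and \<delta> R :: real assume \<delta>: "0 < \<delta>" and R: "0 < R"
  obtain g1 g2 Cg where Cg: "0 \<le> Cg"
    "\<And>x. dist x x0 < r / 2 \<Longrightarrow> norm (g x - (g x0 + g1 * (x - x0) + g2 * (x - x0)\<^sup>2)) \<le> Cg * norm (x - x0) ^ 3"
    by (rule holomorphic_Taylor_order_2[OF g r]) (rule that; assumption)
  define P where "P = w0 + x0 *s y"
  define p where "p = g x0 *s P"
  define A where "A = g x0 *s y + g1 *s P"
  define B where "B = g1 *s y + g2 *s P"
  define D where "D = Cg * (norm P + norm y) + norm g2 * norm y"
  have D0: "0 \<le> D" using Cg by (simp add: D_def)
  \<comment> \<open>The curve has the second order expansion \<open>p + \<xi> A + \<xi>\<^sup>2 B\<close>.\<close>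
  have curve: "norm (g (x0 + \<xi>) *s (w0 + (x0 + \<xi>) *s y) - (p + \<xi> *s A) - \<xi>\<^sup>2 *s B) \<le> D * norm \<xi> ^ 3"
    if \<xi>: "norm \<xi> < r / 2" "norm \<xi> \<le> 1" for \<xi>
  proof -
    define e where "e = g (x0 + \<xi>) - (g x0 + g1 * \<xi> + g2 * \<xi>\<^sup>2)"
    have e: "norm e \<le> Cg * norm \<xi> ^ 3" using Cg(2)[of "x0 + \<xi>"] \<xi> by (simp add: e_def dist_norm)
    have ge: "g (x0 + \<xi>) = g x0 + g1 * \<xi> + g2 * \<xi>\<^sup>2 + e" by (simp add: e_def)
    have "g (x0 + \<xi>) *s (w0 + (x0 + \<xi>) *s y) - (p + \<xi> *s A) - \<xi>\<^sup>2 *s B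
        = e *s (P + \<xi> *s y) + (g2 * \<xi> ^ 3) *s y"
      unfolding ge P_def p_def A_def B_def
      by (simp add: vec_eq_iff algebra_simps power2_eq_square power3_eq_cube)
    also have "norm \<dots> \<le> norm e * norm (P + \<xi> *s y) + norm g2 * norm \<xi> ^ 3 * norm y"
      by (rule order_trans[OF norm_triangle_ineq]) (simp only: norm_vector_scalar norm_mult norm_power order_refl)
    also have "norm e * norm (P + \<xi> *s y) \<le> (Cg * norm \<xi> ^ 3) * (norm P + norm y)"
    proof (intro mult_mono e)
      have "norm (P + \<xi> *s y) \<le> norm P + norm \<xi> * norm y" by (metis norm_triangle_ineq norm_vector_scalar)
      also have "norm \<xi> * norm y \<le> norm y" using \<xi>(2) by (simp add: mult_left_le_one_le)
      finally show "norm (P + \<xi> *s y) \<le> norm P + norm y" by simp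
    qed (use Cg in auto)
    finally show ?thesis by (simp add: D_def algebra_simps)
  qed
  have np: "\<rho>1 < norm p" "norm p < \<rho>2" using p by (auto simp: p_def P_def)
  obtain L where L: "linear L" "\<And>m k. norm m \<le> 1 \<Longrightarrow> norm k \<le> 1 \<Longrightarrow>
       \<bar>M (p + m + k) - M (p + m) - L k\<bar> \<le> C * norm k * (norm k + norm m)"
    using strict[of p] np p(3) by auto
  obtain KL where KL: "0 < KL" "\<And>k. \<bar>L k\<bar> \<le> KL * norm k"
    using linear_bounded_pos[OF L(1)] by (metis real_norm_def)
  define A' where "A' = norm A + 1"
  define B' where "B' = norm B + D + 1"
  have A': "1 \<le> A'" "norm A \<le> A'" and B': "1 \<le> B'" using D0 by (auto simp: A'_def B'_def)
  define c3 where "c3 = KL * D + C * B' * (B' + A')"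
  have c3: "0 \<le> c3" using KL D0 C A' B' by (simp add: c3_def)
  define \<eta> where "\<eta> = min (\<rho>2 - norm p) (norm p - \<rho>1)"
  have \<eta>: "0 < \<eta>" using np by (simp add: \<eta>_def)
  define s where "s = min (min (R / 2) (r / 4)) (min (min (1 / A') (1 / B')) (min (\<eta> / A') (\<delta> / (2 * (c3 + 1)))))"
  have s: "0 < s" using R r A' B' \<eta> \<delta> c3 by (auto simp: s_def)
  have sR: "s < R" "s < r / 2" using R r s by (auto simp: s_def)
  have sA: "s * A' \<le> 1" "s * A' \<le> \<eta>" "s * B' \<le> 1" "s * (c3 + 1) \<le> \<delta> / 2"
  proof -
    have le: "s \<le> 1 / A'" "s \<le> 1 / B'" "s \<le> \<eta> / A'" "s \<le> \<delta> / (2 * (c3 + 1))"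
      by (simp_all add: s_def min_le_iff_disj)
    have pos: "0 < A'" "0 < B'" "0 < 2 * (c3 + 1)" using A' B' c3 by auto
    show "s * A' \<le> 1" "s * A' \<le> \<eta>" "s * B' \<le> 1"
      using le pos by (simp_all add: pos_le_divide_eq)
    have "s * (2 * (c3 + 1)) \<le> \<delta>" using le(4) pos(3) by (simp only: pos_le_divide_eq)
    then show "s * (c3 + 1) \<le> \<delta> / 2" by (simp add: algebra_simps)
  qed
  have s1: "s \<le> 1" 
  proof -
    have "s * 1 \<le> s * A'" using A'(1) s by (intro mult_left_mono) auto
    then show ?thesis using sA(1) by linarith
  qed
  have inside: "\<rho>1 \<le> norm (p + x *s (complex_of_real s *s A)) \<and> norm (p + x *s (complex_of_real s *s A)) \<le> \<rho>2"
    if "norm x \<le> 1" for x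
  proof -
    have "norm (x *s (complex_of_real s *s A)) \<le> 1 * (s * A')"
      unfolding norm_vector_scalar using that s A' by (intro mult_mono) auto
    then have "norm (x *s (complex_of_real s *s A)) \<le> \<eta>" using sA by simp
    then show ?thesis
      using norm_triangle_ineq[of p "x *s (complex_of_real s *s A)"] norm_diff_ineq[of p "x *s (complex_of_real s *s A)"]
      unfolding \<eta>_def by linarith
  qed
  \<comment> \<open>The coefficient of the harmonic quadratic form \<open>\<xi>\<close> to \<open>L (\<xi>^2 B)\<close>.\<close>
  define \<gamma> where "\<gamma> = Complex (L B) (- L (\<i> *s B))"
  have LB: "L (cis t *s B) = Re (\<gamma> * cis t)" for t
  proof -
    have "cis t *s B = cos t *\<^sub>R B + sin t *\<^sub>R (\<i> *s B)"
      by (simp add: vec_eq_iff complex_eq_iff algebra_simps)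
    then show ?thesis using L(1) by (simp add: linear_add linear_scale \<gamma>_def)
  qed
  have "0 < \<delta> / 2 * s\<^sup>2" using \<delta> s by simp
  then obtain \<theta> where \<theta>: "M p + Re ((\<alpha> * s) * cis \<theta> + ((\<beta> - \<gamma>) * s\<^sup>2) * cis (2 * \<theta>)) - \<delta> / 2 * s\<^sup>2
      \<le> M (p + cis \<theta> *s (complex_of_real s *s A))"
    using circle_mean_touching[of "\<lambda>\<theta>. M (p + cis \<theta> *s (complex_of_real s *s A))" "M p" "\<delta> / 2 * s\<^sup>2" "\<alpha> * s" "(\<beta> - \<gamma>) * s\<^sup>2"]
      mean[OF inside] by blast
  define \<xi> where "\<xi> = of_real s * cis \<theta>"
  have n\<xi>: "norm \<xi> = s" using s by (simp add: \<xi>_def norm_mult)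
  have \<xi>2: "\<xi>\<^sup>2 = of_real (s\<^sup>2) * cis (2 * \<theta>)"
    by (simp add: \<xi>_def power_mult_distrib) (simp add: power2_eq_square cis_mult)
  define m where "m = \<xi> *s A"
  define k where "k = g (x0 + \<xi>) *s (w0 + (x0 + \<xi>) *s y) - (p + \<xi> *s A)"
  have m: "norm m \<le> s * A'" unfolding m_def norm_vector_scalar n\<xi> using s A' by (intro mult_left_mono) auto
  have kr: "norm (k - \<xi>\<^sup>2 *s B) \<le> D * s ^ 3" unfolding k_def using curve[of \<xi>] n\<xi> sR s1 by simp
  have k: "norm k \<le> s\<^sup>2 * B'"
  proof -
    have "norm k \<le> norm (k - \<xi>\<^sup>2 *s B) + norm (\<xi>\<^sup>2 *s B)" by (metis diff_add_cancel norm_triangle_ineq)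
    also have "norm (\<xi>\<^sup>2 *s B) = s\<^sup>2 * norm B" by (simp add: norm_power n\<xi>)
    finally have nk: "norm k \<le> norm (k - \<xi>\<^sup>2 *s B) + s\<^sup>2 * norm B" .
    have "D * s ^ 3 \<le> D * s\<^sup>2" using D0 s s1 by (intro mult_left_mono power_decreasing) auto
    then have "norm k \<le> D * s\<^sup>2 + s\<^sup>2 * norm B" using kr nk by linarith
    also have "\<dots> \<le> s\<^sup>2 * B'" by (simp add: B'_def algebra_simps)
    finally show ?thesis .
  qed
  have k': "norm k \<le> s * B' * s" using k by (simp add: power2_eq_square mult_ac)
  have "s * B' * s \<le> 1 * 1" using sA s s1 B' by (intro mult_mono) auto
  then have k1: "norm k \<le> 1" using k' by linarith
  have m1: "norm m \<le> 1" using m sA by linarith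
  have "\<bar>M (p + m + k) - M (p + m) - L k\<bar> \<le> C * norm k * (norm k + norm m)"
    by (rule L(2)[OF m1 k1])
  also have "\<dots> \<le> C * (s\<^sup>2 * B') * (s * B' + s * A')"
  proof (intro mult_mono add_mono m mult_left_mono C k)
    have "s\<^sup>2 * B' \<le> s * B'" using s s1 B' by (simp add: power2_eq_square mult_left_le)
    then show "norm k \<le> s * B'" using k by linarith
  qed (use C s B' in auto)
  finally have 1: "\<bar>M (p + m + k) - M (p + m) - L k\<bar> \<le> C * B' * (B' + A') * s ^ 3"
    by (simp add: power2_eq_square power3_eq_cube algebra_simps)
  have "L k - L (\<xi>\<^sup>2 *s B) = L (k - \<xi>\<^sup>2 *s B)" using L(1) by (simp add: linear_diff)
  also have "\<bar>\<dots>\<bar> \<le> KL * (D * s ^ 3)"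
    using KL(2)[of "k - \<xi>\<^sup>2 *s B"] kr KL(1) by (meson mult_left_mono order_trans less_imp_le)
  finally have 2: "\<bar>L k - L (\<xi>\<^sup>2 *s B)\<bar> \<le> KL * D * s ^ 3" by (simp add: mult.assoc)
  have 3: "L (\<xi>\<^sup>2 *s B) = s\<^sup>2 * Re (\<gamma> * cis (2 * \<theta>))"
  proof -
    have "\<xi>\<^sup>2 *s B = s\<^sup>2 *\<^sub>R (cis (2 * \<theta>) *s B)"
      unfolding \<xi>2 by (simp add: vec_eq_iff) (simp add: scaleR_conv_of_real)
    then show ?thesis using L(1) LB[of "2 * \<theta>"] by (simp add: linear_scale)
  qed
  have 4: "p + cis \<theta> *s (complex_of_real s *s A) = p + m"
    by (simp add: m_def \<xi>_def mult.commute)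
  have 5: "Re ((\<alpha> * s) * cis \<theta> + ((\<beta> - \<gamma>) * s\<^sup>2) * cis (2 * \<theta>)) = Re (\<alpha> * \<xi> + \<beta> * \<xi>\<^sup>2) - s\<^sup>2 * Re (\<gamma> * cis (2 * \<theta>))"
    unfolding \<xi>2 unfolding \<xi>_def by (simp add: algebra_simps)
  have c3s: "c3 * s ^ 3 \<le> \<delta> / 2 * s\<^sup>2"
  proof -
    have "c3 * s \<le> \<delta> / 2" using sA(4) s by (simp add: algebra_simps)
    then have "c3 * s * s\<^sup>2 \<le> \<delta> / 2 * s\<^sup>2" by (rule mult_right_mono) simp
    then show ?thesis by (simp add: power2_eq_square power3_eq_cube mult.assoc)
  qed
  have "C * B' * (B' + A') * s ^ 3 + KL * D * s ^ 3 = c3 * s ^ 3" by (simp add: c3_def algebra_simps)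
  then have "M p + Re (\<alpha> * \<xi> + \<beta> * \<xi>\<^sup>2) - \<delta> * s\<^sup>2 \<le> M (p + m + k)"
    using 1 2 \<theta> c3s unfolding 3 4 5 by linarith
  moreover have "p + m + k = g (x0 + \<xi>) *s (w0 + (x0 + \<xi>) *s y)" by (simp add: k_def m_def)
  ultimately show "\<exists>x. 0 < dist x x0 \<and> dist x x0 < R \<and>
        M (g x0 *s (w0 + x0 *s y)) + Re (\<alpha> * (x - x0) + \<beta> * (x - x0)\<^sup>2) - \<delta> * (dist x x0)\<^sup>2
        \<le> M (g x *s (w0 + x *s y))"
    using n\<xi> s sR by (intro exI[of _ "x0 + \<xi>"]) (simp add: dist_norm p_def P_def)
qed

text \<open>Upper semicontinuity makes the bound hold near each point of the image of \<open>K\<close>;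
  compactness gives a uniform radius.\<close>
lemma mollification_upper_bound_on_compact:
  fixes W :: "complex^'n \<Rightarrow> real" and q :: "complex \<Rightarrow> complex^'n"
  assumes K: "compact K" and q: "continuous_on K q" and H: "continuous_on K H"
    and G: "open G" "q ` K \<subseteq> G" and W: "usc_real_on G W"
    and le: "\<And>x. x \<in> K \<Longrightarrow> W (q x) \<le> H x" and \<eta>: "0 < \<eta>"
  obtains d where "0 < d" "\<And>x u. x \<in> K \<Longrightarrow> dist u (q x) < d \<Longrightarrow> W u \<le> H x + \<eta>"
proof -
  have "\<exists>d>0. \<forall>x'\<in>K. \<forall>u. dist x' x < d \<longrightarrow> dist u (q x') < d \<longrightarrow> W u \<le> H x' + \<eta>" if x: "x \<in> K" for x
  proof -
    have qx: "q x \<in> G" using x G by auto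
    have "W (q x) < H x + \<eta> / 2" using le[OF x] \<eta> by simp
    then obtain d1 where d1: "d1 > 0" "\<And>u. u \<in> G \<Longrightarrow> dist u (q x) < d1 \<Longrightarrow> W u < H x + \<eta> / 2"
      using usc_real_onD[OF W qx] by blast
    obtain d2 where d2: "d2 > 0" "\<And>u. dist u (q x) < d2 \<Longrightarrow> u \<in> G"
      using G(1) qx unfolding open_dist by blast
    define d3 where "d3 = min d1 d2 / 2"
    have d3: "d3 > 0" using d1 d2 by (simp add: d3_def)
    obtain d4 where d4: "d4 > 0" "\<And>x'. x' \<in> K \<Longrightarrow> dist x' x < d4 \<Longrightarrow> dist (q x') (q x) < d3"
      using q x d3 unfolding continuous_on_iff by meson
    have "\<eta> / 2 > 0" using \<eta> by simp
    then obtain d5 where d5: "d5 > 0" "\<And>x'. x' \<in> K \<Longrightarrow> dist x' x < d5 \<Longrightarrow> dist (H x') (H x) < \<eta> / 2"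
      using H x unfolding continuous_on_iff by meson
    show ?thesis
    proof (intro exI[of _ "min d3 (min d4 d5)"] conjI ballI allI impI)
      show "0 < min d3 (min d4 d5)" using d3 d4 d5 by simp
      fix x' u assume a: "x' \<in> K" "dist x' x < min d3 (min d4 d5)" "dist u (q x') < min d3 (min d4 d5)"
      have "dist u (q x) \<le> dist u (q x') + dist (q x') (q x)" by (rule dist_triangle)
      also have "\<dots> < d3 + d3" using a d4(2)[OF a(1)] by (intro add_strict_mono) auto
      finally have "dist u (q x) < d1" "dist u (q x) < d2" by (auto simp: d3_def)
      then have "W u < H x + \<eta> / 2" using d1 d2 by blast
      moreover have "dist (H x') (H x) < \<eta> / 2" using a d5 by auto
      ultimately show "W u \<le> H x' + \<eta>" unfolding dist_real_def by linarith
    qed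
  qed
  then obtain d where d: "\<And>x. x \<in> K \<Longrightarrow> d x > 0 \<and> (\<forall>x'\<in>K. \<forall>u. dist x' x < d x \<longrightarrow> dist u (q x') < d x \<longrightarrow> W u \<le> H x' + \<eta>)"
    by metis
  have "\<exists>F\<subseteq>K. finite F \<and> K \<subseteq> (\<Union>x\<in>F. ball x (d x))"
  proof (rule compactE_image[OF K, of K "\<lambda>x. ball x (d x)"])
    show "K \<subseteq> (\<Union>x\<in>K. ball x (d x))" using d by force
  qed auto
  then obtain F where F: "F \<subseteq> K" "finite F" "K \<subseteq> (\<Union>x\<in>F. ball x (d x))" by blast
  define d0 where "d0 = Min (insert 1 (d ` F))"
  have d0: "0 < d0" unfolding d0_def using F d by (subst Min_gr_iff) auto
  have d0_le: "d0 \<le> d x" if "x \<in> F" for x unfolding d0_def using F(2) that by (intro Min_le) auto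
  show thesis
  proof (rule that[OF d0])
    fix x u assume x: "x \<in> K" and u: "dist u (q x) < d0"
    obtain y where y: "y \<in> F" "x \<in> ball y (d y)" using F(3) x by blast
    have "dist u (q x) < d y" using u d0_le[OF y(1)] by linarith
    then show "W u \<le> H x + \<eta>" using d[of y] y F(1) x by (auto simp: dist_commute)
  qed
qed

text \<open>The factor \<open>exp (s h(x))\<close> is not holomorphic, but where \<open>h\<close> is the real part of a
  holomorphic function \<open>f\<close> it has the same modulus as \<open>exp (s f(x))\<close>, and the rotation invariant function \<open>W\<close>
  sees only the modulus. Hence \<open>W\<close> is evaluated along a holomorphic curve. To avoid
  composing a merely semicontinuous function with a curve, the maximum principle is applied to a mollification
  of \<open>W\<close>, which dominates \<open>W\<close>, is rotation invariant, and exceeds \<open>H\<close> on the boundary by at most \<open>\<eta>\<close>.\<close>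
lemma maximum_principle_along_rotating_curve:
  fixes W :: "complex^'n \<Rightarrow> real"
  assumes W: "bounded_psh_on {z. 0 < norm z \<and> norm z < 2} W"
    and rot: "\<And>c z. norm c = 1 \<Longrightarrow> W (c *s z) = W z"
    and s: "s \<le> 0" and X: "open X" "bounded X"
    and h: "continuous_on (closure X) h" "\<And>x. x \<in> closure X \<Longrightarrow> 0 \<le> h x" "\<And>x. x \<in> X \<Longrightarrow> harmonic_at h x"
    and w: "\<And>x. x \<in> closure X \<Longrightarrow> 0 < norm (w0 + x *s y) \<and> norm (w0 + x *s y) < 2"
    and H: "continuous_on (closure X) H" "\<And>x. x \<in> X \<Longrightarrow> harmonic_at H x"
    and bdry: "\<And>x. x \<in> closure X \<Longrightarrow> x \<notin> X \<Longrightarrow> W (of_real (exp (s * h x)) *s (w0 + x *s y)) \<le> H x"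
    and x: "x \<in> X"
  shows "W (of_real (exp (s * h x)) *s (w0 + x *s y)) \<le> H x"
proof -
  let ?G = "{z::complex^'n. 0 < norm z \<and> norm z < 2}"
  have oG: "open ?G" by (intro open_Collect_conj open_Collect_less continuous_intros)
  have usc: "usc_real_on ?G W" using W by (simp add: bounded_psh_on_def)
  define q where "q = (\<lambda>x. complex_of_real (exp (s * h x)) *s (w0 + x *s y))"
  have qc: "continuous_on (closure X) q" unfolding q_def by (intro continuous_intros h)
  have nq: "norm (q x) = exp (s * h x) * norm (w0 + x *s y)" for x
    unfolding q_def norm_vector_scalar by simp
  have qG: "q ` closure X \<subseteq> ?G"
  proof clarify
    fix x assume x: "x \<in> closure X"
    have "exp (s * h x) \<le> 1" using s h(2)[OF x] by (simp add: mult_nonpos_nonneg)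
    then have "exp (s * h x) * norm (w0 + x *s y) \<le> norm (w0 + x *s y)" by (simp add: mult_left_le_one_le)
    then show "0 < norm (q x) \<and> norm (q x) < 2" unfolding nq using w[OF x] by (smt (verit) exp_gt_zero mult_pos_pos)
  qed
  have cX: "compact (closure X)" using X(2) by (simp add: compact_closure)
  have xcl: "x \<in> closure X" using x closure_subset by auto
  have ne: "closure X \<noteq> {}" and nqc: "continuous_on (closure X) (\<lambda>x. norm (q x))"
    using xcl by (auto intro!: continuous_intros qc)
  obtain xa where xa: "xa \<in> closure X" "\<And>x. x \<in> closure X \<Longrightarrow> norm (q xa) \<le> norm (q x)"
    using continuous_attains_inf[OF cX ne nqc] by (elim bexE) blast
  obtain xb where xb: "xb \<in> closure X" "\<And>x. x \<in> closure X \<Longrightarrow> norm (q x) \<le> norm (q xb)"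
    using continuous_attains_sup[OF cX ne nqc] by (elim bexE) blast
  \<comment> \<open>The curve runs inside a compact shell, with room for the mollification radius.\<close>
  define r1 where "r1 = norm (q xa) / 2"
  define r2 where "r2 = (norm (q xb) + 2) / 2"
  have r1: "0 < r1" "r1 < norm (q xa)" using qG xa(1) by (auto simp: r1_def)
  have r2: "norm (q xb) < r2" "r2 < 2" using qG xb(1) by (auto simp: r2_def)
  define S where "S = {z::complex^'n. r1 \<le> norm z \<and> norm z \<le> r2}"
  have SG: "S \<subseteq> ?G" using r1 r2 by (auto simp: S_def)
  have Sclosed: "closed S" unfolding S_def by (intro closed_Collect_conj closed_Collect_le continuous_intros)
  have "bounded S" by (rule bounded_subset[OF bounded_cball[of 0 r2]]) (auto simp: S_def)
  then have "compact S" using Sclosed by (simp add: compact_eq_bounded_closed)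
  then obtain N where N: "\<And>u. u \<in> S \<Longrightarrow> \<bar>W u\<bar> \<le> N" using W SG unfolding bounded_psh_on_def by meson
  have "(\<lambda>u. indicator S u * (indicator ?G u * W u)) \<in> borel_measurable borel"
    by (rule borel_measurable_times[OF _ usc_real_on_borel_measurable[OF oG usc]])
      (use Sclosed in \<open>simp add: borel_measurable_indicator\<close>)
  moreover have "(\<lambda>u. indicator S u * (indicator ?G u * W u)) = (\<lambda>u. indicator S u * W u)"
    using SG by (auto simp: fun_eq_iff indicator_def)
  ultimately have meas: "(\<lambda>u. indicator S u * W u) \<in> borel_measurable borel" by simp
  have "W (q x) \<le> H x + \<eta>" if \<eta>: "0 < \<eta>" for \<eta>
  proof -
    let ?K = "closure X - X"
    have cK: "compact ?K" using cX X(1) by (rule compact_diff)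
    obtain d where d: "0 < d" "\<And>x u. x \<in> ?K \<Longrightarrow> dist u (q x) < d \<Longrightarrow> W u \<le> H x + \<eta>"
    proof (rule mollification_upper_bound_on_compact[OF cK _ _ oG _ usc _ \<eta>, of q H])
      show "continuous_on ?K q" "continuous_on ?K H" using qc H(1) by (auto elim: continuous_on_subset)
      show "q ` ?K \<subseteq> ?G" using qG by auto
      show "W (q x) \<le> H x" if "x \<in> ?K" for x using that bdry by (auto simp: q_def)
    qed (rule that; assumption)
    define \<epsilon> where "\<epsilon> = min (min d 1) (min (r1 / 2) ((r2 - norm (q xb)) / 2))"
    have eps: "0 < \<epsilon>" "\<epsilon> \<le> 1" "\<epsilon> \<le> d" "\<epsilon> < r1" "\<epsilon> < r2 - norm (q xb)"
    proof -
      have "\<epsilon> \<le> (r2 - norm (q xb)) / 2" unfolding \<epsilon>_def by (rule min.coboundedI2[OF min.cobounded2])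
      also have "\<dots> < r2 - norm (q xb)" using r2(1) by (simp add: field_simps)
      finally show "\<epsilon> < r2 - norm (q xb)" .
    qed (use d r1 r2 in \<open>auto simp: \<epsilon>_def\<close>)
    interpret shell_mollifier W S r1 r2 \<epsilon> N "\<integral>v. bump \<epsilon> (v::complex^'n) \<partial>lborel"
    proof
      show "S = {z. r1 \<le> norm z \<and> norm z \<le> r2}" by (rule S_def)
      show "W z \<le> (LINT \<theta>:{0..2*pi}|lborel. W (z + cis \<theta> *s v)) / (2 * pi)"
        if "\<And>x. norm x \<le> 1 \<Longrightarrow> z + x *s v \<in> S" for z v
        by (rule bounded_psh_on_mean[OF W]) (use that SG in blast)
    qed (use r2 eps meas N in auto)
    define M where "M = mollify S W \<epsilon>"
    have inner: "r1 + \<epsilon> < norm (q x)" "norm (q x) < r2 - \<epsilon>" if "x \<in> closure X" for x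
      using xa(2)[OF that] xb(2)[OF that] eps by (auto simp: r1_def)
    obtain C where C0: "0 \<le> C" "\<And>p. norm p \<le> 2 \<Longrightarrow> \<exists>L. linear L \<and> (\<forall>m k. norm m \<le> 1 \<longrightarrow> norm k \<le> 1 \<longrightarrow>
       \<bar>mollify S W \<epsilon> (p + m + k) - mollify S W \<epsilon> (p + m) - L k\<bar> \<le> C * norm k * (norm k + norm m))"
      by (rule mollify_strict_derivative) (rule that; assumption)
    note C = C0[folded M_def]
    have Mrot: "M (c *s z) = M z" if "norm c = 1" for c z
      unfolding M_def by (rule mollify_rotate[OF that rot[OF that]])
    have sub: "subharmonic_touching (\<lambda>x. M (q x)) x0" if x0: "x0 \<in> X" for x0
    proof -
      have x0c: "x0 \<in> closure X" using x0 closure_subset by auto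
      obtain r f where r: "r > 0" "f holomorphic_on ball x0 r" "\<And>x. x \<in> ball x0 r \<Longrightarrow> h x = Re (f x)"
        using h(3)[OF x0] unfolding harmonic_at_def by blast
      define g where "g = (\<lambda>x. exp (of_real s * f x))"
      have g: "g holomorphic_on ball x0 r" unfolding g_def by (intro holomorphic_intros r)
      have qg: "M (q x) = M (g x *s (w0 + x *s y)) \<and> norm (q x) = norm (g x *s (w0 + x *s y))" if x: "x \<in> ball x0 r" for x
      proof -
        have "q x = cis (- (s * Im (f x))) *s (g x *s (w0 + x *s y))"
        proof -
          have "g x = of_real (exp (s * Re (f x))) * cis (s * Im (f x))" by (simp add: g_def exp_eq_polar)
          then have "cis (- (s * Im (f x))) * g x = of_real (exp (s * Re (f x))) * (cis (- (s * Im (f x))) * cis (s * Im (f x)))"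
            by (simp only: mult.left_commute)
          then have "cis (- (s * Im (f x))) * g x = of_real (exp (s * Re (f x)))" by (simp add: cis_mult)
          then show ?thesis unfolding q_def r(3)[OF x] vector_smult_assoc by (simp only:)
        qed
        then show ?thesis by (simp only: Mrot[OF norm_cis] norm_vector_scalar norm_cis mult_1 simp_thms)
      qed
      have x0b: "x0 \<in> ball x0 r" using r by simp
      have "subharmonic_touching (\<lambda>x. M (g x *s (w0 + x *s y))) x0"
      proof (rule mollifier_composed_with_curve[OF r(1) g C(2) C(1)])
        show "r1 + \<epsilon> < norm (g x0 *s (w0 + x0 *s y))" "norm (g x0 *s (w0 + x0 *s y)) < r2 - \<epsilon>"
          using inner[OF x0c] qg[OF x0b] by auto
        show "r2 - \<epsilon> \<le> 2" using r2 eps by simp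
        fix z w :: "complex^'n"
        assume inS: "\<And>x. norm x \<le> 1 \<Longrightarrow> r1 + \<epsilon> \<le> norm (z + x *s w) \<and> norm (z + x *s w) \<le> r2 - \<epsilon>"
        show "M z \<le> (LINT \<theta>:{0..2*pi}|lborel. M (z + cis \<theta> *s w)) / (2 * pi) \<and>
         set_integrable lborel {0..2*pi} (\<lambda>\<theta>. M (z + cis \<theta> *s w))"
          unfolding M_def by (intro conjI mollify_mean inS)
      qed
      then have T: "\<forall>\<alpha> \<beta> \<delta> R. 0 < \<delta> \<longrightarrow> 0 < R \<longrightarrow> (\<exists>x. 0 < dist x x0 \<and> dist x x0 < R \<and>
          M (q x0) + Re (\<alpha> * (x - x0) + \<beta> * (x - x0)\<^sup>2) - \<delta> * (dist x x0)\<^sup>2 \<le> M (g x *s (w0 + x *s y)))"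
        unfolding subharmonic_touching_def conjunct1[OF qg[OF x0b]] .
      show ?thesis unfolding subharmonic_touching_def
      proof (intro allI impI)
        fix \<alpha> \<beta> :: complex and \<delta> R :: real assume \<delta>: "0 < \<delta>" and R: "0 < R"
        have "0 < min R r" using R r(1) by simp
        from T[rule_format, OF \<delta> this, of \<alpha> \<beta>] obtain x where x: "0 < dist x x0" "dist x x0 < min R r"
          "M (q x0) + Re (\<alpha> * (x - x0) + \<beta> * (x - x0)\<^sup>2) - \<delta> * (dist x x0)\<^sup>2 \<le> M (g x *s (w0 + x *s y))"
          by (elim exE conjE)
        have xb: "x \<in> ball x0 r" using x(2) by (simp add: dist_commute)
        note gq = conjunct1[OF qg[OF xb], symmetric]
        have xR: "dist x x0 < R" using x(2) by simp
        show "\<exists>x. 0 < dist x x0 \<and> dist x x0 < R \<and>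
          M (q x0) + Re (\<alpha> * (x - x0) + \<beta> * (x - x0)\<^sup>2) - \<delta> * (dist x x0)\<^sup>2 \<le> M (q x)"
          by (rule exI[of _ x], intro conjI, rule x(1), rule xR, rule x(3)[unfolded gq])
      qed
    qed
    have contM: "continuous_on (closure X) (\<lambda>x. M (q x))"
    proof -
      have "continuous_on (cball 0 2) M"
        unfolding continuous_on_eq_continuous_within
      proof (rule ballI, rule continuous_at_imp_continuous_within)
        fix p :: "complex^'n" assume p: "p \<in> cball 0 2"
        obtain L where L: "linear L" "\<And>m k. norm m \<le> 1 \<Longrightarrow> norm k \<le> 1 \<Longrightarrow>
           \<bar>M (p + m + k) - M (p + m) - L k\<bar> \<le> C * norm k * (norm k + norm m)"
        proof -
          have "norm p \<le> 2" using p by simp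
          from C(2)[OF this] show ?thesis by (elim exE conjE) (rule that, assumption, blast)
        qed
        obtain KL where KL: "0 < KL" "\<And>k. \<bar>L k\<bar> \<le> KL * norm k"
          using linear_bounded_pos[OF L(1)] by (metis real_norm_def)
        have lip: "\<bar>M z - M p\<bar> \<le> (C + KL) * norm (z - p)" if z: "norm (z - p) \<le> 1" for z
        proof -
          have "\<bar>M z - M p - L (z - p)\<bar> \<le> C * norm (z - p) * norm (z - p)" using L(2)[of 0 "z - p"] z by simp
          also have "\<dots> \<le> C * norm (z - p) * 1" using C(1) z by (intro mult_left_mono) auto
          finally show ?thesis using KL(2)[of "z - p"] by (simp add: distrib_right)
        qed
        have pos: "0 < C + KL + 1" using C KL by simp
        show "isCont M p" unfolding continuous_at_eps_delta
        proof (intro allI impI)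
          fix e :: real assume e: "0 < e"
          show "\<exists>d>0. \<forall>z. dist z p < d \<longrightarrow> dist (M z) (M p) < e"
          proof (intro exI[of _ "min 1 (e / (C + KL + 1))"] conjI allI impI)
            show "0 < min 1 (e / (C + KL + 1))" using e pos by simp
            fix z assume z: "dist z p < min 1 (e / (C + KL + 1))"
            have "\<bar>M z - M p\<bar> \<le> (C + KL) * norm (z - p)" using lip[of z] z by (simp add: dist_norm)
            also have "\<dots> \<le> (C + KL + 1) * norm (z - p)" by (intro mult_right_mono) auto
            also have "\<dots> < e" using z pos by (simp add: dist_norm pos_less_divide_eq mult.commute)
            finally show "dist (M z) (M p) < e" by (simp add: dist_real_def)
          qed
        qed
      qed
      then show ?thesis
        by (rule continuous_on_compose2[OF _ qc]) (use qG in auto)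
    qed
    have "M (q x) \<le> H x + \<eta>"
    proof (rule maximum_principle[OF X _ _ _ sub _ x])
      show "usc_real_on (closure X) (\<lambda>x. M (q x))"
        unfolding usc_real_on_def
      proof (intro ballI allI impI)
        fix z c assume z: "z \<in> closure X" and c: "M (q z) < c"
        then obtain d where "d > 0" "\<And>x'. x' \<in> closure X \<Longrightarrow> dist x' z < d \<Longrightarrow> dist (M (q x')) (M (q z)) < c - M (q z)"
          using contM unfolding continuous_on_iff by (meson diff_gt_0_iff_gt)
        then show "\<exists>d>0. \<forall>x'\<in>closure X. dist x' z < d \<longrightarrow> M (q x') < c"
          by (force simp: dist_real_def abs_less_iff)
      qed
      show "continuous_on (closure X) (\<lambda>x. H x + \<eta>)" by (intro continuous_intros H)
      show "harmonic_at (\<lambda>x. H x + \<eta>) x" if "x \<in> X" for x by (intro harmonic_at_add H that harmonic_at_const)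
      show "M (q x) \<le> H x + \<eta>" if "x \<in> closure X" "x \<notin> X" for x
        unfolding M_def using inner[OF that(1)] d(2)[of x] that eps by (intro mollify_le) auto
    qed
    moreover have "W (q x) \<le> M (q x)" unfolding M_def using inner[OF xcl] by (intro mollify_ge) auto
    ultimately show ?thesis by simp
  qed
  then show ?thesis unfolding q_def using field_le_epsilon by blast
qed

section \<open>Functions with an isotropic logarithmic singularity\<close>

lemma maximum_principle_on_line:
  assumes G: "open G" and u: "bounded_psh_on G u" and X: "open X" "bounded X"
    and sub: "\<And>x. x \<in> closure X \<Longrightarrow> x *s w \<in> G"
    and H: "continuous_on (closure X) H" "\<And>x. x \<in> X \<Longrightarrow> harmonic_at H x"
    and bdry: "\<And>x. x \<in> closure X \<Longrightarrow> x \<notin> X \<Longrightarrow> u (x *s w) \<le> H x"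
    and x: "x \<in> X"
  shows "u (x *s w) \<le> H x"
proof (rule maximum_principle[OF X _ H(1) bdry _ H(2) x])
  have "usc_real_on G u" using u by (simp add: bounded_psh_on_def)
  then show "usc_real_on (closure X) (\<lambda>x. u (x *s w))"
    by (rule usc_real_on_compose_continuous) (use sub in \<open>auto intro!: continuous_intros\<close>)
  fix x assume "x \<in> X"
  then have "0 + x *s w \<in> G" using sub closure_subset by auto
  then have "subharmonic_touching (\<lambda>x. u (0 + x *s w)) x" by (rule subharmonic_touching_on_line[OF G u])
  then show "subharmonic_touching (\<lambda>x. u (x *s w)) x" by simp
qed

lemma harmonic_at_ln_cmod:
  assumes "x \<noteq> 0"
  shows "harmonic_at (\<lambda>x. ln (norm x)) x"
  by (rule harmonic_at_ln_norm[where f = "\<lambda>x. x" and S = UNIV]) (use assms in auto)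

lemma closure_annulus_subset:
  fixes r R :: real
  shows "closure {x::complex. r < norm x \<and> norm x < R} \<subseteq> {x. r \<le> norm x \<and> norm x \<le> R}"
proof (rule closure_minimal)
  show "closed {x::complex. r \<le> norm x \<and> norm x \<le> R}"
    by (intro closed_Collect_conj closed_Collect_le continuous_intros)
qed auto

lemma open_annulus: "open {x::complex. r < norm x \<and> norm x < R}"
  by (intro open_Collect_conj open_Collect_less continuous_intros)

lemma bounded_annulus: "bounded {x::complex. r < norm x \<and> norm x < R}"
  by (rule bounded_subset[OF bounded_ball[of 0 R]]) auto

abbreviation "punctured_ball \<equiv> {z::complex^'n. 0 < norm z \<and> norm z < 2}"

lemma open_punctured_ball: "open punctured_ball"
  by (intro open_Collect_conj open_Collect_less continuous_intros)

text \<open>The situation after rescaling: a plurisubharmonic function on the punctured ball of radius 2,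
  negative, bounded below by a logarithm, with Lelong number at least \<open>\<nu>\<close> at the origin (\<open>near_0\<close>) and at
  most \<open>\<nu>\<close> on every complex line (\<open>on_line\<close>).\<close>
locale isotropic_psh =
  fixes u :: "complex^'n \<Rightarrow> real" and \<nu> a b :: real
  assumes psh: "bounded_psh_on punctured_ball u"
    and nonpos: "\<And>z. 0 < norm z \<Longrightarrow> norm z < 2 \<Longrightarrow> u z \<le> 0"
    and lower: "\<And>z. 0 < norm z \<Longrightarrow> norm z \<le> 1 \<Longrightarrow> a * ln (norm z) - b \<le> u z"
    and near_0: "\<And>\<nu>'. \<nu>' < \<nu> \<Longrightarrow> \<exists>\<delta>>0. \<forall>z. 0 < norm z \<longrightarrow> norm z < \<delta> \<longrightarrow> u z \<le> \<nu>' * ln (norm z)"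
    and on_line: "\<And>w \<mu> \<delta>. w \<noteq> 0 \<Longrightarrow> \<nu> < \<mu> \<Longrightarrow> 0 < \<delta> \<Longrightarrow>
        \<exists>\<zeta>. 0 < norm \<zeta> \<and> norm \<zeta> < \<delta> \<and> \<mu> * ln (norm \<zeta>) \<le> u (\<zeta> *s w)"
    and pos: "0 < \<nu>" "0 < a" "0 < b"
begin

text \<open>On a line through the origin the function is compared with \<open>\<nu>' log \<bar>\<zeta>\<bar>\<close> on an annulus, for every
  \<open>\<nu>' < \<nu>\<close>: on the outer circle it is negative, and on a small inner circle the Lelong number gives the
  bound.\<close>
lemma upper:
  assumes z: "0 < norm z" "norm z \<le> 1"
  shows "u z \<le> \<nu> * ln (norm z)"
proof (cases "norm z = 1")
  case True
  then show ?thesis using nonpos[of z] by simp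
next
  case False
  then have z1: "norm z < 1" using z by simp
  have L: "ln (norm z) < 0" using z z1 by simp
  define w where "w = complex_of_real (1 / norm z) *s z"
  have w: "norm w = 1" unfolding w_def norm_vector_scalar norm_of_real using z by simp
  have zw: "complex_of_real (norm z) *s w = z" using z by (simp add: w_def vec_eq_iff)
  have le: "u z \<le> \<nu>' * ln (norm z)" if "\<nu>' < \<nu>" for \<nu>'
  proof -
    obtain \<delta> where \<delta>: "\<delta> > 0" "\<And>z. 0 < norm z \<Longrightarrow> norm z < \<delta> \<Longrightarrow> u z \<le> \<nu>' * ln (norm z)"
      using near_0[OF \<open>\<nu>' < \<nu>\<close>] by blast
    define r where "r = min \<delta> (norm z) / 2"
    have r: "0 < r" "r < \<delta>" "r < norm z" using \<delta>(1) z unfolding r_def by linarith+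
    let ?X = "{x::complex. r < norm x \<and> norm x < 1}"
    have cl: "r \<le> norm x \<and> norm x \<le> 1" if "x \<in> closure ?X" for x
      using that closure_annulus_subset[of r 1] by blast
    have "u (complex_of_real (norm z) *s w) \<le> \<nu>' * ln (norm (complex_of_real (norm z)))"
    proof (rule maximum_principle_on_line[OF open_punctured_ball psh open_annulus bounded_annulus, of r 1])
      show "x *s w \<in> punctured_ball" if "x \<in> closure ?X" for x
        using cl[OF that] r w by auto
      show "continuous_on (closure ?X) (\<lambda>x. \<nu>' * ln (norm x))"
        using cl r by (intro continuous_intros) force
      show "harmonic_at (\<lambda>x. \<nu>' * ln (norm x)) x" if "x \<in> ?X" for x
        by (intro harmonic_at_cmult harmonic_at_ln_cmod) (use that r in auto)
      show "u (x *s w) \<le> \<nu>' * ln (norm x)" if x: "x \<in> closure ?X" "x \<notin> ?X" for x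
      proof (cases "norm x = 1")
        case True
        then show ?thesis using nonpos[of "x *s w"] w by simp
      next
        case False
        then have "norm x = r" using cl[OF x(1)] x(2) by auto
        then show ?thesis using \<delta>(2)[of "x *s w"] w r by simp
      qed
    qed (use r z1 in auto)
    then show ?thesis unfolding zw by simp
  qed
  show ?thesis
  proof (rule ccontr)
    assume "\<not> ?thesis"
    then have "u z / ln (norm z) < \<nu>" using L by (simp add: neg_divide_less_eq)
    then obtain \<nu>' where \<nu>': "u z / ln (norm z) < \<nu>'" "\<nu>' < \<nu>" using dense by blast
    then have "\<nu>' * ln (norm z) < u z" using L by (simp add: neg_divide_less_eq)
    then show False using le[OF \<nu>'(2)] by simp
  qed
qed

abbreviation "U \<equiv> circle_max u"

lemma usc: "usc_real_on punctured_ball u"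
  using psh by (simp add: bounded_psh_on_def)

lemma punctured_ball_scalar: "z \<in> punctured_ball \<Longrightarrow> norm c = 1 \<Longrightarrow> c *s z \<in> punctured_ball"
  unfolding mem_Collect_eq norm_vector_scalar by simp

lemma U_psh: "bounded_psh_on punctured_ball U"
  by (rule bounded_psh_on_circle_max[OF open_punctured_ball psh punctured_ball_scalar])

lemma U_attained:
  assumes "z \<in> punctured_ball"
  obtains c where "norm c = 1" "U z = u (c *s z)"
proof -
  have "\<exists>\<theta>. U z = u (cis \<theta> *s z)" by (rule circle_max_attained[OF usc]) (use assms in simp)
  then show thesis using that norm_cis by blast
qed

lemma U_ge:
  assumes "z \<in> punctured_ball" "norm c = 1"
  shows "u (c *s z) \<le> U z"
proof -
  obtain \<theta> where c: "c = cis \<theta>" using assms(2) that[of "Arg c"]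
    by (metis cis_Arg norm_zero sgn_eq zero_neq_one div_by_1 of_real_1)
  show ?thesis unfolding c by (rule circle_max_ge[OF usc]) (use assms in simp)
qed

lemma U_ge_self: "z \<in> punctured_ball \<Longrightarrow> u z \<le> U z"
  using U_ge[of z 1] by simp

lemma U_nonpos:
  assumes "z \<in> punctured_ball"
  shows "U z \<le> 0"
proof -
  obtain c where c: "norm c = 1" "U z = u (c *s z)" using U_attained[OF assms] by blast
  have "c *s z \<in> punctured_ball" using assms c(1) by (rule punctured_ball_scalar)
  then show ?thesis using c(2) nonpos[of "c *s z"] by simp
qed

lemma U_norm_eq:
  assumes "norm x = norm (y::complex)"
  shows "U (x *s w) = U (y *s w)"
proof (cases "y = 0")
  case False
  have "x *s w = (x / y) *s (y *s w)" using False by simp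
  then show ?thesis using circle_max_rotate[of "x / y" u "y *s w"] False assms by (simp add: norm_divide)
qed (use assms in simp)

text \<open>The three circle theorem on the annulus between the radii \<open>e^s\<close> and 1, with the affine function of
  \<open>log \<bar>x\<bar>\<close> that has the prescribed boundary values.\<close>
lemma U_convex:
  assumes w: "0 < norm w" "norm w < 2" and s: "s \<le> 0" and \<tau>: "0 \<le> \<tau>" "\<tau> \<le> 1"
  shows "U (of_real (exp (\<tau> * s)) *s w) \<le> \<tau> * U (of_real (exp s) *s w) + (1 - \<tau>) * U w"
proof (cases "s = 0 \<or> \<tau> = 0 \<or> \<tau> = 1")
  case True
  then show ?thesis by (auto simp: algebra_simps)
next
  case False
  then have s0: "s < 0" and \<tau>0: "0 < \<tau>" "\<tau> < 1" using s \<tau> by auto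
  let ?r = "exp s"
  have r: "0 < ?r" "?r < 1" using s0 by auto
  let ?X = "{x::complex. ?r < norm x \<and> norm x < 1}"
  let ?H = "\<lambda>x. U w + ((U (of_real ?r *s w) - U w) / s) * ln (norm x)"
  have cl: "?r \<le> norm x \<and> norm x \<le> 1" if "x \<in> closure ?X" for x
    using that closure_annulus_subset[of ?r 1] by blast
  have mid: "?r < exp (\<tau> * s) \<and> exp (\<tau> * s) < 1"
    using s0 \<tau>0 by (simp add: mult_pos_neg mult_less_cancel_right1)
  have "U (complex_of_real (exp (\<tau> * s)) *s w) \<le> ?H (complex_of_real (exp (\<tau> * s)))"
  proof (rule maximum_principle_on_line[OF open_punctured_ball U_psh open_annulus bounded_annulus, of ?r 1])
    show "x *s w \<in> punctured_ball" if "x \<in> closure ?X" for x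
    proof -
      have x: "0 < norm x" "norm x \<le> 1" using cl[OF that] r by auto
      then have "norm x * norm w \<le> norm w" by (simp add: mult_left_le_one_le)
      then have "norm (x *s w) < 2" "0 < norm (x *s w)"
        unfolding norm_vector_scalar using x(1) w by (linarith, intro mult_pos_pos)
      then show ?thesis by blast
    qed
    show "continuous_on (closure ?X) ?H"
      using cl r by (intro continuous_intros) force
    show "harmonic_at ?H x" if "x \<in> ?X" for x
      by (intro harmonic_at_add harmonic_at_const harmonic_at_cmult harmonic_at_ln_cmod) (use that r in auto)
    show "U (x *s w) \<le> ?H x" if x: "x \<in> closure ?X" "x \<notin> ?X" for x
    proof (cases "norm x = 1")
      case True
      then show ?thesis using U_norm_eq[of x 1 w] by simp
    next
      case False
      then have "norm x = ?r" using cl[OF x(1)] x(2) by auto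
      then show ?thesis using U_norm_eq[of x "of_real ?r" w] s0 by simp
    qed
  qed (use mid in simp)
  also have "\<dots> = \<tau> * U (of_real (exp s) *s w) + (1 - \<tau>) * U w"
    using s0 by (simp add: field_simps)
  finally show ?thesis .
qed

text \<open>The Lelong number on the line of \<open>w\<close> provides one radius \<open>e^s1\<close> at which \<open>U \<ge> \<mu> s1\<close>. Since
  \<open>U\<close> is convex in \<open>s\<close> and nonpositive at \<open>s = 0\<close>, the inequality \<open>U \<ge> \<mu> s\<close> propagates to all
  \<open>s \<le> s1\<close>. On the remaining bounded range of \<open>s\<close> the logarithmic lower bound gives a constant.\<close>
lemma U_lower:
  assumes w: "0 < norm w" "norm w \<le> 1" and \<mu>: "\<nu> < \<mu>"
  obtains K where "0 < K" "\<And>s. s \<le> 0 \<Longrightarrow> \<mu> * s - K \<le> U (of_real (exp s) *s w)"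
proof -
  have w0: "w \<noteq> 0" using w by auto
  obtain \<zeta> where \<zeta>: "0 < norm \<zeta>" "norm \<zeta> < 1" "\<mu> * ln (norm \<zeta>) \<le> u (\<zeta> *s w)"
    using on_line[OF w0 \<mu>, of 1] by auto
  define s1 where "s1 = ln (norm \<zeta>)"
  have s1: "s1 < 0" "exp s1 = norm \<zeta>" using \<zeta> by (auto simp: s1_def)
  have inG: "of_real (exp s) *s w \<in> punctured_ball" if "s \<le> 0" for s
  proof -
    have "exp s * norm w \<le> norm w" using that by (simp add: mult_left_le_one_le)
    moreover have "0 < exp s * norm w" using w by simp
    moreover have "norm (complex_of_real (exp s) *s w) = exp s * norm w" by simp
    ultimately show ?thesis using w(2) unfolding mem_Collect_eq by linarith
  qed
  have "\<mu> * s1 \<le> U (\<zeta> *s w)"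
  proof -
    have "norm \<zeta> * norm w \<le> 1 * 1" using \<zeta> w by (intro mult_mono) auto
    moreover have "0 < norm \<zeta> * norm w" using \<zeta>(1) w(1) by (rule mult_pos_pos)
    ultimately have "\<zeta> *s w \<in> punctured_ball" unfolding mem_Collect_eq norm_vector_scalar by linarith
    then show ?thesis using \<zeta>(3) U_ge_self[of "\<zeta> *s w"] unfolding s1_def by linarith
  qed
  also have "U (\<zeta> *s w) = U (of_real (exp s1) *s w)" by (rule U_norm_eq) (simp add: s1)
  finally have U1: "\<mu> * s1 \<le> U (of_real (exp s1) *s w)" .
  define K where "K = 1 + \<bar>a * (s1 + ln (norm w)) - b\<bar>"
  show thesis
  proof (rule that[of K])
    show "0 < K" by (simp add: K_def)
    fix s :: real assume s: "s \<le> 0"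
    show "\<mu> * s - K \<le> U (of_real (exp s) *s w)"
    proof (cases "s \<le> s1")
      case True
      define \<tau> where "\<tau> = s1 / s"
      have \<tau>: "0 < \<tau>" "\<tau> \<le> 1" "\<tau> * s = s1" using True s1 by (auto simp: \<tau>_def divide_le_eq zero_less_divide_iff)
      have "U (of_real (exp (\<tau> * s)) *s w) \<le> \<tau> * U (of_real (exp s) *s w) + (1 - \<tau>) * U w"
        using w s \<tau> by (intro U_convex) auto
      also have "(1 - \<tau>) * U w \<le> 0" using U_nonpos[of w] w \<tau> by (intro mult_nonneg_nonpos) auto
      finally have "\<mu> * (\<tau> * s) \<le> \<tau> * U (of_real (exp s) *s w)" using U1 \<tau>(3) by simp
      then have "\<tau> * (\<mu> * s) \<le> \<tau> * U (of_real (exp s) *s w)" by (simp add: mult.left_commute)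
      then have "\<mu> * s \<le> U (of_real (exp s) *s w)" using \<tau>(1) by (rule mult_left_le_imp_le)
      then show ?thesis by (simp add: K_def)
    next
      case False
      let ?z = "complex_of_real (exp s) *s w"
      have nz: "0 < norm ?z" "norm ?z \<le> 1" using w s by (auto intro: mult_le_one)
      have "ln (norm ?z) = s + ln (norm w)" using w by (simp add: ln_mult)
      then have "a * (s1 + ln (norm w)) \<le> a * ln (norm ?z)" using False pos by (intro mult_left_mono) auto
      then have "a * (s1 + ln (norm w)) - b \<le> u ?z" using lower[OF nz] by linarith
      also have "\<dots> \<le> U ?z" by (rule U_ge_self[OF inG[OF s]])
      finally have "- K \<le> U ?z" by (simp add: K_def)
      moreover have "\<mu> * s \<le> 0" using s \<mu> pos by (simp add: mult_nonneg_nonpos)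
      ultimately show ?thesis by linarith
    qed
  qed
qed

text \<open>The parameters stay in a region where the directions \<open>w0 + x y\<close> are bounded away from 0 and from
  the sphere of radius 2.\<close>
lemma transversal_point:
  assumes w0: "1 / 3 \<le> norm (w0::complex^'n)" "norm w0 \<le> 1" and y: "norm y \<le> 1 / 4" and x: "norm x \<le> 1"
  shows "1 / 12 \<le> norm (w0 + x *s y) \<and> norm (w0 + x *s y) \<le> 5 / 4"
    and "s \<le> 0 \<Longrightarrow> of_real (exp s) *s (w0 + x *s y) \<in> punctured_ball"
proof -
  have "norm (x *s y) \<le> 1 * (1 / 4)" unfolding norm_vector_scalar using x y by (intro mult_mono) auto
  then show p: "1 / 12 \<le> norm (w0 + x *s y) \<and> norm (w0 + x *s y) \<le> 5 / 4"
    using norm_triangle_ineq[of w0 "x *s y"] norm_diff_ineq[of w0 "x *s y"] w0 by linarith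
  assume "s \<le> 0"
  then have "exp s * norm (w0 + x *s y) \<le> norm (w0 + x *s y)" by (simp add: mult_left_le_one_le)
  moreover have "norm (of_real (exp s) *s (w0 + x *s y)) = exp s * norm (w0 + x *s y)"
    unfolding norm_vector_scalar by simp
  moreover have "0 < exp s * norm (w0 + x *s y)" using p by (intro mult_pos_pos) auto
  ultimately show "of_real (exp s) *s (w0 + x *s y) \<in> punctured_ball"
    using p unfolding mem_Collect_eq by linarith
qed

lemma open_transversal_sublevel:
  assumes w0: "1 / 3 \<le> norm w0" "norm w0 \<le> 1" and y: "norm y \<le> 1 / 4"
    and \<rho>: "0 < \<rho>" "\<rho> \<le> 1 / 2" and s: "s \<le> 0"
  shows "open {x. norm x < \<rho> \<and> U (of_real (exp s) *s (w0 + x *s y)) < c}"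
proof -
  have "usc_real_on punctured_ball U" using U_psh by (simp add: bounded_psh_on_def)
  then have uscF: "usc_real_on (ball 0 1) (\<lambda>x. U (of_real (exp s) *s (w0 + x *s y)))"
  proof (rule usc_real_on_compose_continuous)
    show "continuous_on (ball 0 1) (\<lambda>x. of_real (exp s) *s (w0 + x *s y))" by (intro continuous_intros)
    show "(\<lambda>x. of_real (exp s) *s (w0 + x *s y)) ` ball 0 1 \<subseteq> punctured_ball"
    proof (rule image_subsetI)
      fix x :: complex assume "x \<in> ball 0 1"
      then show "of_real (exp s) *s (w0 + x *s y) \<in> punctured_ball"
        by (intro transversal_point(2)[OF w0 y _ s]) simp
    qed
  qed
  show ?thesis unfolding open_dist
  proof
    fix x assume x: "x \<in> {x. norm x < \<rho> \<and> U (of_real (exp s) *s (w0 + x *s y)) < c}"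
    then have x1: "x \<in> ball 0 1" using \<rho> by auto
    obtain d where d: "d > 0" "\<And>x'. x' \<in> ball 0 1 \<Longrightarrow> dist x' x < d \<Longrightarrow> U (of_real (exp s) *s (w0 + x' *s y)) < c"
      using usc_real_onD[OF uscF x1, of c] x by blast
    show "\<exists>e>0. \<forall>x'. dist x' x < e \<longrightarrow> x' \<in> {x. norm x < \<rho> \<and> U (of_real (exp s) *s (w0 + x *s y)) < c}"
    proof (intro exI[of _ "min d (\<rho> - norm x)"] conjI allI impI)
      show "0 < min d (\<rho> - norm x)" using d x by simp
      fix x' assume x': "dist x' x < min d (\<rho> - norm x)"
      have "norm x' \<le> norm x + dist x' x" using norm_triangle_sub[of x' x] by (simp add: dist_norm)
      then have "norm x' < \<rho>" using x' by simp
      moreover have "U (of_real (exp s) *s (w0 + x' *s y)) < c"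
        by (rule d(2)) (use x' \<open>norm x' < \<rho>\<close> \<rho> in auto)
      ultimately show "x' \<in> {x. norm x < \<rho> \<and> U (of_real (exp s) *s (w0 + x *s y)) < c}" by blast
    qed
  qed
qed

text \<open>If \<open>F\<close> is not tiny, compare \<open>U\<close> along the curve with the exponent \<open>s h(x)\<close> against \<open>(\<mu> s - M) h\<close>, where
  \<open>h\<close> is the potential of \<open>F\<close>. On the unit circle \<open>h = 0\<close> and \<open>U \<le> 0\<close>; on \<open>F\<close> convexity in the
  exponent interpolates between \<open>U \<le> \<mu> s - M\<close> and \<open>U \<le> 0\<close>. At \<open>x = 0\<close> the result is
  \<open>U (e^(s h(0)) w0) \<le> (\<mu> s - M) h(0)\<close>, whereas \<open>U (e^(s h(0)) w0) \<ge> \<mu> s h(0) - K\<close>. The terms \<open>\<mu> s h(0)\<close>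
  cancel, so the conclusion is uniform in \<open>s\<close>.\<close>
lemma transversal_capacity:
  assumes w0: "1 / 3 \<le> norm w0" "norm w0 \<le> 1" and y: "norm y \<le> 1 / 4"
    and K: "0 < K" "\<And>s. s \<le> 0 \<Longrightarrow> \<mu> * s - K \<le> U (of_real (exp s) *s w0)"
    and \<rho>: "0 < \<rho>" "\<rho> \<le> 1 / 2" and s: "s \<le> 0" and M: "0 < M"
    and F: "F = {x. norm x < \<rho> \<and> U (of_real (exp s) *s (w0 + x *s y)) < \<mu> * s - M}"
    and area: "2 * pi * exp (- 2 * R) \<le> measure lborel F"
  shows "M * (ln (1 / \<rho>) - 2) \<le> K * (R + 7)"
proof -
  note wx = transversal_point(1)[OF w0 y] and sG = transversal_point(2)[OF w0 y]
  have oF: "open F" unfolding F by (rule open_transversal_sublevel[OF w0 y \<rho> s])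
  have Fsub: "F \<subseteq> ball 0 \<rho>" by (auto simp: F)
  obtain Q Y h where cap: "open Q" "closed Y" "Q \<subseteq> Y" "Y \<subseteq> F"
    "continuous_on (cball 0 1 - Q) h"
    "\<And>x. x \<in> ball 0 1 - Y \<Longrightarrow> harmonic_at h x"
    "\<And>x. x \<in> cball 0 1 - Q \<Longrightarrow> 0 \<le> h x \<and> h x \<le> 1"
    "\<And>x. norm x = 1 \<Longrightarrow> h x = 0"
    "\<And>x. norm x \<le> \<rho> \<Longrightarrow> x \<notin> Q \<Longrightarrow> (ln (1 / \<rho>) - 2) / (R + 7) \<le> h x"
    "ln (1 / \<rho>) < R"
    by (rule logarithmic_potential_of_open_set[OF oF Fsub \<rho> area]) (rule that; assumption)
  have R0: "0 < R"
  proof -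
    have "0 \<le> ln (1 / \<rho>)" using \<rho> by (intro ln_ge_zero) auto
    then show ?thesis using cap(10) by linarith
  qed
  show "M * (ln (1 / \<rho>) - 2) \<le> K * (R + 7)"
  proof (cases "0 \<in> Y")
    case True
    then have "U (of_real (exp s) *s w0) < \<mu> * s - M" using cap(4) by (auto simp: F)
    then have MK: "M < K" using K(2)[OF s] by linarith
    have "M * (ln (1 / \<rho>) - 2) \<le> M * (R + 7)" using M cap(10) by (intro mult_left_mono) auto
    also have "\<dots> \<le> K * (R + 7)" using MK R0 by (intro mult_right_mono) auto
    finally show ?thesis .
  next
    case False
    define X where "X = ball (0::complex) 1 - Y"
    have X: "open X" "bounded X" using cap(2) by (auto simp: X_def intro: bounded_subset[OF bounded_ball])
    have clX: "closure X \<subseteq> cball 0 1 - Q"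
    proof (rule closure_minimal)
      show "X \<subseteq> cball 0 1 - Q" using cap(3) by (auto simp: X_def)
      show "closed (cball 0 1 - Q)" using cap(1) by auto
    qed
    have "U (of_real (exp (s * h 0)) *s (w0 + 0 *s y)) \<le> (\<mu> * s - M) * h 0"
    proof (rule maximum_principle_along_rotating_curve[OF U_psh _ s X])
      show "U (c *s z) = U z" if "norm c = 1" for c z using that by (rule circle_max_rotate)
      show "continuous_on (closure X) h" using cap(5) clX by (rule continuous_on_subset)
      then show "continuous_on (closure X) (\<lambda>x. (\<mu> * s - M) * h x)" by (intro continuous_intros)
      show "0 \<le> h x" if "x \<in> closure X" for x using cap(7) clX that by auto
      show "harmonic_at h x" if "x \<in> X" for x using cap(6) that by (simp add: X_def)
      then show "harmonic_at (\<lambda>x. (\<mu> * s - M) * h x) x" if "x \<in> X" for x using that by (intro harmonic_at_cmult)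
      show "0 < norm (w0 + x *s y) \<and> norm (w0 + x *s y) < 2" if "x \<in> closure X" for x
        using wx[of x] clX that by fastforce
      show "0 \<in> X" using False by (simp add: X_def)
      fix x assume x: "x \<in> closure X" "x \<notin> X"
      have x1: "norm x \<le> 1" and xQ: "x \<in> cball 0 1 - Q" using x clX by auto
      have wG: "w0 + x *s y \<in> punctured_ball" using sG[OF x1, of 0] by simp
      show "U (of_real (exp (s * h x)) *s (w0 + x *s y)) \<le> (\<mu> * s - M) * h x"
      proof (cases "norm x = 1")
        case True
        then show ?thesis using cap(8)[of x] U_nonpos[OF wG] by simp
      next
        case False
        then have "x \<in> Y" using x x1 by (auto simp: X_def)
        then have "x \<in> F" using cap by auto
        then have UF: "U (of_real (exp s) *s (w0 + x *s y)) \<le> \<mu> * s - M" by (simp add: F)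
        have h01: "0 \<le> h x" "h x \<le> 1" using cap(7)[OF xQ] by auto
        have "U (of_real (exp (h x * s)) *s (w0 + x *s y)) \<le> h x * U (of_real (exp s) *s (w0 + x *s y)) + (1 - h x) * U (w0 + x *s y)"
          using wG s h01 by (intro U_convex) auto
        also have "\<dots> \<le> h x * (\<mu> * s - M) + 0"
          using UF U_nonpos[OF wG] h01 by (intro add_mono mult_left_mono mult_nonneg_nonpos) auto
        finally show ?thesis by (simp add: mult.commute)
      qed
    qed
    moreover have Q0: "0 \<notin> Q" using False cap(3) by auto
    moreover have h0: "0 \<le> h 0" using cap(7)[of 0] Q0 by simp
    moreover have "\<mu> * (s * h 0) - K \<le> U (of_real (exp (s * h 0)) *s w0)"
      using s h0 by (intro K(2)) (simp add: mult_nonpos_nonneg)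
    ultimately have MK: "M * h 0 \<le> K" by (simp add: algebra_simps)
    have "M * ((ln (1 / \<rho>) - 2) / (R + 7)) \<le> M * h 0"
      using M cap(9)[of 0] Q0 \<rho> by (intro mult_left_mono) auto
    then have "M * (ln (1 / \<rho>) - 2) / (R + 7) \<le> K" using MK by simp
    then show ?thesis using R0 by (simp add: pos_divide_le_eq)
  qed
qed

text \<open>The gain in \<open>transversal_capacity\<close> is the factor \<open>ln (1 / \<rho>)\<close>: confining the parameters to a small disc makes the
  exponential rate as large as desired. The radius depends on \<open>w0\<close> through the constant \<open>K\<close> of the
  line of \<open>w0\<close>.\<close>
lemma transversal_estimate:
  assumes w0: "1 / 3 \<le> norm w0" "norm w0 \<le> 1" and \<mu>: "\<nu> < \<mu>" and B: "0 < B"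
  obtains \<rho> where "0 < \<rho>" "\<rho> \<le> 1 / 2"
    "\<And>y s M. norm y \<le> 1 / 4 \<Longrightarrow> s \<le> 0 \<Longrightarrow> 0 < M \<Longrightarrow>
       {x. norm x < \<rho> \<and> U (of_real (exp s) *s (w0 + x *s y)) < \<mu> * s - M} \<in> sets borel \<and>
       measure lborel {x. norm x < \<rho> \<and> U (of_real (exp s) *s (w0 + x *s y)) < \<mu> * s - M}
         \<le> 2 * pi * exp (14 - B * M)"
proof -
  have w0': "0 < norm w0" using w0 by linarith
  obtain K where K: "0 < K" "\<And>s. s \<le> 0 \<Longrightarrow> \<mu> * s - K \<le> U (of_real (exp s) *s w0)"
    by (rule U_lower[OF w0' w0(2) \<mu>]) (rule that; assumption)
  \<comment> \<open>Chosen so that \<open>ln (1 / \<rho>) - 2 = K B / 2\<close>; the additional 2 also ensures \<open>\<rho> \<le> 1/2\<close>.\<close>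
  define \<rho> where "\<rho> = exp (- (2 + K * B / 2))"
  have KB: "0 < K * B / 2" using K(1) B by simp
  have \<rho>0: "0 < \<rho>" by (simp add: \<rho>_def)
  have "\<rho> \<le> exp (- 1)" unfolding \<rho>_def using KB by simp
  also have "\<dots> \<le> 1 / 2" using exp_ge_add_one_self[of "1::real"] by (simp add: exp_minus field_simps)
  finally have \<rho>: "\<rho> \<le> 1 / 2" .
  have ln\<rho>: "ln (1 / \<rho>) - 2 = K * B / 2" by (simp add: \<rho>_def ln_div)
  show thesis
  proof (rule that[OF \<rho>0 \<rho>])
    fix y s M assume y: "norm (y::complex^'n) \<le> 1 / 4" and s: "s \<le> (0::real)" and M: "0 < (M::real)"
    define F where "F = {x. norm x < \<rho> \<and> U (of_real (exp s) *s (w0 + x *s y)) < \<mu> * s - M}"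
    have T: "M * (K * B / 2) \<le> K * (R + 7)" if "2 * pi * exp (- 2 * R) \<le> measure lborel F" for R
      unfolding ln\<rho>[symmetric] by (rule transversal_capacity[OF w0 y K(1) K(2) \<rho>0 \<rho> s M F_def that])
    have imp: "B * M \<le> 2 * R + 14" if "2 * pi * exp (- 2 * R) \<le> measure lborel F" for R
    proof -
      have "K * (M * B / 2) \<le> K * (R + 7)" using T[OF that] by (simp add: algebra_simps)
      then have "M * B / 2 \<le> R + 7" using K(1) by (rule mult_left_le_imp_le)
      then show ?thesis by (simp add: algebra_simps)
    qed
    have le: "measure lborel F \<le> 2 * pi * exp (14 - B * M)"
    proof (cases "measure lborel F = 0")
      case False
      then have m: "0 < measure lborel F" by (simp add: zero_less_measure_iff)
      define R where "R = - ln (measure lborel F / (2 * pi)) / 2"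
      have eq: "measure lborel F = 2 * pi * exp (- 2 * R)" using m by (simp add: R_def)
      then have "B * M \<le> 2 * R + 14" using imp by simp
      then have "- 2 * R \<le> 14 - B * M" by simp
      then show ?thesis unfolding eq by simp
    qed simp
    have "F \<in> sets borel"
      unfolding F_def by (rule borel_open) (rule open_transversal_sublevel[OF w0 y \<rho>0 \<rho> s])
    then show "{x. norm x < \<rho> \<and> U (of_real (exp s) *s (w0 + x *s y)) < \<mu> * s - M} \<in> sets borel \<and>
       measure lborel {x. norm x < \<rho> \<and> U (of_real (exp s) *s (w0 + x *s y)) < \<mu> * s - M}
         \<le> 2 * pi * exp (14 - B * M)" using le by (simp add: F_def)
  qed
qed

text \<open>With \<open>T = M - (\<mu> - \<nu>) s\<close> the bad set is where \<open>u < \<nu> s - T\<close>. The comparison function is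
  \<open>\<nu> ln \<bar>\<zeta>\<bar> + \<nu> - T h - \<eta> ln \<bar>\<zeta>\<bar>\<close>: the summand \<open>\<nu>\<close> makes up for the norm of \<open>w\<close> and
  for the variation of \<open>ln \<bar>\<zeta>\<bar>\<close> over the bad set, and the last summand, which tends to 0 with
  \<open>\<eta>\<close>, beats \<open>T h\<close> on a small inner circle. The set lies in the disc of radius \<open>3/2 e^s\<close>, so \<open>h\<close> on
  the circle of radius \<open>e^s\<close> is at least the stated quotient.\<close>
lemma line_capacity:
  assumes w: "1 / 12 \<le> norm w" "norm w \<le> 5 / 4" and \<mu>: "\<nu> < \<mu>" and s: "s \<le> - 2" and M: "0 < M"
    and E: "E = {\<zeta>. dist (of_real (exp s)) \<zeta> < exp s / 2 \<and> u (\<zeta> *s w) < \<mu> * s - M}"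
    and area: "2 * pi * exp (- 2 * R) \<le> measure lborel E"
  shows "U (of_real (exp s) *s w) \<le> \<nu> * s + \<nu> - (M - (\<mu> - \<nu>) * s) * ((- s - 3) / (R + 7))"
    and "0 < R"
proof -
  let ?e = "exp s"
  have e0: "0 < ?e" by simp
  have "exp (- 2) \<le> (1 / 3 :: real)" using exp_ge_add_one_self[of "2::real"] by (simp add: exp_minus field_simps)
  moreover have "?e \<le> exp (- 2)" using s by simp
  ultimately have e3: "?e \<le> 1 / 3" by linarith
  \<comment> \<open>The disc around \<open>e^s\<close> of radius \<open>e^s / 2\<close> lies in the disc of radius \<open>\<rho>\<close> around 0.\<close>
  define \<rho> where "\<rho> = 3 / 2 * ?e"
  have \<rho>: "0 < \<rho>" "\<rho> \<le> 1 / 2" using e3 by (auto simp: \<rho>_def)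
  have Enorm: "?e / 2 < norm \<zeta> \<and> norm \<zeta> < \<rho>" if "dist (complex_of_real ?e) \<zeta> < ?e / 2" for \<zeta>
  proof -
    have "\<bar>norm (complex_of_real ?e) - norm \<zeta>\<bar> \<le> norm (complex_of_real ?e - \<zeta>)" by (rule norm_triangle_ineq3)
    then have "\<bar>?e - norm \<zeta>\<bar> < ?e / 2" using that unfolding dist_norm norm_of_real abs_exp_cancel by linarith
    then show ?thesis unfolding \<rho>_def by linarith
  qed
  have inG: "\<zeta> *s w \<in> punctured_ball" if "0 < norm \<zeta>" "norm \<zeta> \<le> 1" for \<zeta>
  proof -
    have "norm \<zeta> * norm w \<le> 1 * (5 / 4)" using that w by (intro mult_mono) auto
    moreover have "0 < norm \<zeta> * norm w" using that w by (intro mult_pos_pos) auto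
    ultimately show ?thesis unfolding mem_Collect_eq norm_vector_scalar by linarith
  qed
  have oE: "open E" unfolding open_dist
  proof
    fix x assume x: "x \<in> E"
    then have "0 < norm x" "norm x \<le> 1" using Enorm[of x] \<rho> e0 by (auto simp: E)
    then have xG: "x *s w \<in> punctured_ball" by (rule inG)
    have cont: "continuous_on UNIV (\<lambda>\<zeta>. \<zeta> *s w)" by (intro continuous_intros)
    obtain d1 where d1: "d1 > 0" "\<And>z. z \<in> punctured_ball \<Longrightarrow> dist z (x *s w) < d1 \<Longrightarrow> u z < \<mu> * s - M"
      using usc_real_onD[OF usc xG, of "\<mu> * s - M"] x unfolding E by blast
    obtain d2 where d2: "d2 > 0" "\<And>x'. dist x' x < d2 \<Longrightarrow> dist (x' *s w) (x *s w) < d1"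
      using cont d1(1) unfolding continuous_on_iff by (meson UNIV_I)
    define d where "d = min d2 (?e / 2 - dist (complex_of_real ?e) x)"
    show "\<exists>e>0. \<forall>x'. dist x' x < e \<longrightarrow> x' \<in> E"
    proof (intro exI[of _ d] conjI allI impI)
      show "0 < d" using d2 x by (simp add: d_def E)
      fix x' assume x': "dist x' x < d"
      have "dist (complex_of_real ?e) x' \<le> dist (complex_of_real ?e) x + dist x x'" by (rule dist_triangle)
      then have D: "dist (complex_of_real ?e) x' < ?e / 2" using x' by (simp add: d_def dist_commute)
      then have "0 < norm x'" "norm x' \<le> 1" using Enorm[OF D] \<rho> e0 by auto
      then have "x' *s w \<in> punctured_ball" by (rule inG)
      then have "u (x' *s w) < \<mu> * s - M" by (rule d1(2)) (use d2(2) x' in \<open>simp add: d_def\<close>)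
      then show "x' \<in> E" using D by (simp add: E)
    qed
  qed
  have Esub: "E \<subseteq> ball 0 \<rho>" using Enorm by (auto simp: E)
  obtain Q Y h where cap: "open Q" "closed Y" "Q \<subseteq> Y" "Y \<subseteq> E"
    "continuous_on (cball 0 1 - Q) h"
    "\<And>x. x \<in> ball 0 1 - Y \<Longrightarrow> harmonic_at h x"
    "\<And>x. x \<in> cball 0 1 - Q \<Longrightarrow> 0 \<le> h x \<and> h x \<le> 1"
    "\<And>x. norm x = 1 \<Longrightarrow> h x = 0"
    "\<And>x. norm x \<le> \<rho> \<Longrightarrow> x \<notin> Q \<Longrightarrow> (ln (1 / \<rho>) - 2) / (R + 7) \<le> h x"
    "ln (1 / \<rho>) < R"
    by (rule logarithmic_potential_of_open_set[OF oE Esub \<rho> area]) (rule that; assumption)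
  show R0: "0 < R"
  proof -
    have "0 \<le> ln (1 / \<rho>)" using \<rho> by (intro ln_ge_zero) auto
    then show ?thesis using cap(10) by linarith
  qed
  have l\<rho>: "- s - 1 \<le> ln (1 / \<rho>)"
  proof -
    have "ln \<rho> = ln (3 / 2) + s" unfolding \<rho>_def by (subst ln_mult) auto
    moreover have "ln (3 / 2 :: real) \<le> 3 / 2 - 1" by (rule ln_le_minus_one) simp
    ultimately show ?thesis using \<rho> by (simp add: ln_div)
  qed
  define T where "T = M - (\<mu> - \<nu>) * s"
  have "(\<mu> - \<nu>) * s \<le> 0" using \<mu> s by (intro mult_nonneg_nonpos) auto
  then have T0: "0 < T" using M by (simp add: T_def)
  define k where "k = (- s - 3) / (R + 7)"
  have k_le: "k \<le> (ln (1 / \<rho>) - 2) / (R + 7)" unfolding k_def using l\<rho> R0 by (intro divide_right_mono) auto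
  also have "\<dots> \<le> 1" using cap(10) R0 by (simp add: divide_le_eq)
  finally have k1: "k \<le> 1" .
  have main: "u (\<zeta> *s w) \<le> \<nu> * s + \<nu> - T * k" if \<zeta>: "norm \<zeta> = ?e" for \<zeta>
  proof (cases "\<zeta> \<in> Y")
    case True
    then have "u (\<zeta> *s w) < \<mu> * s - M" using cap(4) by (auto simp: E)
    also have "\<mu> * s - M = \<nu> * s - T" by (simp add: T_def algebra_simps)
    also have "T * k \<le> T * 1" using T0 k1 by (intro mult_left_mono) auto
    ultimately show ?thesis using pos \<open>T * k \<le> T * 1\<close> by linarith
  next
    case False
    have "u (\<zeta> *s w) \<le> \<nu> * s + \<nu> - T * h \<zeta> + \<epsilon>" if \<epsilon>: "0 < \<epsilon>" for \<epsilon>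
    proof -
      \<comment> \<open>On the circle of radius \<open>e^s\<close> the perturbation \<open>- \<eta> ln \<bar>\<zeta>\<bar>\<close> equals \<open>\<epsilon>\<close>.\<close>
      define \<eta> where "\<eta> = \<epsilon> / (- s)"
      have "0 < - s" using s by linarith
      then have \<eta>: "0 < \<eta>" "\<eta> * s = - \<epsilon>" using \<epsilon> unfolding \<eta>_def by (intro divide_pos_pos, auto)
      define r where "r = min (?e / 4) (exp (- T / \<eta>))"
      have r: "0 < r" "r \<le> ?e / 4" "ln r \<le> - T / \<eta>"
      proof -
        show "0 < r" by (simp add: r_def)
        then have "ln r \<le> ln (exp (- T / \<eta>))" by (subst ln_le_cancel_iff) (auto simp: r_def)
        then show "ln r \<le> - T / \<eta>" by simp
      qed (simp add: r_def)
      have Tr: "T \<le> - \<eta> * ln r"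
      proof -
        have "\<eta> * ln r \<le> \<eta> * (- T / \<eta>)" using r(3) \<eta>(1) by (intro mult_left_mono) auto
        then show ?thesis using \<eta>(1) by simp
      qed
      define X where "X = {x::complex. r < norm x \<and> norm x < 1} - Y"
      have X: "open X" "bounded X"
        using cap(2) open_annulus[of r 1] bounded_annulus[of r 1] by (auto simp: X_def intro: bounded_subset)
      have clX: "closure X \<subseteq> {x. r \<le> norm x \<and> norm x \<le> 1} - Q"
      proof (rule closure_minimal)
        show "X \<subseteq> {x. r \<le> norm x \<and> norm x \<le> 1} - Q" using cap(3) by (auto simp: X_def)
        have "closed {x::complex. r \<le> norm x \<and> norm x \<le> 1}"
          by (intro closed_Collect_conj closed_Collect_le continuous_intros)
        then show "closed ({x::complex. r \<le> norm x \<and> norm x \<le> 1} - Q)" using cap(1) by (rule closed_Diff)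
      qed
      have xcl: "0 < norm x" "r \<le> norm x" "norm x \<le> 1" "x \<in> cball 0 1 - Q" if "x \<in> closure X" for x
      proof -
        show "r \<le> norm x" "norm x \<le> 1" using that clX by auto
        then show "0 < norm x" using r(1) by linarith
        show "x \<in> cball 0 1 - Q" using that clX by auto
      qed
      let ?H = "\<lambda>x. (\<nu> - \<eta>) * ln (norm x) + (\<nu> + (- T) * h x)"
      have "u (\<zeta> *s w) \<le> ?H \<zeta>"
      proof (rule maximum_principle_on_line[OF open_punctured_ball psh X])
        show "x *s w \<in> punctured_ball" if "x \<in> closure X" for x by (rule inG) (use xcl[OF that] in auto)
        have "continuous_on (closure X) h" using cap(5) by (rule continuous_on_subset) (use xcl in auto)
        moreover have "continuous_on (closure X) (\<lambda>x. ln (norm x))"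
          by (intro continuous_intros) (use xcl(1) in force)
        ultimately show "continuous_on (closure X) ?H"
          by (intro continuous_on_add continuous_on_mult continuous_on_const)
        show "harmonic_at ?H x" if "x \<in> X" for x
        proof (intro harmonic_at_add harmonic_at_const harmonic_at_cmult harmonic_at_ln_cmod cap(6))
          show "x \<noteq> 0" using that r(1) by (auto simp: X_def)
          show "x \<in> ball 0 1 - Y" using that by (auto simp: X_def)
        qed
        show "\<zeta> \<in> X" using \<zeta> False r(1,2) e3 e0 s by (auto simp: X_def)
        fix x assume x: "x \<in> closure X" "x \<notin> X"
        note xx = xcl[OF x(1)]
        have h01: "0 \<le> h x" "h x \<le> 1" using cap(7)[OF xx(4)] by auto
        have Th: "T * h x \<le> T" using h01 T0 by (simp add: mult_left_le)
        have lnx: "ln (norm x) \<le> 0" using xx by simp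
        then have \<eta>l: "\<eta> * ln (norm x) \<le> 0" using \<eta>(1) by (intro mult_nonneg_nonpos) auto
        consider "norm x = 1" | "x \<in> Y" | "norm x = r" using x xx by (auto simp: X_def)
        then show "u (x *s w) \<le> ?H x"
        proof cases
          case 1
          have "u (x *s w) \<le> 0" using nonpos[of "x *s w"] inG[OF xx(1,3)] by blast
          then show ?thesis using 1 cap(8)[of x] pos by simp
        next
          case 2
          then have xE: "x \<in> E" using cap(4) by auto
          then have "?e / 2 < norm x" using Enorm by (auto simp: E)
          then have "ln (?e / 2) \<le> ln (norm x)" using xx(1) by (subst ln_le_cancel_iff) auto
          then have "s - 1 \<le> ln (norm x)" using ln_2_less_1 by (simp add: ln_div)
          then have "\<nu> * (s - 1) \<le> \<nu> * ln (norm x)" using pos by (intro mult_left_mono) auto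
          moreover have "u (x *s w) < \<nu> * s - T" using xE by (simp add: E T_def algebra_simps)
          ultimately show ?thesis using \<eta>l Th by (simp add: algebra_simps)
        next
          case 3
          have "norm x * norm w \<le> 1 / 4 * (5 / 4)" using 3 r e3 w by (intro mult_mono) auto
          then have n1: "norm (x *s w) \<le> 1" "0 < norm (x *s w)"
            unfolding norm_vector_scalar using xx(1) w(1) by (linarith, intro mult_pos_pos, auto)
          have "u (x *s w) \<le> \<nu> * ln (norm (x *s w))" by (rule upper[OF n1(2,1)])
          also have "ln (norm (x *s w)) = ln (norm x) + ln (norm w)"
            unfolding norm_vector_scalar using xx(1) w by (subst ln_mult) auto
          also have "\<nu> * (ln (norm x) + ln (norm w)) \<le> \<nu> * (ln (norm x) + 1)"
          proof (intro mult_left_mono add_left_mono)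
            have "ln (norm w) \<le> norm w - 1" using w by (intro ln_le_minus_one) auto
            then show "ln (norm w) \<le> 1" using w by linarith
          qed (use pos in auto)
          finally show ?thesis using Tr Th 3 by (simp add: algebra_simps)
        qed
      qed
      also have "\<dots> = \<nu> * s + \<nu> - T * h \<zeta> + \<epsilon>" using \<eta>(2) by (simp add: \<zeta> algebra_simps)
      finally show ?thesis .
    qed
    then have "u (\<zeta> *s w) \<le> \<nu> * s + \<nu> - T * h \<zeta>" by (rule field_le_epsilon)
    moreover have "k \<le> h \<zeta>"
      using k_le cap(9)[of \<zeta>] \<zeta> False cap(3) e0 by (force simp: \<rho>_def)
    then have "T * k \<le> T * h \<zeta>" using T0 by (intro mult_left_mono) auto
    ultimately show ?thesis by linarith
  qed
  have eG: "complex_of_real ?e *s w \<in> punctured_ball" by (rule inG) (use s in auto)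
  obtain c where c: "norm c = 1" "U (of_real ?e *s w) = u (c *s (of_real ?e *s w))" using U_attained[OF eG] by blast
  have "u ((c * of_real ?e) *s w) \<le> \<nu> * s + \<nu> - T * k" by (rule main) (simp add: norm_mult c)
  then show "U (of_real (exp s) *s w) \<le> \<nu> * s + \<nu> - (M - (\<mu> - \<nu>) * s) * ((- s - 3) / (R + 7))"
    using c(2) by (simp add: T_def k_def vector_smult_assoc)
qed

text \<open>The quotient in \<open>line_capacity\<close> is bounded below by a positive constant. With
  \<open>R = B M - s\<close> this needs \<open>M\<close> to be at most a multiple of \<open>-s\<close>, which the logarithmic lower bound provides as soon
  as the bad set is nonempty. A fixed fraction of \<open>(\<mu> - \<nu>) s\<close> then raises \<open>\<nu>\<close> to \<open>\<mu>2\<close>.\<close>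
lemma line_estimate:
  assumes \<mu>: "\<nu> < \<mu>" and B: "0 < B"
  obtains B3 \<mu>2 s1 where "0 < B3" "\<nu> < \<mu>2"  "s1 \<le> - 2"
    "\<And>w s M. 1 / 12 \<le> norm w \<Longrightarrow> norm w \<le> 5 / 4 \<Longrightarrow> s \<le> s1 \<Longrightarrow> 0 < M \<Longrightarrow>
       2 * pi * exp (2 * s - 2 * B * M) \<le> measure lborel {\<zeta>. dist (of_real (exp s)) \<zeta> < exp s / 2 \<and> u (\<zeta> *s w) < \<mu> * s - M} \<Longrightarrow>
       U (of_real (exp s) *s w) < \<mu>2 * s - (M / (2 * B3) - \<nu> - 1)"
proof -
  \<comment> \<open>With this choice \<open>R + 7 \<le> B3 (-s)\<close> for \<open>R = B M - s\<close>, and \<open>-s - 3 \<ge> -s / 2\<close> for \<open>s \<le> s1\<close>.\<close>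
  define B3 where "B3 = 2 + B * (a + 1)"
  define \<mu>2 where "\<mu>2 = \<nu> + (\<mu> - \<nu>) / (2 * B3)"
  define s1 where "s1 = - (7 + 5 * a + b)"
  have B3: "0 < B3" using B pos by (simp add: B3_def add_pos_pos)
  show thesis
  proof (rule that[of B3 \<mu>2 s1])
    show "0 < B3" by (rule B3)
    show "\<nu> < \<mu>2" using \<mu> B3 by (simp add: \<mu>2_def)
    show "s1 \<le> - 2" using pos by (simp add: s1_def)
    fix w s M
    define E where "E = {\<zeta>. dist (complex_of_real (exp s)) \<zeta> < exp s / 2 \<and> u (\<zeta> *s w) < \<mu> * s - M}"
    assume w: "1 / 12 \<le> norm w" "norm w \<le> 5 / 4" and s: "s \<le> s1" and M: "0 < M"
      and area: "2 * pi * exp (2 * s - 2 * B * M) \<le> measure lborel {\<zeta>. dist (of_real (exp s)) \<zeta> < exp s / 2 \<and> u (\<zeta> *s w) < \<mu> * s - M}"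
    define R where "R = - s + B * M"
    have R2: "- 2 * R = 2 * s - 2 * B * M" by (simp add: R_def)
    have area': "2 * pi * exp (- 2 * R) \<le> measure lborel E" unfolding R2 E_def by (rule area)
    have s2: "s \<le> - 2" using s pos by (simp add: s1_def)
    have s7: "7 + 5 * a + b \<le> - s" using s by (simp add: s1_def)
    note C = line_capacity[OF w \<mu> s2 M E_def area']
    have "E \<noteq> {}"
    proof
      assume "E = {}"
      then have "2 * pi * exp (- 2 * R) \<le> 0" using area' by simp
      moreover have "0 < 2 * pi * exp (- 2 * R)" by simp
      ultimately show False by linarith
    qed
    then obtain \<zeta> where \<zeta>: "dist (complex_of_real (exp s)) \<zeta> < exp s / 2" "u (\<zeta> *s w) < \<mu> * s - M"
      by (auto simp: E_def)
    have n\<zeta>: "exp s / 2 < norm \<zeta> \<and> norm \<zeta> < 3 / 2 * exp s"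
    proof -
      have "\<bar>norm (complex_of_real (exp s)) - norm \<zeta>\<bar> \<le> norm (complex_of_real (exp s) - \<zeta>)" by (rule norm_triangle_ineq3)
      then have "\<bar>exp s - norm \<zeta>\<bar> < exp s / 2" using \<zeta>(1) unfolding dist_norm norm_of_real abs_exp_cancel by linarith
      then show ?thesis by linarith
    qed
    have "exp (- 2) \<le> (1 / 3 :: real)" using exp_ge_add_one_self[of "2::real"] by (simp add: exp_minus field_simps)
    moreover have "exp s \<le> exp (- 2)" using s2 by simp
    ultimately have e3: "exp s \<le> 1 / 3" by linarith
    have up: "norm (\<zeta> *s w) \<le> 1"
    proof -
      have "norm \<zeta> * norm w \<le> (1 / 2) * (5 / 4)" using n\<zeta> e3 w by (intro mult_mono) auto
      then show ?thesis unfolding norm_vector_scalar by linarith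
    qed
    have lo: "exp s / 24 \<le> norm (\<zeta> *s w)"
    proof -
      have "(exp s / 2) * (1 / 12) \<le> norm \<zeta> * norm w" using n\<zeta> w by (intro mult_mono) auto
      then show ?thesis unfolding norm_vector_scalar by linarith
    qed
    have "exp (s - 5) \<le> exp s / 24"
    proof -
      have "(2::real) ^ 5 \<le> exp 1 ^ 5" using exp_ge_add_one_self[of "1::real"] by (intro power_mono) auto
      then have "(24::real) \<le> exp 5" by (simp add: exp_of_nat_mult[symmetric])
      then show ?thesis unfolding exp_diff by (intro divide_left_mono) auto
    qed
    then have "exp (s - 5) \<le> norm (\<zeta> *s w)" using lo by linarith
    then have "ln (exp (s - 5)) \<le> ln (norm (\<zeta> *s w))"
      by (subst ln_le_cancel_iff) (auto intro: less_le_trans[OF exp_gt_zero])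
    then have "a * (s - 5) \<le> a * ln (norm (\<zeta> *s w))" using pos by (intro mult_left_mono) auto
    moreover have "a * ln (norm (\<zeta> *s w)) - b \<le> u (\<zeta> *s w)"
    proof (rule lower[OF _ up])
      have "0 < exp s / 24" by simp
      then show "0 < norm (\<zeta> *s w)" using lo by linarith
    qed
    moreover have "\<mu> * s \<le> 0" using \<mu> pos s2 by (intro mult_nonneg_nonpos) auto
    ultimately have "M \<le> a * (- s) + 5 * a + b" using \<zeta>(2) by (simp add: algebra_simps)
    then have Ms: "M \<le> (a + 1) * (- s)" using s7 pos by (simp add: algebra_simps)
    then have "B * M \<le> B * ((a + 1) * (- s))" using B by (intro mult_left_mono) auto
    then have R7: "R + 7 \<le> B3 * (- s)" using s7 pos by (simp add: R_def B3_def algebra_simps)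
    have Rpos: "0 < R + 7" using C(2) by simp
    have k: "1 / (2 * B3) \<le> (- s - 3) / (R + 7)"
    proof -
      have "1 * (R + 7) \<le> B3 * (- s)" using R7 by simp
      also have "\<dots> \<le> B3 * (2 * (- s - 3))" using s7 pos B3 by (intro mult_left_mono) auto
      finally have "(R + 7) \<le> (- s - 3) * (2 * B3)" by (simp add: algebra_simps)
      then have "(R + 7) / (2 * B3) \<le> - s - 3" using B3 by (subst pos_divide_le_eq) auto
      then show ?thesis unfolding pos_le_divide_eq[OF Rpos] by simp
    qed
    have "(\<mu> - \<nu>) * s \<le> 0" using \<mu> s2 by (intro mult_nonneg_nonpos) auto
    then have T: "0 \<le> M - (\<mu> - \<nu>) * s" using M by linarith
    have "(M - (\<mu> - \<nu>) * s) * (1 / (2 * B3)) \<le> (M - (\<mu> - \<nu>) * s) * ((- s - 3) / (R + 7))"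
      using k T by (intro mult_left_mono) auto
    then have "U (of_real (exp s) *s w) \<le> \<nu> * s + \<nu> - (M - (\<mu> - \<nu>) * s) * (1 / (2 * B3))"
      using C(1) by linarith
    also have "\<dots> = \<mu>2 * s - (M / (2 * B3) - \<nu>)" by (simp add: \<mu>2_def diff_divide_distrib add_divide_distrib algebra_simps)
    finally show "U (of_real (exp s) *s w) < \<mu>2 * s - (M / (2 * B3) - \<nu> - 1)" by linarith
  qed
qed

end

section \<open>The volume of sublevel sets\<close>

lemma emeasure_ball_complex: "0 \<le> r \<Longrightarrow> emeasure lborel (ball (c::complex) r) = ennreal (pi * r\<^sup>2)"
  using content_ball[of r c] emeasure_lborel_ball_finite[of c r] emeasure_eq_ennreal_measure[of lborel "ball c r"]
  by (simp add: unit_ball_vol_2)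

lemma sets_lborel_pair:
  "sets (lborel \<Otimes>\<^sub>M lborel) = sets (borel :: ('a::euclidean_space \<times> 'b::euclidean_space) measure)"
  unfolding borel_prod[symmetric] by (intro sets_pair_measure_cong) simp_all

text \<open>The indicator functions are of open sets, hence measurable on the product space; the
  innermost variable changes from \<open>\<zeta>\<close> to \<open>y\<close>.\<close>
lemma Fubini_three_balls:
  fixes g :: "complex \<Rightarrow> complex \<Rightarrow> complex^'n \<Rightarrow> 'a::topological_space"
  assumes g: "continuous_on UNIV (\<lambda>(\<zeta>, x, y). g \<zeta> x y)" and E: "open E"
    and D: "open D" "open P" "open Q"
  defines "J \<equiv> \<lambda>\<zeta> x y. (if \<zeta> \<in> D \<and> x \<in> P \<and> y \<in> Q \<and> g \<zeta> x y \<in> E then 1 else 0 :: ennreal)"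
  shows "(\<integral>\<^sup>+y. \<integral>\<^sup>+x. \<integral>\<^sup>+\<zeta>. J \<zeta> x y \<partial>lborel \<partial>lborel \<partial>lborel)
       = (\<integral>\<^sup>+x. \<integral>\<^sup>+\<zeta>. \<integral>\<^sup>+y. J \<zeta> x y \<partial>lborel \<partial>lborel \<partial>lborel)"
proof -
  have sets3: "sets ((lborel \<Otimes>\<^sub>M lborel) \<Otimes>\<^sub>M lborel) = sets (borel :: ((complex \<times> (complex^'n)) \<times> complex) measure)"
    unfolding borel_prod[symmetric] by (intro sets_pair_measure_cong sets_lborel_pair[unfolded borel_prod[symmetric]]) simp_all
  define S where "S = {p::((complex \<times> (complex^'n)) \<times> complex). snd p \<in> D \<and> fst (fst p) \<in> P \<and> snd (fst p) \<in> Q \<and> g (snd p) (fst (fst p)) (snd (fst p)) \<in> E}"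
  have oS: "open S"
  proof -
    have "continuous_on UNIV (\<lambda>p::((complex \<times> (complex^'n)) \<times> complex). (snd p, fst (fst p), snd (fst p)))"
      by (intro continuous_intros)
    then have "continuous_on UNIV (\<lambda>p::((complex \<times> (complex^'n)) \<times> complex). (\<lambda>(\<zeta>, x, y). g \<zeta> x y) (snd p, fst (fst p), snd (fst p)))"
      by (rule continuous_on_compose2[OF g]) simp
    then have "continuous_on UNIV (\<lambda>p::((complex \<times> (complex^'n)) \<times> complex). g (snd p) (fst (fst p)) (snd (fst p)))"
      by (simp only: prod.case)
    then have "open ((\<lambda>p::((complex \<times> (complex^'n)) \<times> complex). g (snd p) (fst (fst p)) (snd (fst p))) -` E)"
      by (rule open_vimage[OF E])
    moreover have "open ((\<lambda>p::((complex \<times> (complex^'n)) \<times> complex). snd p) -` D)"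
      "open ((\<lambda>p::((complex \<times> (complex^'n)) \<times> complex). fst (fst p)) -` P)"
      "open ((\<lambda>p::((complex \<times> (complex^'n)) \<times> complex). snd (fst p)) -` Q)"
      by (intro open_vimage D continuous_intros)+
    moreover have "S = ((\<lambda>p::((complex \<times> (complex^'n)) \<times> complex). g (snd p) (fst (fst p)) (snd (fst p))) -` E)
      \<inter> ((\<lambda>p. snd p) -` D) \<inter> ((\<lambda>p. fst (fst p)) -` P) \<inter> ((\<lambda>p. snd (fst p)) -` Q)"
      by (auto simp: S_def)
    ultimately show ?thesis by auto
  qed
  have JS: "J \<zeta> x y = indicator S ((x, y), \<zeta>)" for \<zeta> x y
    by (simp add: J_def S_def)
  have m3: "(\<lambda>(q, \<zeta>). J \<zeta> (fst q) (snd q)) \<in> borel_measurable ((lborel \<Otimes>\<^sub>M lborel) \<Otimes>\<^sub>M lborel)"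
  proof -
    have "(\<lambda>(q, \<zeta>). J \<zeta> (fst q) (snd q)) = (indicator S :: _ \<Rightarrow> ennreal)"
      by (auto simp: fun_eq_iff JS)
    moreover have "(indicator S :: _ \<Rightarrow> ennreal) \<in> borel_measurable borel" using oS by simp
    ultimately show ?thesis by (simp add: measurable_cong_sets[OF sets3 refl])
  qed
  have "(\<lambda>q. \<integral>\<^sup>+\<zeta>. J \<zeta> (fst q) (snd q) \<partial>lborel) \<in> borel_measurable (lborel \<Otimes>\<^sub>M lborel)"
    by (rule lborel.borel_measurable_nn_integral[OF m3])
  then have "(\<lambda>(x, y). \<integral>\<^sup>+\<zeta>. J \<zeta> x y \<partial>lborel) \<in> borel_measurable (lborel \<Otimes>\<^sub>M lborel)"
    by (simp add: case_prod_unfold)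
  then have "(\<integral>\<^sup>+y. \<integral>\<^sup>+x. \<integral>\<^sup>+\<zeta>. J \<zeta> x y \<partial>lborel \<partial>lborel \<partial>lborel)
      = (\<integral>\<^sup>+x. \<integral>\<^sup>+y. \<integral>\<^sup>+\<zeta>. J \<zeta> x y \<partial>lborel \<partial>lborel \<partial>lborel)"
    by (rule lborel_pair.Fubini')
  also have "\<dots> = (\<integral>\<^sup>+x. \<integral>\<^sup>+\<zeta>. \<integral>\<^sup>+y. J \<zeta> x y \<partial>lborel \<partial>lborel \<partial>lborel)"
  proof (rule nn_integral_cong)
    fix x :: complex
    have "(\<lambda>p::complex \<times> (complex^'n). ((x, snd p), fst p)) -` S \<in> sets borel"
      by (intro borel_open open_vimage oS continuous_intros)
    moreover have "(\<lambda>(\<zeta>, y). J \<zeta> x y) = indicator ((\<lambda>p::complex \<times> (complex^'n). ((x, snd p), fst p)) -` S)"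
      by (auto simp: fun_eq_iff JS indicator_def)
    ultimately have "(\<lambda>(\<zeta>, y). J \<zeta> x y) \<in> borel_measurable borel" by simp
    then have "(\<lambda>(\<zeta>, y). J \<zeta> x y) \<in> borel_measurable (lborel \<Otimes>\<^sub>M lborel)"
      by (simp add: measurable_cong_sets[OF sets_lborel_pair refl])
    then show "(\<integral>\<^sup>+y. \<integral>\<^sup>+\<zeta>. J \<zeta> x y \<partial>lborel \<partial>lborel) = (\<integral>\<^sup>+\<zeta>. \<integral>\<^sup>+y. J \<zeta> x y \<partial>lborel \<partial>lborel)"
      by (rule lborel_pair.Fubini')
  qed
  finally show ?thesis .
qed

context isotropic_psh
begin

lemma open_sublevel: "open {z. 0 < norm z \<and> norm z < 2 \<and> u z < c}"
  unfolding open_dist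
proof
  fix z assume z: "z \<in> {z. 0 < norm z \<and> norm z < 2 \<and> u z < c}"
  then have zG: "z \<in> punctured_ball" by blast
  obtain d where d: "d > 0" "\<And>z'. z' \<in> punctured_ball \<Longrightarrow> dist z' z < d \<Longrightarrow> u z' < c"
    using usc_real_onD[OF usc zG, of c] z by blast
  obtain e where e: "e > 0" "\<And>z'. dist z' z < e \<Longrightarrow> z' \<in> punctured_ball"
    using open_punctured_ball zG unfolding open_dist by blast
  show "\<exists>e>0. \<forall>z'. dist z' z < e \<longrightarrow> z' \<in> {z. 0 < norm z \<and> norm z < 2 \<and> u z < c}"
  proof (intro exI[of _ "min d e"] conjI allI impI)
    fix z' assume "dist z' z < min d e"
    then have "z' \<in> punctured_ball" "dist z' z < d" using e by auto
    then show "z' \<in> {z. 0 < norm z \<and> norm z < 2 \<and> u z < c}" using d(2) by blast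
  qed (use d e in simp)
qed

text \<open>Points near \<open>e^s w0\<close> are written as \<open>\<zeta> (w0 + x y)\<close> with \<open>\<zeta>\<close> near \<open>e^s\<close>, \<open>\<bar>x\<bar> < \<rho>\<close> and \<open>\<bar>y\<bar> < 1/4\<close>,
  and the measure of the bad triples is computed in two ways. For fixed \<open>y\<close> the parameters \<open>x\<close> with
  small \<open>U\<close> form a set of area at most \<open>const e^(-B M)\<close> by the transversal estimate; for all other \<open>x\<close> the bad
  \<open>\<zeta>\<close> have area at most \<open>const e^(2 s - B M)\<close> by the line estimate. For fixed \<open>\<zeta>\<close> and \<open>x\<close>, with \<open>x\<close>
  not too small, the map from \<open>y\<close> to \<open>\<zeta> (w0 + x y)\<close> is an affine dilation whose image covers the ball
  around \<open>e^s w0\<close>, so the measure of bad \<open>y\<close> is at least the volume in question divided by the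
  Jacobian, which is at most \<open>e^(2 n s)\<close>.\<close>
lemma volume_estimate_near_direction:
  assumes w0: "1 / 3 \<le> norm w0" "norm w0 \<le> 1" and \<mu>: "\<nu> < \<mu>" and B: "0 < B"
  obtains \<sigma> C s1 M0 where "0 < \<sigma>" "0 \<le> C"
    "\<And>s M. s \<le> s1 \<Longrightarrow> M0 \<le> M \<Longrightarrow>
      emeasure lborel {z. dist z (of_real (exp s) *s w0) < \<sigma> * exp s \<and> 0 < norm z \<and> norm z < 2 \<and> u z < \<mu> * s - M}
        \<le> ennreal (C * exp (2 * real CARD('n) * s - B * M))"
proof -
  have B2: "0 < B / 2" using B by simp
  obtain B3 \<mu>2 s1 where L: "0 < B3" "\<nu> < \<mu>2"  "s1 \<le> - 2"
    "\<And>w s M. 1 / 12 \<le> norm w \<Longrightarrow> norm w \<le> 5 / 4 \<Longrightarrow> s \<le> s1 \<Longrightarrow> 0 < M \<Longrightarrow>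
       2 * pi * exp (2 * s - 2 * (B / 2) * M) \<le> measure lborel {\<zeta>. dist (of_real (exp s)) \<zeta> < exp s / 2 \<and> u (\<zeta> *s w) < \<mu> * s - M} \<Longrightarrow>
       U (of_real (exp s) *s w) < \<mu>2 * s - (M / (2 * B3) - \<nu> - 1)"
    by (rule line_estimate[OF \<mu> B2]) (rule that; assumption)
  have BB: "0 < 2 * B3 * B" using L(1) B by simp
  obtain \<rho> where \<rho>: "0 < \<rho>" "\<rho> \<le> 1 / 2"
    "\<And>y s M. norm y \<le> 1 / 4 \<Longrightarrow> s \<le> 0 \<Longrightarrow> 0 < M \<Longrightarrow>
       {x. norm x < \<rho> \<and> U (of_real (exp s) *s (w0 + x *s y)) < \<mu>2 * s - M} \<in> sets borel \<and>
       measure lborel {x. norm x < \<rho> \<and> U (of_real (exp s) *s (w0 + x *s y)) < \<mu>2 * s - M}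
         \<le> 2 * pi * exp (14 - 2 * B3 * B * M)"
    by (rule transversal_estimate[OF w0 L(2) BB]) (rule that; assumption)
  \<comment> \<open>The radius of the disc of \<open>\<zeta> / e^s\<close> around 1; it is so small that solving \<open>\<zeta> (w0 + x y) = z\<close> for \<open>y\<close> gives \<open>\<bar>y\<bar> < 1/4\<close> whenever \<open>\<bar>x\<bar> > \<rho> / 2\<close> and \<open>z\<close> is within \<open>\<rho> / 16 e^s\<close> of \<open>e^s w0\<close>.\<close>
  define \<kappa> where "\<kappa> = \<rho> / 64"
  have \<kappa>: "0 < \<kappa>" "\<kappa> \<le> 1 / 128" using \<rho>(1,2) by (auto simp: \<kappa>_def)
  define M0 where "M0 = 2 * B3 * (\<nu> + 2)"
  define C1 where "C1 = 2 * pi * pi * (exp (14 + 2 * B3 * B * (\<nu> + 1)) + 1)"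
  define V where "V = measure lborel (ball (0::complex^'n) (1 / 4))"
  define \<alpha> where "\<alpha> = (pi * (\<rho> / 4)\<^sup>2) * (pi * \<kappa>\<^sup>2)"
  have \<alpha>: "0 < \<alpha>" using \<rho>(1,2) \<kappa> by (simp add: \<alpha>_def)
  have C1: "0 \<le> C1" by (simp add: C1_def add_nonneg_nonneg)
  have V0: "0 \<le> V" by (simp add: V_def)
  show thesis
  proof (rule that[of "\<rho> / 16" "C1 * V / \<alpha>" s1 M0])
    show "0 < \<rho> / 16" using \<rho>(1,2) by simp
    show "0 \<le> C1 * V / \<alpha>" using C1 V0 \<alpha> by simp
    fix s M assume s: "s \<le> s1" and M: "M0 \<le> M"
    let ?e = "exp s"
    let ?ec = "complex_of_real ?e"
    have s0: "s \<le> 0" "s \<le> - 2" using s L(3) by auto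
    have M_pos: "0 < M"
    proof -
      have "0 < M0" using L(1) pos by (simp add: M0_def)
      then show ?thesis using M by linarith
    qed
    define M' where "M' = M / (2 * B3) - \<nu> - 1"
    have M': "0 < M'"
    proof -
      have "\<nu> + 2 \<le> M / (2 * B3)" using M L(1) by (simp add: M0_def pos_le_divide_eq mult.commute)
      then show ?thesis by (simp add: M'_def)
    qed
    have "exp (- 2) \<le> (1 / 3 :: real)" using exp_ge_add_one_self[of "2::real"] by (simp add: exp_minus field_simps)
    moreover have "?e \<le> exp (- 2)" using s0 by simp
    ultimately have e3: "?e \<le> 1 / 3" by linarith
    define E where "E = {z. 0 < norm z \<and> norm z < 2 \<and> u z < \<mu> * s - M}"
    have oE: "open E" unfolding E_def by (rule open_sublevel)
    define D where "D = ball ?ec (?e / 2)"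
    define P where "P = ball (0::complex) \<rho>"
    define Q where "Q = ball (0::complex^'n) (1 / 4)"
    define J where "J = (\<lambda>\<zeta> x y. (if \<zeta> \<in> D \<and> x \<in> P \<and> y \<in> Q \<and> \<zeta> *s (w0 + x *s y) \<in> E then 1 else 0 :: ennreal))"
    have cont: "continuous_on UNIV (\<lambda>(\<zeta>, x, y). \<zeta> *s (w0 + x *s (y::complex^'n)))"
      unfolding case_prod_unfold by (intro continuous_intros)
    have fub: "(\<integral>\<^sup>+y. \<integral>\<^sup>+x. \<integral>\<^sup>+\<zeta>. J \<zeta> x y \<partial>lborel \<partial>lborel \<partial>lborel)
       = (\<integral>\<^sup>+x. \<integral>\<^sup>+\<zeta>. \<integral>\<^sup>+y. J \<zeta> x y \<partial>lborel \<partial>lborel \<partial>lborel)"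
      unfolding J_def by (rule Fubini_three_balls[OF cont oE]) (simp_all add: D_def P_def Q_def)
    define m where "m = C1 * exp (2 * s - B * M)"
    have m0: "0 \<le> m" using C1 by (simp add: m_def)
    \<comment> \<open>Upper bound: fix the transversal direction \<open>y\<close>, then split the parameters \<open>x\<close>.\<close>
    have inner: "(\<integral>\<^sup>+x. \<integral>\<^sup>+\<zeta>. J \<zeta> x y \<partial>lborel \<partial>lborel) \<le> ennreal m * indicator Q y" for y
    proof (cases "y \<in> Q")
      case False
      then have "J \<zeta> x y = 0" for \<zeta> x by (simp add: J_def)
      then show ?thesis by simp
    next
      case True
      then have y: "norm y \<le> 1 / 4" by (simp add: Q_def)
      define F where "F = {x. norm x < \<rho> \<and> U (of_real ?e *s (w0 + x *s y)) < \<mu>2 * s - M'}"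
      have F: "F \<in> sets borel" "measure lborel F \<le> 2 * pi * exp (14 - 2 * B3 * B * M')"
        using \<rho>(3)[OF y s0(1) M'] by (auto simp: F_def)
      have FP: "F \<subseteq> P" by (auto simp: F_def P_def)
      have Ffin: "emeasure lborel F = ennreal (measure lborel F)"
      proof -
        have "emeasure lborel F \<le> emeasure lborel P" using FP by (intro emeasure_mono) (auto simp: P_def)
        also have "\<dots> < \<infinity>" unfolding P_def by (rule emeasure_lborel_ball_finite)
        finally show ?thesis by (simp add: emeasure_eq_ennreal_measure)
      qed
      let ?a = "pi * (?e / 2)\<^sup>2" and ?b = "2 * pi * exp (2 * s - B * M)"
      have bd: "(\<integral>\<^sup>+\<zeta>. J \<zeta> x y \<partial>lborel) \<le> ennreal ?a * indicator F x + ennreal ?b * indicator P x" for x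
      proof (cases "x \<in> P")
        case False
        then have "J \<zeta> x y = 0" for \<zeta> by (simp add: J_def)
        then show ?thesis by simp
      next
        case xP: True
        then have x1: "norm x \<le> 1" using \<rho>(1,2) by (simp add: P_def)
        let ?w = "w0 + x *s y"
        note tp = transversal_point(1)[OF w0 y x1]
        define Ew where "Ew = {\<zeta>. dist ?ec \<zeta> < ?e / 2 \<and> u (\<zeta> *s ?w) < \<mu> * s - M}"
        show ?thesis
        proof (cases "x \<in> F")
          case True
          have "(\<integral>\<^sup>+\<zeta>. J \<zeta> x y \<partial>lborel) \<le> (\<integral>\<^sup>+\<zeta>. indicator D \<zeta> \<partial>lborel)"
            by (intro nn_integral_mono) (simp add: J_def)
          also have "\<dots> = ennreal ?a" unfolding D_def
            by (subst nn_integral_indicator) (auto simp: emeasure_ball_complex)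
          finally show ?thesis using True by (simp add: add_increasing2)
        next
          case False
          have "\<not> U (of_real ?e *s ?w) < \<mu>2 * s - M'" using False xP by (simp add: F_def P_def)
          then have lt: "measure lborel Ew < ?b"
            using L(4)[of ?w s M] tp s M_pos unfolding Ew_def M'_def by force
          have JE: "J \<zeta> x y = indicator Ew \<zeta>" for \<zeta>
          proof -
            have "0 < norm (\<zeta> *s ?w) \<and> norm (\<zeta> *s ?w) < 2" if "dist ?ec \<zeta> < ?e / 2"
            proof -
              have "\<bar>norm ?ec - norm \<zeta>\<bar> \<le> norm (?ec - \<zeta>)" by (rule norm_triangle_ineq3)
              then have "\<bar>?e - norm \<zeta>\<bar> < ?e / 2" using that unfolding dist_norm norm_of_real abs_exp_cancel by linarith
              then have n: "0 < norm \<zeta>" "norm \<zeta> \<le> 1 / 2" using e3 exp_gt_zero[of s] by linarith+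
              have "norm \<zeta> * norm ?w \<le> 1 / 2 * (5 / 4)" using n tp by (intro mult_mono) auto
              moreover have "0 < norm \<zeta> * norm ?w" using n tp by (intro mult_pos_pos) auto
              ultimately show ?thesis unfolding norm_vector_scalar by linarith
            qed
            then show ?thesis using xP True unfolding J_def Ew_def E_def D_def mem_ball
              by (auto simp: indicator_def simp del: vector_add_ldistrib norm_vector_scalar)
          qed
          have "\<zeta> \<in> Ew \<longleftrightarrow> \<zeta> \<in> D \<and> \<zeta> *s ?w \<in> E" for \<zeta>
            using JE[of \<zeta>] xP True unfolding J_def
            by (cases "\<zeta> \<in> Ew"; cases "\<zeta> \<in> D \<and> \<zeta> *s ?w \<in> E") (simp_all del: vector_add_ldistrib)
          then have Ew_eq: "Ew = (\<lambda>\<zeta>. \<zeta> *s ?w) -` E \<inter> D" by blast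
          have "open ((\<lambda>\<zeta>. \<zeta> *s ?w) -` E)" by (intro open_vimage oE continuous_intros)
          then have oEw: "open Ew" unfolding Ew_eq D_def by (rule open_Int[OF _ open_ball])
          have "Ew \<subseteq> D" by (auto simp: Ew_def D_def)
          then have "emeasure lborel Ew \<le> emeasure lborel D" by (intro emeasure_mono) (auto simp: D_def)
          also have "\<dots> < \<infinity>" unfolding D_def by (rule emeasure_lborel_ball_finite)
          finally have "emeasure lborel Ew = ennreal (measure lborel Ew)" by (simp add: emeasure_eq_ennreal_measure)
          moreover have "(\<integral>\<^sup>+\<zeta>. J \<zeta> x y \<partial>lborel) = emeasure lborel Ew"
            unfolding JE using oEw by simp
          ultimately have "(\<integral>\<^sup>+\<zeta>. J \<zeta> x y \<partial>lborel) \<le> ennreal ?b" using lt by (simp add: ennreal_leI)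
          then show ?thesis using xP by (simp add: add_increasing)
        qed
      qed
      have "(\<integral>\<^sup>+x. \<integral>\<^sup>+\<zeta>. J \<zeta> x y \<partial>lborel \<partial>lborel) \<le> (\<integral>\<^sup>+x. ennreal ?a * indicator F x + ennreal ?b * indicator P x \<partial>lborel)"
        by (intro nn_integral_mono bd)
      also have "\<dots> = ennreal ?a * emeasure lborel F + ennreal ?b * emeasure lborel P"
      proof -
        have Fm: "F \<in> sets lborel" and Pm: "P \<in> sets lborel" using F(1) by (simp_all add: P_def)
        have "(\<lambda>x. ennreal ?a * indicator F x) \<in> borel_measurable lborel"
          "(\<lambda>x. ennreal ?b * indicator P x) \<in> borel_measurable lborel"
          by (intro borel_measurable_times_ennreal borel_measurable_const borel_measurable_indicator Fm Pm)+
        then show ?thesis by (simp only: nn_integral_add nn_integral_cmult_indicator[OF Fm] nn_integral_cmult_indicator[OF Pm])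
      qed
      also have "\<dots> = ennreal (?a * measure lborel F + ?b * (pi * \<rho>\<^sup>2))"
        unfolding Ffin P_def using \<rho>(1,2) by (simp add: emeasure_ball_complex ennreal_mult[symmetric] ennreal_plus[symmetric] del: ennreal_plus)
      also have "\<dots> \<le> ennreal m"
      proof (rule ennreal_leI)
        have e1: "2 * B3 * B * M' = B * M - 2 * B3 * B * (\<nu> + 1)"
          using L(1) by (simp add: M'_def field_simps)
        have "?a * measure lborel F \<le> (pi * exp (2 * s)) * (2 * pi * exp (14 - 2 * B3 * B * M'))"
        proof (rule mult_mono[OF _ F(2)])
          have "(?e / 2)\<^sup>2 \<le> ?e\<^sup>2" by (intro power_mono) auto
          then show "?a \<le> pi * exp (2 * s)" by (simp add: exp_double)
        qed auto
        also have "\<dots> = 2 * pi * pi * (exp (14 + 2 * B3 * B * (\<nu> + 1)) * exp (2 * s - B * M))"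
        proof -
          have "exp (2 * s) * exp (14 - 2 * B3 * B * M') = exp (14 + 2 * B3 * B * (\<nu> + 1)) * exp (2 * s - B * M)"
            unfolding exp_add[symmetric] using e1 by simp
          moreover have "(pi * x) * (2 * pi * y) = 2 * pi * pi * (x * y)" for x y :: real by simp
          ultimately show ?thesis by (simp only:)
        qed
        finally have 1: "?a * measure lborel F \<le> 2 * pi * pi * (exp (14 + 2 * B3 * B * (\<nu> + 1)) * exp (2 * s - B * M))" .
        have "\<rho>\<^sup>2 \<le> 1" using \<rho>(1,2) by (intro power_le_one) auto
        then have 2: "?b * (pi * \<rho>\<^sup>2) \<le> ?b * (pi * 1)" by (intro mult_left_mono) auto
        show "?a * measure lborel F + ?b * (pi * \<rho>\<^sup>2) \<le> m"
        proof -
          have alg: "2 * pi * pi * (X + 1) * Y = 2 * pi * pi * (X * Y) + 2 * pi * Y * (pi * 1)" for X Y :: real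
            by (simp add: algebra_simps)
          show ?thesis unfolding m_def C1_def alg by (rule add_mono[OF 1 2])
        qed
      qed
      finally show ?thesis using True by simp
    qed
    have "(\<integral>\<^sup>+y. \<integral>\<^sup>+x. \<integral>\<^sup>+\<zeta>. J \<zeta> x y \<partial>lborel \<partial>lborel \<partial>lborel) \<le> (\<integral>\<^sup>+y. ennreal m * indicator Q y \<partial>lborel)"
      by (intro nn_integral_mono inner)
    also have "\<dots> = ennreal (m * V)"
    proof -
      have Qm: "Q \<in> sets lborel" by (simp add: Q_def)
      have "emeasure lborel Q < \<infinity>" unfolding Q_def by (rule emeasure_lborel_ball_finite)
      then have "emeasure lborel Q = ennreal V" unfolding V_def Q_def by (simp add: emeasure_eq_ennreal_measure)
      then show ?thesis unfolding nn_integral_cmult_indicator[OF Qm] using m0 V0 by (simp add: ennreal_mult)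
    qed
    finally have up: "(\<integral>\<^sup>+x. \<integral>\<^sup>+\<zeta>. \<integral>\<^sup>+y. J \<zeta> x y \<partial>lborel \<partial>lborel \<partial>lborel) \<le> ennreal (m * V)"
      unfolding fub .
    \<comment> \<open>Lower bound: for \<open>x\<close> and \<open>\<zeta>\<close> in suitable small discs the points \<open>\<zeta> (w0 + x y)\<close> sweep out the whole ball.\<close>
    define E' where "E' = {z. dist z (of_real ?e *s w0) < \<rho> / 16 * ?e} \<inter> E"
    have oE': "open E'"
    proof -
      have "{z. dist z (of_real ?e *s w0) < \<rho> / 16 * ?e} = ball (of_real ?e *s w0) (\<rho> / 16 * ?e)"
        by (auto simp: dist_commute)
      then show ?thesis unfolding E'_def by (simp only:) (rule open_Int[OF open_ball oE])
    qed
    have E'b: "E' \<in> sets borel" using oE' by simp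
    \<comment> \<open>A disc of parameters \<open>x\<close> with \<open>\<rho> / 2 < \<bar>x\<bar> < \<rho>\<close>.\<close>
    define A where "A = ball (complex_of_real (3 / 4 * \<rho>)) (\<rho> / 4)"
    define D' where "D' = ball ?ec (\<kappa> * ?e)"
    let ?n = "CARD('n)"
    have low: "emeasure lborel E' * indicator A x * indicator D' \<zeta>
        \<le> ennreal (exp (2 * real ?n * s)) * (\<integral>\<^sup>+y. J \<zeta> x y \<partial>lborel)" for x \<zeta>
    proof (cases "x \<in> A \<and> \<zeta> \<in> D'")
      case False
      then show ?thesis by auto
    next
      case True
      have xA: "norm (complex_of_real (3 / 4 * \<rho>) - x) < \<rho> / 4" using True unfolding A_def mem_ball dist_norm by blast
      have "\<bar>norm (complex_of_real (3 / 4 * \<rho>)) - norm x\<bar> \<le> norm (complex_of_real (3 / 4 * \<rho>) - x)"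
        by (rule norm_triangle_ineq3)
      moreover have "norm (complex_of_real (3 / 4 * \<rho>)) = 3 / 4 * \<rho>" using \<rho>(1) unfolding norm_of_real by simp
      ultimately have "\<bar>3 / 4 * \<rho> - norm x\<bar> < \<rho> / 4" using xA by linarith
      then have x: "\<rho> / 2 < norm x" "norm x < \<rho>" by linarith+
      have \<zeta>d: "norm (?ec - \<zeta>) < \<kappa> * ?e" using True by (simp add: D'_def dist_norm)
      have "\<bar>norm ?ec - norm \<zeta>\<bar> \<le> norm (?ec - \<zeta>)" by (rule norm_triangle_ineq3)
      then have "\<bar>?e - norm \<zeta>\<bar> < \<kappa> * ?e" using \<zeta>d unfolding norm_of_real abs_exp_cancel by linarith
      moreover have "\<kappa> * ?e \<le> 1 / 128 * ?e" using \<kappa> by (intro mult_right_mono) auto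
      ultimately have \<zeta>: "127 / 128 * ?e \<le> norm \<zeta>" "norm \<zeta> \<le> 129 / 128 * ?e" by linarith+
      have \<zeta>D: "\<zeta> \<in> D" using \<zeta>d \<open>\<kappa> * ?e \<le> 1 / 128 * ?e\<close> exp_gt_zero[of s] unfolding D_def mem_ball dist_norm by linarith
      let ?c = "\<zeta> * x"
      have c: "127 / 256 * (\<rho> * ?e) \<le> norm ?c" "norm ?c \<le> ?e"
      proof -
        have "(127 / 128 * ?e) * (\<rho> / 2) \<le> norm \<zeta> * norm x" using \<zeta> x \<rho>(1,2) exp_gt_zero[of s] by (intro mult_mono) linarith+
        then show "127 / 256 * (\<rho> * ?e) \<le> norm ?c" by (simp add: norm_mult algebra_simps)
        have "norm \<zeta> * norm x \<le> (129 / 128 * ?e) * (1 / 2)" using \<zeta> x \<rho>(1,2) exp_gt_zero[of s] by (intro mult_mono) linarith+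
        then show "norm ?c \<le> ?e" using exp_gt_zero[of s] unfolding norm_mult by linarith
      qed
      have "0 < 127 / 256 * (\<rho> * ?e)" using \<rho>(1,2) by simp
      then have c0: "?c \<noteq> 0" using c(1) by auto
      have sub: "(\<lambda>y. \<zeta> *s w0 + ?c *s y) -` E' \<subseteq> {y. y \<in> Q \<and> \<zeta> *s (w0 + x *s y) \<in> E}"
      proof
        fix y assume y: "y \<in> (\<lambda>y. \<zeta> *s w0 + ?c *s y) -` E'"
        have eq: "\<zeta> *s w0 + ?c *s y = \<zeta> *s (w0 + x *s y)" by (simp add: vec_eq_iff algebra_simps)
        have z: "norm (\<zeta> *s w0 + ?c *s y - ?ec *s w0) < \<rho> / 16 * ?e" "\<zeta> *s w0 + ?c *s y \<in> E"
          using y by (auto simp: E'_def dist_norm)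
        have "?c *s y = (\<zeta> *s w0 + ?c *s y - ?ec *s w0) + (?ec - \<zeta>) *s w0"
          by (simp add: vec_eq_iff algebra_simps)
        then have "norm (?c *s y) \<le> norm (\<zeta> *s w0 + ?c *s y - ?ec *s w0) + norm ((?ec - \<zeta>) *s w0)"
          by (metis norm_triangle_ineq)
        also have "norm ((?ec - \<zeta>) *s w0) \<le> (\<kappa> * ?e) * 1"
          unfolding norm_vector_scalar using \<zeta>d w0 \<kappa> by (intro mult_mono) auto
        finally have "norm ?c * norm y < \<rho> / 16 * ?e + \<kappa> * ?e" using z(1) unfolding norm_vector_scalar by linarith
        also have "\<dots> = 5 / 64 * (\<rho> * ?e)" by (simp add: \<kappa>_def algebra_simps)
        finally have cy: "norm ?c * norm y < 5 / 64 * (\<rho> * ?e)" .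
        have "norm y < 1 / 4"
        proof (rule ccontr)
          assume "\<not> norm y < 1 / 4"
          then have "127 / 256 * (\<rho> * ?e) * (1 / 4) \<le> norm ?c * norm y" using c(1) \<rho>(1,2) by (intro mult_mono) auto
          moreover have "0 < \<rho> * ?e" using \<rho>(1,2) by simp
          ultimately show False using cy by linarith
        qed
        then show "y \<in> {y. y \<in> Q \<and> \<zeta> *s (w0 + x *s y) \<in> E}" using z(2) unfolding eq by (simp add: Q_def)
      qed
      have "emeasure lborel E' = ennreal (norm ?c ^ (2 * ?n)) * emeasure lborel ((\<lambda>y. \<zeta> *s w0 + ?c *s y) -` E')"
        by (rule emeasure_lborel_vector_scalar_vimage[OF E'b c0])
      also have "\<dots> \<le> ennreal (exp (2 * real ?n * s)) * (\<integral>\<^sup>+y. J \<zeta> x y \<partial>lborel)"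
      proof (intro mult_mono)
        have "norm ?c ^ (2 * ?n) \<le> ?e ^ (2 * ?n)" using c(2) by (intro power_mono) auto
        also have "\<dots> = exp (2 * real ?n * s)" by (simp add: exp_of_nat_mult[symmetric])
        finally show "ennreal (norm ?c ^ (2 * ?n)) \<le> ennreal (exp (2 * real ?n * s))" by (rule ennreal_leI)
        have cc: "continuous_on UNIV (\<lambda>y. \<zeta> *s w0 + ?c *s y)" by (intro continuous_intros)
        then have "open ((\<lambda>y. \<zeta> *s w0 + ?c *s y) -` E')" using oE' by (simp add: open_vimage)
        then have "emeasure lborel ((\<lambda>y. \<zeta> *s w0 + ?c *s y) -` E') = (\<integral>\<^sup>+y. indicator ((\<lambda>y. \<zeta> *s w0 + ?c *s y) -` E') y \<partial>lborel)"
          by simp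
        also have "\<dots> \<le> (\<integral>\<^sup>+y. J \<zeta> x y \<partial>lborel)"
        proof (intro nn_integral_mono)
          fix y
          show "indicator ((\<lambda>y. \<zeta> *s w0 + ?c *s y) -` E') y \<le> J \<zeta> x y"
          proof (cases "y \<in> (\<lambda>y. \<zeta> *s w0 + ?c *s y) -` E'")
            case True
            then have "y \<in> Q \<and> \<zeta> *s (w0 + x *s y) \<in> E" using sub by blast
            then have "J \<zeta> x y = 1" using \<zeta>D x(2) unfolding J_def by (simp add: P_def del: vector_add_ldistrib)
            then show ?thesis by (simp add: indicator_def)
          qed simp
        qed
        finally show "emeasure lborel ((\<lambda>y. \<zeta> *s w0 + ?c *s y) -` E') \<le> (\<integral>\<^sup>+y. J \<zeta> x y \<partial>lborel)" .
      qed auto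
      finally show ?thesis using True by simp
    qed
    let ?c0 = "ennreal (exp (- (2 * real ?n * s)))"
    have low2: "?c0 * emeasure lborel E' * indicator A x * indicator D' \<zeta> \<le> (\<integral>\<^sup>+y. J \<zeta> x y \<partial>lborel)" for x \<zeta>
    proof -
      have "?c0 * (emeasure lborel E' * indicator A x * indicator D' \<zeta>)
          \<le> ?c0 * (ennreal (exp (2 * real ?n * s)) * (\<integral>\<^sup>+y. J \<zeta> x y \<partial>lborel))"
        by (rule mult_left_mono[OF low]) simp
      also have "\<dots> = (?c0 * ennreal (exp (2 * real ?n * s))) * (\<integral>\<^sup>+y. J \<zeta> x y \<partial>lborel)" by (rule mult.assoc[symmetric])
      also have "?c0 * ennreal (exp (2 * real ?n * s)) = 1"
        by (subst ennreal_mult[symmetric]) (auto simp: exp_add[symmetric])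
      finally show ?thesis by (simp only: mult.assoc mult_1)
    qed
    have "?c0 * emeasure lborel E' * (ennreal (pi * (\<rho> / 4)\<^sup>2) * ennreal (pi * (\<kappa> * ?e)\<^sup>2))
        = (\<integral>\<^sup>+x. \<integral>\<^sup>+\<zeta>. ?c0 * emeasure lborel E' * indicator A x * indicator D' \<zeta> \<partial>lborel \<partial>lborel)"
    proof -
      have Am: "A \<in> sets lborel" and Dm: "D' \<in> sets lborel" by (simp_all add: A_def D'_def)
      have "emeasure lborel A = ennreal (pi * (\<rho> / 4)\<^sup>2)" "emeasure lborel D' = ennreal (pi * (\<kappa> * ?e)\<^sup>2)"
        unfolding A_def D'_def using \<rho>(1,2) \<kappa> by (intro emeasure_ball_complex; simp)+
      moreover have "K * indicator A x * L = K * L * indicator A x" for K L :: ennreal and x by (simp only: mult_ac)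
      ultimately show ?thesis
        unfolding nn_integral_cmult_indicator[OF Dm] by (simp only: nn_integral_cmult_indicator[OF Am]) (simp only: mult_ac)
    qed
    also have "\<dots> \<le> (\<integral>\<^sup>+x. \<integral>\<^sup>+\<zeta>. \<integral>\<^sup>+y. J \<zeta> x y \<partial>lborel \<partial>lborel \<partial>lborel)"
      by (intro nn_integral_mono low2)
    also have "\<dots> \<le> ennreal (m * V)" by (rule up)
    finally have main: "?c0 * emeasure lborel E' * (ennreal (pi * (\<rho> / 4)\<^sup>2) * ennreal (pi * (\<kappa> * ?e)\<^sup>2)) \<le> ennreal (m * V)" .
    have "emeasure lborel E' \<le> emeasure lborel (ball (of_real ?e *s w0) (\<rho> / 16 * ?e))"
      by (intro emeasure_mono) (auto simp: E'_def dist_commute)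
    also have "\<dots> < \<infinity>" by (rule emeasure_lborel_ball_finite)
    finally have E'm: "emeasure lborel E' = ennreal (measure lborel E')" by (simp add: emeasure_eq_ennreal_measure)
    have "ennreal (exp (- (2 * real ?n * s)) * measure lborel E' * (pi * (\<rho> / 4)\<^sup>2 * (pi * (\<kappa> * ?e)\<^sup>2))) \<le> ennreal (m * V)"
      using main unfolding E'm by (simp add: ennreal_mult)
    then have "exp (- (2 * real ?n * s)) * measure lborel E' * (pi * (\<rho> / 4)\<^sup>2 * (pi * (\<kappa> * ?e)\<^sup>2)) \<le> m * V"
      using m0 V0 by (subst (asm) ennreal_le_iff) auto
    then have "exp (2 * real ?n * s) * (exp (- (2 * real ?n * s)) * measure lborel E' * (pi * (\<rho> / 4)\<^sup>2 * (pi * (\<kappa> * ?e)\<^sup>2))) \<le> exp (2 * real ?n * s) * (m * V)"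
      by (rule mult_left_mono) simp
    then have "measure lborel E' * (pi * (\<rho> / 4)\<^sup>2 * (pi * (\<kappa> * ?e)\<^sup>2)) \<le> exp (2 * real ?n * s) * (m * V)"
      unfolding mult.assoc[symmetric] exp_add[symmetric] by simp
    moreover have "pi * (\<rho> / 4)\<^sup>2 * (pi * (\<kappa> * ?e)\<^sup>2) = \<alpha> * exp (2 * s)"
      by (simp add: \<alpha>_def power_mult_distrib exp_double)
    moreover have "exp (2 * real ?n * s) * (m * V) = (C1 * V * exp (2 * real ?n * s - B * M)) * exp (2 * s)"
      by (simp add: m_def exp_add[symmetric] exp_diff)
    ultimately have "(measure lborel E' * \<alpha>) * exp (2 * s) \<le> (C1 * V * exp (2 * real ?n * s - B * M)) * exp (2 * s)"
      by (simp only: mult.assoc)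
    then have "measure lborel E' * \<alpha> \<le> C1 * V * exp (2 * real ?n * s - B * M)"
      by (rule mult_right_le_imp_le) simp
    then have "measure lborel E' \<le> C1 * V / \<alpha> * exp (2 * real ?n * s - B * M)"
      using \<alpha> by (simp add: pos_le_divide_eq mult.commute)
    then have "emeasure lborel E' \<le> ennreal (C1 * V / \<alpha> * exp (2 * real ?n * s - B * M))"
      unfolding E'm by (rule ennreal_leI)
    moreover have "E' = {z. dist z (of_real (exp s) *s w0) < \<rho> / 16 * exp s \<and> 0 < norm z \<and> norm z < 2 \<and> u z < \<mu> * s - M}"
      by (auto simp: E'_def E_def)
    ultimately show "emeasure lborel {z. dist z (of_real (exp s) *s w0) < \<rho> / 16 * exp s \<and> 0 < norm z \<and> norm z < 2 \<and> u z < \<mu> * s - M}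
        \<le> ennreal (C1 * V / \<alpha> * exp (2 * real CARD('n) * s - B * M))" by simp
  qed
qed

end

section \<open>Integrability of the exponential\<close>

lemma term_le_suminf_ennreal:
  fixes f :: "nat \<Rightarrow> ennreal"
  shows "f j \<le> (\<Sum>i. f i)"
  using sum_le_suminf[of f "{j}"] by simp

context isotropic_psh
begin

text \<open>Finitely many of the balls of \<open>volume_estimate_near_direction\<close>, scaled by \<open>e^s\<close>, cover the shell, by compactness of
  the set of directions.\<close>
lemma shell_volume_estimate:
  assumes \<mu>: "\<nu> < \<mu>" and B: "0 < B"
  obtains C s1 M0 where "0 \<le> C" "s1 \<le> 0" "0 \<le> M0"
    "\<And>s M. s \<le> s1 \<Longrightarrow> M0 \<le> M \<Longrightarrow>
      emeasure lborel {z. exp s / 3 \<le> norm z \<and> norm z \<le> exp s \<and> u z < \<mu> * s - M}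
        \<le> ennreal (C * exp (2 * real CARD('n) * s - B * M))"
proof -
  define T where "T = {w::complex^'n. 1 / 3 \<le> norm w \<and> norm w \<le> 1}"
  let ?S = "\<lambda>w0 \<sigma> s M. {z. dist z (of_real (exp s) *s w0) < \<sigma> * exp s \<and> 0 < norm z \<and> norm z < 2 \<and> u z < \<mu> * s - M}"
  let ?good = "\<lambda>w0 \<sigma> C s1 M0. 0 < \<sigma> \<and> 0 \<le> C \<and> (\<forall>s M. s \<le> s1 \<longrightarrow> M0 \<le> M \<longrightarrow>
      emeasure lborel (?S w0 \<sigma> s M) \<le> ennreal (C * exp (2 * real CARD('n) * s - B * M)))"
  have "\<exists>q. ?good w0 (fst q) (fst (snd q)) (fst (snd (snd q))) (snd (snd (snd q)))" if w0: "w0 \<in> T" for w0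
  proof -
    have w: "1 / 3 \<le> norm w0" "norm w0 \<le> 1" using w0 by (auto simp: T_def)
    show ?thesis
    proof (rule volume_estimate_near_direction[OF w \<mu> B])
      fix \<sigma> C s1 M0
      assume a: "0 < \<sigma>" "0 \<le> C" "\<And>s M. s \<le> s1 \<Longrightarrow> M0 \<le> M \<Longrightarrow>
        emeasure lborel (?S w0 \<sigma> s M) \<le> ennreal (C * exp (2 * real CARD('n) * s - B * M))"
      show ?thesis
        by (rule exI[of _ "(\<sigma>, C, s1, M0)"], unfold fst_conv snd_conv, intro conjI allI impI, rule a(1), rule a(2), rule a(3))
    qed
  qed
  then have "\<forall>w0\<in>T. \<exists>q. ?good w0 (fst q) (fst (snd q)) (fst (snd (snd q))) (snd (snd (snd q)))" by (rule ballI)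
  from bchoice[OF this] obtain q where q: "\<forall>w0\<in>T. ?good w0 (fst (q w0)) (fst (snd (q w0))) (fst (snd (snd (q w0)))) (snd (snd (snd (q w0))))"
    by (rule exE)
  define \<sigma> C s1 M0 where "\<sigma> = (\<lambda>w. fst (q w))" and "C = (\<lambda>w. fst (snd (q w)))"
    and "s1 = (\<lambda>w. fst (snd (snd (q w))))" and "M0 = (\<lambda>w. snd (snd (snd (q w))))"
  have good: "?good w0 (\<sigma> w0) (C w0) (s1 w0) (M0 w0)" if "w0 \<in> T" for w0
    using bspec[OF q that] unfolding \<sigma>_def C_def s1_def M0_def .
  have \<sigma>0: "0 < \<sigma> w0" if "w0 \<in> T" for w0 using good[OF that] by (rule conjunct1)
  have "compact T"
  proof -
    have "closed T" unfolding T_def by (intro closed_Collect_conj closed_Collect_le continuous_intros)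
    moreover have "bounded T" by (rule bounded_subset[OF bounded_cball[of 0 1]]) (auto simp: T_def)
    ultimately show ?thesis by (simp add: compact_eq_bounded_closed)
  qed
  then have "\<exists>F\<subseteq>T. finite F \<and> T \<subseteq> (\<Union>w0\<in>F. ball w0 (\<sigma> w0))"
  proof (rule compactE_image[of T T "\<lambda>w0. ball w0 (\<sigma> w0)"])
    show "T \<subseteq> (\<Union>w0\<in>T. ball w0 (\<sigma> w0))"
    proof
      fix w assume "w \<in> T"
      then have "w \<in> ball w (\<sigma> w)" using \<sigma>0 by simp
      then show "w \<in> (\<Union>w0\<in>T. ball w0 (\<sigma> w0))" using \<open>w \<in> T\<close> by blast
    qed
  qed auto
  then obtain F where F: "F \<subseteq> T" "finite F" "T \<subseteq> (\<Union>w0\<in>F. ball w0 (\<sigma> w0))" by blast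
  define s0 where "s0 = Min (insert 0 (s1 ` F))"
  define N0 where "N0 = Max (insert 0 (M0 ` F))"
  have s0: "s0 \<le> 0" "\<And>w0. w0 \<in> F \<Longrightarrow> s0 \<le> s1 w0" using F(2) by (auto simp: s0_def)
  have N0: "0 \<le> N0" "\<And>w0. w0 \<in> F \<Longrightarrow> M0 w0 \<le> N0" using F(2) by (auto simp: N0_def)
  have C0: "\<And>w0. w0 \<in> F \<Longrightarrow> 0 \<le> C w0"
    using good[THEN conjunct2, THEN conjunct1] F(1) by (meson subsetD)
  show thesis
  proof (rule that[of "\<Sum>w0\<in>F. C w0" s0 N0])
    show "0 \<le> (\<Sum>w0\<in>F. C w0)" using C0 by (rule sum_nonneg)
    fix s M assume s: "s \<le> s0" and M: "N0 \<le> M"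
    let ?A = "{z. exp s / 3 \<le> norm z \<and> norm z \<le> exp s \<and> u z < \<mu> * s - M}"
    have opS: "?S w0 r s M \<in> sets lborel" for w0 r
    proof -
      have "?S w0 r s M = ball (of_real (exp s) *s w0) (r * exp s) \<inter> {z. 0 < norm z \<and> norm z < 2 \<and> u z < \<mu> * s - M}"
        by (auto simp: dist_commute)
      moreover have "open (ball (of_real (exp s) *s w0) (r * exp s) \<inter> {z. 0 < norm z \<and> norm z < 2 \<and> u z < \<mu> * s - M})"
        by (rule open_Int[OF open_ball open_sublevel])
      ultimately show ?thesis by (simp only: borel_open sets_lborel)
    qed
    have "?A \<subseteq> (\<Union>w0\<in>F. ?S w0 (\<sigma> w0) s M)"
    proof
      fix z assume "z \<in> ?A"
      then have z: "exp s / 3 \<le> norm z" "norm z \<le> exp s" "u z < \<mu> * s - M" by auto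
      define w where "w = complex_of_real (exp (- s)) *s z"
      have nw: "norm w = exp (- s) * norm z" unfolding w_def norm_vector_scalar by simp
      have zw: "z = of_real (exp s) *s w"
        unfolding w_def vector_smult_assoc of_real_mult[symmetric] exp_add[symmetric] by simp
      have "w \<in> T"
      proof -
        have "exp (- s) * (exp s / 3) \<le> norm w" unfolding nw using z(1) by (intro mult_left_mono) auto
        moreover have "norm w \<le> exp (- s) * exp s" unfolding nw using z(2) by (intro mult_left_mono) auto
        ultimately show ?thesis unfolding T_def by (simp add: exp_minus)
      qed
      then obtain w0 where w0: "w0 \<in> F" "w \<in> ball w0 (\<sigma> w0)" using F(3) by blast
      have "z - of_real (exp s) *s w0 = of_real (exp s) *s (w - w0)" unfolding zw by (simp add: vec_eq_iff algebra_simps)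
      then have "dist z (of_real (exp s) *s w0) = exp s * norm (w - w0)"
        unfolding dist_norm by (simp only: norm_vector_scalar) simp
      also have "\<dots> < exp s * \<sigma> w0" using w0(2) by (simp add: dist_norm norm_minus_commute)
      finally have d: "dist z (of_real (exp s) *s w0) < \<sigma> w0 * exp s" by (simp add: mult.commute)
      have "0 < exp s / 3" "exp s \<le> 1" using s s0(1) by auto
      then have "0 < norm z" "norm z < 2" using z by linarith+
      then show "z \<in> (\<Union>w0\<in>F. ?S w0 (\<sigma> w0) s M)" using w0(1) d z(3) by blast
    qed
    then have "emeasure lborel ?A \<le> emeasure lborel (\<Union>w0\<in>F. ?S w0 (\<sigma> w0) s M)"
      by (rule emeasure_mono[OF _ sets.finite_UN[OF F(2) opS]])
    also have "\<dots> \<le> (\<Sum>w0\<in>F. emeasure lborel (?S w0 (\<sigma> w0) s M))"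
      by (rule emeasure_subadditive_finite[OF F(2)]) (rule image_subsetI, rule opS)
    also have "\<dots> \<le> (\<Sum>w0\<in>F. ennreal (C w0 * exp (2 * real CARD('n) * s - B * M)))"
    proof (rule sum_mono)
      fix w0 assume w0: "w0 \<in> F"
      have "s \<le> s1 w0" "M0 w0 \<le> M" using s0(2)[OF w0] N0(2)[OF w0] s M by auto
      then show "emeasure lborel (?S w0 (\<sigma> w0) s M) \<le> ennreal (C w0 * exp (2 * real CARD('n) * s - B * M))"
        using good[THEN conjunct2, THEN conjunct2, rule_format, of w0 s M] subsetD[OF F(1) w0] by (simp only: simp_thms)
    qed
    also have "\<dots> = ennreal ((\<Sum>w0\<in>F. C w0) * exp (2 * real CARD('n) * s - B * M))"
      unfolding sum_distrib_right using C0 by (intro sum_ennreal) auto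
    finally show "emeasure lborel ?A \<le> ennreal ((\<Sum>w0\<in>F. C w0) * exp (2 * real CARD('n) * s - B * M))" .
  qed (use s0 N0 in auto)
qed

text \<open>The shell is split into the part where \<open>u \<ge> \<mu> s - M0\<close> and the levels between
  \<open>\<mu> s - M0 - j - 1\<close> and \<open>\<mu> s - M0 - j\<close>. The rate \<open>B = 2 c + 1\<close> beats the growth \<open>e^(2 c j)\<close> of the
  integrand by \<open>e^(-j)\<close>.\<close>
lemma shell_integral_estimate:
  fixes t c :: real
  assumes \<mu>: "\<nu> < \<mu>" and c: "0 < c"
  obtains D s1 where "0 \<le> D" "s1 \<le> 0"
    "\<And>s. s \<le> s1 \<Longrightarrow>
      (\<integral>\<^sup>+z. indicator {z. exp s / 3 \<le> norm z \<and> norm z \<le> exp s} z * ennreal (norm z powr (2 * t) * exp (- 2 * c * u z)) \<partial>lborel)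
       \<le> ennreal (D * exp (2 * (t + real CARD('n) - c * \<mu>) * s))"
proof -
  let ?n = "real CARD('n)"
  define B where "B = 2 * c + 1"
  have B: "0 < B" using c by (simp add: B_def)
  obtain C s1 M0 where est: "0 \<le> C" "s1 \<le> 0" "0 \<le> M0"
    "\<And>s M. s \<le> s1 \<Longrightarrow> M0 \<le> M \<Longrightarrow>
      emeasure lborel {z. exp s / 3 \<le> norm z \<and> norm z \<le> exp s \<and> u z < \<mu> * s - M}
        \<le> ennreal (C * exp (2 * ?n * s - B * M))"
    by (rule shell_volume_estimate[OF \<mu> B]) (rule that; assumption)
  define V where "V = measure lborel (cball (0::complex^'n) 1)"
  define G where "G = (\<Sum>j. exp (- 1) ^ j :: real)"
  have sumG: "summable (\<lambda>j. exp (- 1) ^ j :: real)" by (rule summable_geometric) simp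
  have G0: "0 \<le> G" unfolding G_def by (rule suminf_nonneg[OF sumG]) simp
  define D where "D = exp (4 * \<bar>t\<bar>) * (exp (2 * c * M0) * V + exp (2 * c) * C * G)"
  have V0: "0 \<le> V" by (simp add: V_def)
  have D0: "0 \<le> D" using V0 G0 est(1) by (simp add: D_def add_nonneg_nonneg)
  show thesis
  proof (rule that[OF D0 est(2)])
    fix s assume s: "s \<le> s1"
    define A where "A = {z::complex^'n. exp s / 3 \<le> norm z \<and> norm z \<le> exp s}"
    define E where "E = (\<lambda>j::nat. {z. exp s / 3 \<le> norm z \<and> norm z \<le> exp s \<and> u z < \<mu> * s - (M0 + real j)})"
    define p where "p = exp (2 * t * s + 4 * \<bar>t\<bar>)"
    define q0 where "q0 = exp (- 2 * c * (\<mu> * s - M0))"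
    define q where "q = (\<lambda>j::nat. exp (- 2 * c * (\<mu> * s - (M0 + real j + 1))))"
    have As: "A \<in> sets borel"
    proof -
      have "closed A" unfolding A_def by (intro closed_Collect_conj closed_Collect_le continuous_intros)
      then show ?thesis by simp
    qed
    have AG: "0 < norm z \<and> norm z < 2" if "z \<in> A" for z
    proof -
      have "0 < exp s / 3" "exp s \<le> 1" using s est(2) by auto
      then show ?thesis using that unfolding A_def mem_Collect_eq by linarith
    qed
    have Es: "E j \<in> sets borel" for j
    proof -
      have "E j = A \<inter> {z. 0 < norm z \<and> norm z < 2 \<and> u z < \<mu> * s - (M0 + real j)}"
        using AG by (auto simp: E_def A_def)
      moreover have "A \<inter> {z. 0 < norm z \<and> norm z < 2 \<and> u z < \<mu> * s - (M0 + real j)} \<in> sets borel"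
        by (rule sets.Int[OF As borel_open[OF open_sublevel]])
      ultimately show ?thesis by simp
    qed
    have pq: "0 \<le> p" "0 \<le> q0" "\<And>j. 0 \<le> q j" by (simp_all add: p_def q0_def q_def)
    have point: "indicator A z * ennreal (norm z powr (2 * t) * exp (- 2 * c * u z))
        \<le> ennreal (p * q0) * indicator A z + (\<Sum>j. ennreal (p * q j) * indicator (E j) z)" for z
    proof (cases "z \<in> A")
      case False
      then show ?thesis by simp
    next
      case True
      then have z: "exp s / 3 \<le> norm z" "norm z \<le> exp s" by (auto simp: A_def)
      have z0: "0 < norm z" using AG[OF True] by blast
      have lnz: "s - 2 \<le> ln (norm z)" "ln (norm z) \<le> s"
      proof -
        have "(3::real) \<le> exp 2" using exp_ge_add_one_self[of "2::real"] by simp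
        then have "exp (s - 2) \<le> exp s / 3" unfolding exp_diff by (intro divide_left_mono) auto
        then have "exp (s - 2) \<le> norm z" using z(1) by linarith
        then show "s - 2 \<le> ln (norm z)" using z0 by (subst ln_ge_iff) auto
        show "ln (norm z) \<le> s" using z(2) z0 ln_le_cancel_iff[of "norm z" "exp s"] by simp
      qed
      have "2 * t * ln (norm z) \<le> 2 * t * s + 4 * \<bar>t\<bar>"
      proof -
        have "2 * t * (ln (norm z) - s) \<le> \<bar>2 * t * (ln (norm z) - s)\<bar>" by (rule abs_ge_self)
        also have "\<dots> = 2 * \<bar>t\<bar> * \<bar>ln (norm z) - s\<bar>" by (simp add: abs_mult)
        also have "\<dots> \<le> 2 * \<bar>t\<bar> * 2" using lnz by (intro mult_left_mono) auto
        finally show ?thesis by (simp add: algebra_simps)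
      qed
      then have pw: "norm z powr (2 * t) \<le> p" using z0 by (simp add: powr_def p_def)
      show ?thesis
      proof (cases "\<mu> * s - M0 \<le> u z")
        case ge: True
        have "c * (\<mu> * s - M0) \<le> c * u z" using ge c by (intro mult_left_mono) auto
        then have "exp (- 2 * c * u z) \<le> q0" by (simp add: q0_def algebra_simps)
        then have "norm z powr (2 * t) * exp (- 2 * c * u z) \<le> p * q0" using pw pq by (intro mult_mono) auto
        then have "indicator A z * ennreal (norm z powr (2 * t) * exp (- 2 * c * u z)) \<le> ennreal (p * q0) * indicator A z"
          using True by (simp add: ennreal_leI)
        then show ?thesis by (rule order_trans) simp
      next
        case False
        define v where "v = \<mu> * s - M0 - u z"
        have v: "0 < v" using False by (simp add: v_def)
        define j where "j = nat (\<lceil>v\<rceil> - 1)"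
        have j: "real j < v" "v \<le> real j + 1"
        proof -
          have "1 \<le> \<lceil>v\<rceil>" using v by (simp add: one_le_ceiling)
          then have "real j = of_int (\<lceil>v\<rceil>) - 1" by (simp add: j_def)
          then show "real j < v" "v \<le> real j + 1" by linarith+
        qed
        have zE: "z \<in> E j" using z j(1) by (simp add: E_def v_def)
        have "\<mu> * s - (M0 + real j + 1) \<le> u z" using j(2) by (simp add: v_def)
        then have "c * (\<mu> * s - (M0 + real j + 1)) \<le> c * u z" using c by (intro mult_left_mono) auto
        then have "exp (- 2 * c * u z) \<le> q j" by (simp add: q_def algebra_simps)
        then have "norm z powr (2 * t) * exp (- 2 * c * u z) \<le> p * q j" using pw pq by (intro mult_mono) auto
        then have "indicator A z * ennreal (norm z powr (2 * t) * exp (- 2 * c * u z)) \<le> ennreal (p * q j) * indicator (E j) z"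
          using True zE by (simp add: ennreal_leI)
        also have "\<dots> \<le> (\<Sum>i. ennreal (p * q i) * indicator (E i) z)"
          by (rule term_le_suminf_ennreal[of "\<lambda>i. ennreal (p * q i) * indicator (E i) z"])
        finally show ?thesis by (rule order_trans) simp
      qed
    qed
    have Am: "A \<in> sets lborel" and Em: "\<And>j. E j \<in> sets lborel" using As Es by simp_all
    have mA: "(\<lambda>z. ennreal (p * q0) * indicator A z) \<in> borel_measurable lborel"
      by (intro borel_measurable_times_ennreal borel_measurable_const borel_measurable_indicator Am)
    have mE: "(\<lambda>z. ennreal (p * q j) * indicator (E j) z) \<in> borel_measurable lborel" for j
      by (intro borel_measurable_times_ennreal borel_measurable_const borel_measurable_indicator Em)
    have mS: "(\<lambda>z. \<Sum>j. ennreal (p * q j) * indicator (E j) z) \<in> borel_measurable lborel"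
      by (intro borel_measurable_suminf_order mE)
    have "(\<integral>\<^sup>+z. indicator A z * ennreal (norm z powr (2 * t) * exp (- 2 * c * u z)) \<partial>lborel)
        \<le> (\<integral>\<^sup>+z. ennreal (p * q0) * indicator A z + (\<Sum>j. ennreal (p * q j) * indicator (E j) z) \<partial>lborel)"
      by (intro nn_integral_mono point)
    also have "\<dots> = ennreal (p * q0) * emeasure lborel A + (\<Sum>j. ennreal (p * q j) * emeasure lborel (E j))"
      unfolding nn_integral_add[OF mA mS] nn_integral_suminf[OF mE]
        nn_integral_cmult_indicator[OF Am] nn_integral_cmult_indicator[OF Em] ..
    also have "\<dots> \<le> ennreal (p * q0 * (exp (2 * ?n * s) * V)) + (\<Sum>j. ennreal (p * q j * (C * exp (2 * ?n * s - B * (M0 + real j)))))"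
    proof (rule add_mono)
      have "emeasure lborel A \<le> ennreal (exp (2 * ?n * s) * V)"
      proof -
        have c0: "complex_of_real (exp s) \<noteq> 0" by simp
        have "A \<subseteq> cball 0 (exp s)" by (auto simp: A_def)
        then have "emeasure lborel A \<le> emeasure lborel (cball (0::complex^'n) (exp s))" by (intro emeasure_mono) auto
        also have "\<dots> = ennreal (norm (complex_of_real (exp s)) ^ (2 * CARD('n))) * emeasure lborel ((\<lambda>y. 0 + complex_of_real (exp s) *s y) -` cball (0::complex^'n) (exp s))"
          by (rule emeasure_lborel_vector_scalar_vimage[OF _ c0]) simp
        also have "(\<lambda>y. 0 + complex_of_real (exp s) *s y) -` cball (0::complex^'n) (exp s) = cball 0 1"
        proof -
          have "exp s * norm y \<le> exp s \<longleftrightarrow> norm y \<le> 1" for y :: "complex^'n"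
            using mult_le_cancel_left_pos[of "exp s" "norm y" 1] by simp
          then show ?thesis by auto
        qed
        also have "norm (complex_of_real (exp s)) ^ (2 * CARD('n)) = exp (2 * ?n * s)"
          by (simp add: exp_of_nat_mult[symmetric])
        also have "emeasure lborel (cball (0::complex^'n) 1) = ennreal V"
          unfolding V_def using emeasure_lborel_cball_finite[of "0::complex^'n" 1] by (intro emeasure_eq_ennreal_measure) simp
        finally show ?thesis using V0 by (simp add: ennreal_mult)
      qed
      then have "ennreal (p * q0) * emeasure lborel A \<le> ennreal (p * q0) * ennreal (exp (2 * ?n * s) * V)"
        by (rule mult_left_mono) simp
      also have "\<dots> = ennreal (p * q0 * (exp (2 * ?n * s) * V))"
        using pq V0 by (intro ennreal_mult[symmetric]) auto
      finally show "ennreal (p * q0) * emeasure lborel A \<le> ennreal (p * q0 * (exp (2 * ?n * s) * V))" .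
      have "ennreal (p * q j) * emeasure lborel (E j) \<le> ennreal (p * q j * (C * exp (2 * ?n * s - B * (M0 + real j))))" for j
      proof -
        have "emeasure lborel (E j) \<le> ennreal (C * exp (2 * ?n * s - B * (M0 + real j)))"
          unfolding E_def by (rule est(4)[OF s]) simp
        then have "ennreal (p * q j) * emeasure lborel (E j) \<le> ennreal (p * q j) * ennreal (C * exp (2 * ?n * s - B * (M0 + real j)))"
          by (rule mult_left_mono) simp
        also have "\<dots> = ennreal (p * q j * (C * exp (2 * ?n * s - B * (M0 + real j))))"
          using pq est(1) by (intro ennreal_mult[symmetric]) auto
        finally show ?thesis .
      qed
      then show "(\<Sum>j. ennreal (p * q j) * emeasure lborel (E j)) \<le> (\<Sum>j. ennreal (p * q j * (C * exp (2 * ?n * s - B * (M0 + real j)))))"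
        by (intro suminf_le) auto
    qed
    also have "\<dots> \<le> ennreal (p * q0 * (exp (2 * ?n * s) * V)) + (\<Sum>j. ennreal (p * exp (- 2 * c * \<mu> * s + 2 * ?n * s + 2 * c) * C * exp (- 1) ^ j))"
    proof (intro add_left_mono suminf_le ennreal_leI)
      fix j :: nat
      have ex: "q j * exp (2 * ?n * s - B * (M0 + real j)) = exp (- 2 * c * \<mu> * s + 2 * ?n * s + 2 * c) * exp (- M0 - real j)"
        unfolding q_def exp_add[symmetric] by (simp add: B_def algebra_simps)
      have "exp (- M0 - real j) \<le> exp (- real j)" using est(3) by simp
      also have "\<dots> = exp (- 1) ^ j" by (simp add: exp_of_nat_mult[symmetric])
      finally have ej: "exp (- M0 - real j) \<le> exp (- 1) ^ j" .
      have "p * q j * (C * exp (2 * ?n * s - B * (M0 + real j))) = p * C * (q j * exp (2 * ?n * s - B * (M0 + real j)))"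
        by (simp only: mult_ac)
      also have "\<dots> = (p * exp (- 2 * c * \<mu> * s + 2 * ?n * s + 2 * c) * C) * exp (- M0 - real j)"
        unfolding ex by (simp only: mult_ac)
      also have "\<dots> \<le> (p * exp (- 2 * c * \<mu> * s + 2 * ?n * s + 2 * c) * C) * exp (- 1) ^ j"
        using ej pq(1) est(1) by (intro mult_left_mono) auto
      finally show "p * q j * (C * exp (2 * ?n * s - B * (M0 + real j))) \<le> p * exp (- 2 * c * \<mu> * s + 2 * ?n * s + 2 * c) * C * exp (- 1) ^ j" .
    qed auto
    also have "(\<Sum>j. ennreal (p * exp (- 2 * c * \<mu> * s + 2 * ?n * s + 2 * c) * C * exp (- 1) ^ j))
        = ennreal (p * exp (- 2 * c * \<mu> * s + 2 * ?n * s + 2 * c) * C * G)"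
    proof -
      have "(\<Sum>j. ennreal (p * exp (- 2 * c * \<mu> * s + 2 * ?n * s + 2 * c) * C * exp (- 1) ^ j))
        = ennreal (\<Sum>j. p * exp (- 2 * c * \<mu> * s + 2 * ?n * s + 2 * c) * C * exp (- 1) ^ j)"
        using pq(1) est(1) by (intro suminf_ennreal2 summable_mult sumG) auto
      then show ?thesis unfolding G_def by (simp only: suminf_mult[OF sumG])
    qed
    also have "ennreal (p * q0 * (exp (2 * ?n * s) * V)) + ennreal (p * exp (- 2 * c * \<mu> * s + 2 * ?n * s + 2 * c) * C * G)
        = ennreal (p * q0 * (exp (2 * ?n * s) * V) + p * exp (- 2 * c * \<mu> * s + 2 * ?n * s + 2 * c) * C * G)"
      using pq V0 est(1) G0 by (intro ennreal_plus[symmetric]) auto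
    also have "p * q0 * (exp (2 * ?n * s) * V) + p * exp (- 2 * c * \<mu> * s + 2 * ?n * s + 2 * c) * C * G
        = D * exp (2 * (t + ?n - c * \<mu>) * s)"
    proof -
      define X where "X = exp (2 * (t + ?n - c * \<mu>) * s)"
      have "p * q0 * exp (2 * ?n * s) = exp (4 * \<bar>t\<bar>) * exp (2 * c * M0) * X"
        unfolding p_def q0_def X_def exp_add[symmetric] by (simp add: algebra_simps)
      moreover have "p * exp (- 2 * c * \<mu> * s + 2 * ?n * s + 2 * c) = exp (4 * \<bar>t\<bar>) * exp (2 * c) * X"
        unfolding p_def X_def exp_add[symmetric] by (simp add: algebra_simps)
      ultimately show ?thesis unfolding D_def X_def[symmetric] mult.assoc[symmetric] by (simp add: algebra_simps)
    qed
    finally show "(\<integral>\<^sup>+z. indicator {z. exp s / 3 \<le> norm z \<and> norm z \<le> exp s} z * ennreal (norm z powr (2 * t) * exp (- 2 * c * u z)) \<partial>lborel)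
       \<le> ennreal (D * exp (2 * (t + ?n - c * \<mu>) * s))" unfolding A_def .
  qed
qed

text \<open>The choice \<open>c \<mu> < t + n\<close> makes the shell integrals decay geometrically. The shells of ratio 3 with outer
  radii \<open>e^(s1 - k)\<close> cover a punctured ball because \<open>e < 3\<close>.\<close>
lemma integrable_near_0:
  fixes t c :: real
  assumes c: "0 < c" and small: "c * \<nu> < t + real CARD('n)"
  shows "\<exists>\<delta>>0. \<delta> \<le> 1 \<and> (\<integral>\<^sup>+z. indicator (ball 0 \<delta>) z * ennreal (norm z powr (2 * t) * exp (- 2 * c * u z)) \<partial>lborel) < \<infinity>"
proof -
  let ?n = "real CARD('n)"
  have "\<nu> < (t + ?n) / c" using small c by (simp add: pos_less_divide_eq mult.commute)
  then obtain \<mu> where \<mu>: "\<nu> < \<mu>" "\<mu> < (t + ?n) / c" using dense by blast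
  define \<gamma> where "\<gamma> = 2 * (t + ?n - c * \<mu>)"
  have \<gamma>: "0 < \<gamma>" using \<mu>(2) c by (simp add: \<gamma>_def pos_less_divide_eq mult.commute)
  define f where "f = (\<lambda>z. ennreal (norm z powr (2 * t) * exp (- 2 * c * u z)))"
  define A where "A = (\<lambda>s. {z::complex^'n. exp s / 3 \<le> norm z \<and> norm z \<le> exp s})"
  obtain D s1 where D: "0 \<le> D" "s1 \<le> 0"
    "\<And>s. s \<le> s1 \<Longrightarrow> (\<integral>\<^sup>+z. indicator (A s) z * f z \<partial>lborel) \<le> ennreal (D * exp (\<gamma> * s))"
  proof (rule shell_integral_estimate[OF \<mu>(1) c, of t])
    fix D s1 assume D: "0 \<le> D" "s1 \<le> 0" "\<And>s. s \<le> s1 \<Longrightarrow>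
      (\<integral>\<^sup>+z. indicator {z. exp s / 3 \<le> norm z \<and> norm z \<le> exp s} z * ennreal (norm z powr (2 * t) * exp (- 2 * c * u z)) \<partial>lborel)
       \<le> ennreal (D * exp (2 * (t + ?n - c * \<mu>) * s))"
    show thesis
      by (rule that[OF D(1,2)]) (simp only: A_def f_def \<gamma>_def, rule D(3))
  qed
  have point: "indicator (ball 0 (exp s1)) z * f z \<le> (\<Sum>k. indicator (A (s1 - real k)) z * f z)" for z
  proof (cases "0 < norm z \<and> norm z < exp s1")
    case False
    then have "indicator (ball 0 (exp s1)) z * f z = 0" by (auto simp: f_def indicator_def)
    then show ?thesis by (rule ord_eq_le_trans) simp
  next
    case True
    have el: "exp (ln (norm z)) = norm z" using True by simp
    define x where "x = s1 - ln (norm z)"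
    have "ln (norm z) < s1" using True ln_less_cancel_iff[of "norm z" "exp s1"] by simp
    then have x: "0 < x" by (simp add: x_def)
    define k where "k = nat \<lfloor>x\<rfloor>"
    have "0 \<le> \<lfloor>x\<rfloor>" using x by simp
    then have "real k = of_int \<lfloor>x\<rfloor>" by (simp add: k_def)
    then have k: "real k \<le> x" "x < real k + 1" by linarith+
    have "ln (norm z) \<le> s1 - real k" using k(1) by (simp add: x_def)
    then have "exp (ln (norm z)) \<le> exp (s1 - real k)" by simp
    then have 1: "norm z \<le> exp (s1 - real k)" unfolding el .
    have "(s1 - real k) - 1 \<le> ln (norm z)" using k(2) by (simp add: x_def)
    then have "exp ((s1 - real k) - 1) \<le> exp (ln (norm z))" by simp
    then have "exp ((s1 - real k) - 1) \<le> norm z" unfolding el .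
    moreover have "exp (s1 - real k) / 3 \<le> exp ((s1 - real k) - 1)"
      unfolding exp_diff[of "s1 - real k"] using exp_le by (intro divide_left_mono) auto
    ultimately have "z \<in> A (s1 - real k)" using 1 by (simp add: A_def)
    then have "indicator (ball 0 (exp s1)) z * f z \<le> indicator (A (s1 - real k)) z * f z"
      by (simp add: indicator_def)
    also have "\<dots> \<le> (\<Sum>k. indicator (A (s1 - real k)) z * f z)"
      by (rule term_le_suminf_ennreal[of "\<lambda>k. indicator (A (s1 - real k)) z * f z"])
    finally show ?thesis .
  qed
  have fm: "(\<lambda>z. indicator (A (s1 - real k)) z * f z) \<in> borel_measurable lborel" for k
  proof -
    have AG: "A (s1 - real k) \<subseteq> punctured_ball"
    proof
      fix z assume "z \<in> A (s1 - real k)"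
      moreover have "0 < exp (s1 - real k) / 3" "exp (s1 - real k) \<le> 1" using D(2) by auto
      ultimately show "z \<in> punctured_ball" unfolding A_def mem_Collect_eq by linarith
    qed
    have As: "A (s1 - real k) \<in> sets borel"
    proof -
      have "closed (A (s1 - real k))" unfolding A_def by (intro closed_Collect_conj closed_Collect_le continuous_intros)
      then show ?thesis by simp
    qed
    have um: "(\<lambda>z. indicator punctured_ball z * u z) \<in> borel_measurable borel"
      by (rule usc_real_on_borel_measurable[OF open_punctured_ball usc])
    have "(\<lambda>z. indicator (A (s1 - real k)) z * f z)
        = (\<lambda>z. indicator (A (s1 - real k)) z * ennreal (norm z powr (2 * t) * exp (- 2 * c * (indicator punctured_ball z * u z))))"
      using AG by (auto simp: f_def fun_eq_iff indicator_def)
    moreover have "(\<lambda>z. indicator (A (s1 - real k)) z * ennreal (norm z powr (2 * t) * exp (- 2 * c * (indicator punctured_ball z * u z)))) \<in> borel_measurable borel"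
      using As um by measurable
    ultimately show ?thesis by simp
  qed
  have "(\<integral>\<^sup>+z. indicator (ball 0 (exp s1)) z * f z \<partial>lborel) \<le> (\<integral>\<^sup>+z. (\<Sum>k. indicator (A (s1 - real k)) z * f z) \<partial>lborel)"
    by (intro nn_integral_mono point)
  also have "\<dots> = (\<Sum>k. \<integral>\<^sup>+z. indicator (A (s1 - real k)) z * f z \<partial>lborel)"
    by (rule nn_integral_suminf[OF fm])
  also have "\<dots> \<le> (\<Sum>k. ennreal (D * exp (\<gamma> * s1) * exp (- \<gamma>) ^ k))"
  proof (intro suminf_le)
    fix k :: nat
    have "(\<integral>\<^sup>+z. indicator (A (s1 - real k)) z * f z \<partial>lborel) \<le> ennreal (D * exp (\<gamma> * (s1 - real k)))"
      by (rule D(3)) simp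
    also have "exp (\<gamma> * (s1 - real k)) = exp (\<gamma> * s1) * exp (- \<gamma>) ^ k"
      by (simp add: exp_of_nat_mult[symmetric] exp_add[symmetric] algebra_simps)
    finally show "(\<integral>\<^sup>+z. indicator (A (s1 - real k)) z * f z \<partial>lborel) \<le> ennreal (D * exp (\<gamma> * s1) * exp (- \<gamma>) ^ k)"
      by (simp only: mult.assoc)
  qed auto
  also have "\<dots> = ennreal (\<Sum>k. D * exp (\<gamma> * s1) * exp (- \<gamma>) ^ k)"
    using D(1) \<gamma> by (intro suminf_ennreal2 summable_mult summable_geometric) auto
  also have "\<dots> < \<infinity>" by simp
  finally have "(\<integral>\<^sup>+z. indicator (ball 0 (exp s1)) z * f z \<partial>lborel) < \<infinity>" .
  moreover have "0 < exp s1" "exp s1 \<le> 1" using D(2) by simp_all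
  ultimately show ?thesis unfolding f_def by blast
qed

end

section \<open>The integrability threshold\<close>

text \<open>By scaling, every dyadic shell contributes the same positive amount.\<close>
lemma nn_integral_norm_power_diverges:
  assumes \<delta>: "0 < \<delta>"
  shows "(\<integral>\<^sup>+z. indicator (ball 0 \<delta>) z * ennreal (norm (z::complex^'n) powr (- 2 * real CARD('n))) \<partial>lborel) = \<infinity>"
proof -
  let ?n = "real CARD('n)"
  define A where "A = (\<lambda>r. {z::complex^'n. r / 2 < norm z \<and> norm z < r})"
  have oA: "open (A r)" for r unfolding A_def by (intro open_Collect_conj open_Collect_less continuous_intros)
  have Am: "A r \<in> sets lborel" for r using oA by simp
  define V where "V = measure lborel (A 1)"
  have eV: "emeasure lborel (A 1) = ennreal V"
  proof -
    have "emeasure lborel (A 1) \<le> emeasure lborel (ball (0::complex^'n) 1)" by (intro emeasure_mono) (auto simp: A_def)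
    also have "\<dots> < \<infinity>" by (rule emeasure_lborel_ball_finite)
    finally show ?thesis unfolding V_def by (simp add: emeasure_eq_ennreal_measure)
  qed
  have V0: "0 < V"
  proof -
    obtain p :: "complex^'n" where np: "norm p = 3 / 4" by (rule vector_choose_size[of "3 / 4"]) auto
    have "p \<in> A 1" unfolding A_def using np by simp
    then obtain e where e: "0 < e" "ball p e \<subseteq> A 1" using oA open_contains_ball by blast
    have "measure lborel (ball p e) \<le> V"
      unfolding V_def using eV oA by (intro measure_mono_fmeasurable e(2)) (auto simp: fmeasurable_def)
    then show ?thesis using content_ball_pos[OF e(1), of p] by linarith
  qed
  define r where "r = (\<lambda>k::nat. \<delta> * (1 / 2) ^ k)"
  have r0: "0 < r k" for k using \<delta> by (simp add: r_def)
  have scale: "ennreal (r k powr (- 2 * ?n)) * emeasure lborel (A (r k)) = ennreal V" for k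
  proof -
    have c: "complex_of_real (r k) \<noteq> 0" using r0[of k] by simp
    have "emeasure lborel (A (r k)) = ennreal (norm (complex_of_real (r k)) ^ (2 * CARD('n))) * emeasure lborel ((\<lambda>y. 0 + complex_of_real (r k) *s y) -` A (r k))"
      by (rule emeasure_lborel_vector_scalar_vimage[OF _ c]) (use oA in simp)
    also have "(\<lambda>y. 0 + complex_of_real (r k) *s y) -` A (r k) = A 1"
      using r0[of k] by (auto simp: A_def field_simps)
    also have "norm (complex_of_real (r k)) ^ (2 * CARD('n)) = r k powr (2 * ?n)"
      using r0[of k] by (simp add: powr_realpow[symmetric])
    finally have "ennreal (r k powr (- 2 * ?n)) * emeasure lborel (A (r k)) = (ennreal (r k powr (- 2 * ?n)) * ennreal (r k powr (2 * ?n))) * ennreal V"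
      by (simp only: eV mult.assoc)
    also have "ennreal (r k powr (- 2 * ?n)) * ennreal (r k powr (2 * ?n)) = 1"
      using r0[of k] by (subst ennreal_mult[symmetric]) (auto simp: powr_add[symmetric])
    finally show ?thesis by simp
  qed
  have disj: "disjoint_family (\<lambda>k. A (r k))"
  proof -
    have "A (r j) \<inter> A (r k) = {}" if "j < k" for j k
    proof -
      have "(1 / 2 :: real) ^ k \<le> (1 / 2) ^ Suc j" using that by (intro power_decreasing) auto
      then have "r k \<le> r j / 2" using \<delta> by (simp add: r_def)
      then show ?thesis by (auto simp: A_def)
    qed
    then show ?thesis unfolding disjoint_family_on_def by (metis Int_commute linorder_neqE_nat)
  qed
  have point: "(\<Sum>k. ennreal (r k powr (- 2 * ?n)) * indicator (A (r k)) z) \<le> indicator (ball 0 \<delta>) z * ennreal (norm z powr (- 2 * ?n))" for z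
  proof (cases "\<exists>k. z \<in> A (r k)")
    case False
    then show ?thesis by simp
  next
    case True
    then obtain k where k: "z \<in> A (r k)" by blast
    have "(\<Sum>j. ennreal (r j powr (- 2 * ?n)) * indicator (A (r j)) z) = (\<Sum>j\<in>{k}. ennreal (r j powr (- 2 * ?n)) * indicator (A (r j)) z)"
    proof (rule suminf_finite)
      fix j assume "j \<notin> {k}"
      then have "z \<notin> A (r j)" using disj k unfolding disjoint_family_on_def by blast
      then show "ennreal (r j powr (- 2 * ?n)) * indicator (A (r j)) z = 0" by simp
    qed simp
    also have "\<dots> = ennreal (r k powr (- 2 * ?n))" using k by simp
    also have "\<dots> \<le> ennreal (norm z powr (- 2 * ?n))"
    proof (intro ennreal_leI powr_mono2')
      show "norm z \<le> r k" "0 < norm z" using k r0[of k] unfolding A_def mem_Collect_eq by linarith+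
    qed simp
    also have "\<dots> = indicator (ball 0 \<delta>) z * ennreal (norm z powr (- 2 * ?n))"
    proof -
      have "r k \<le> \<delta>" using \<delta> by (simp add: r_def mult_left_le power_le_one)
      then have "z \<in> ball 0 \<delta>" using k by (auto simp: A_def)
      then show ?thesis by simp
    qed
    finally show ?thesis .
  qed
  have m: "(\<lambda>z. ennreal (r k powr (- 2 * ?n)) * indicator (A (r k)) z) \<in> borel_measurable lborel" for k
    by (intro borel_measurable_times_ennreal borel_measurable_const borel_measurable_indicator Am)
  have "(\<Sum>k::nat. ennreal V) = (\<Sum>k. ennreal (r k powr (- 2 * ?n)) * emeasure lborel (A (r k)))"
    by (simp only: scale)
  also have "\<dots> = (\<integral>\<^sup>+z. (\<Sum>k. ennreal (r k powr (- 2 * ?n)) * indicator (A (r k)) z) \<partial>lborel)"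
    unfolding nn_integral_suminf[OF m] nn_integral_cmult_indicator[OF Am] ..
  also have "\<dots> \<le> (\<integral>\<^sup>+z. indicator (ball 0 \<delta>) z * ennreal (norm (z::complex^'n) powr (- 2 * ?n)) \<partial>lborel)"
    by (rule nn_integral_mono) (rule point)
  finally have le: "(\<Sum>k::nat. ennreal V) \<le> (\<integral>\<^sup>+z. indicator (ball 0 \<delta>) z * ennreal (norm (z::complex^'n) powr (- 2 * ?n)) \<partial>lborel)" .
  have "(\<Sum>k::nat. ennreal V) = \<infinity>"
  proof (rule ccontr)
    assume "(\<Sum>k::nat. ennreal V) \<noteq> \<infinity>"
    then have "summable (\<lambda>k::nat. V)" using V0 by (intro summable_suminf_not_top) auto
    then show False using V0 summable_const_iff[of V] by simp
  qed
  then show ?thesis using le by (simp add: top_unique)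
qed

text \<open>A dilation multiplies the integral by a power of \<open>r\<close>.\<close>
lemma nn_integral_scale_finite:
  fixes g :: "'a::euclidean_space \<Rightarrow> ennreal"
  assumes g: "g \<in> borel_measurable borel" and r: "0 < r" and fin: "(\<integral>\<^sup>+x. g x \<partial>lborel) < \<infinity>"
  shows "(\<integral>\<^sup>+z. g ((1 / r) *\<^sub>R z) \<partial>lborel) < \<infinity>"
proof -
  let ?T = "\<lambda>x::'a. 0 + r *\<^sub>R x"
  have eq: "(lborel :: 'a measure) = density (distr lborel borel ?T) (\<lambda>_. ennreal (\<bar>r\<bar> ^ DIM('a)))"
    by (rule lborel_affine) (use r in simp)
  have m: "(\<lambda>z. g ((1 / r) *\<^sub>R z)) \<in> borel_measurable borel"
    by (rule measurable_compose[OF _ g]) simp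
  have "(\<integral>\<^sup>+z. g ((1 / r) *\<^sub>R z) \<partial>lborel) = (\<integral>\<^sup>+z. ennreal (\<bar>r\<bar> ^ DIM('a)) * g ((1 / r) *\<^sub>R z) \<partial>distr lborel borel ?T)"
    by (subst eq, subst nn_integral_density) (use m in auto)
  also have "\<dots> = (\<integral>\<^sup>+x. ennreal (\<bar>r\<bar> ^ DIM('a)) * g x \<partial>lborel)"
    using m r by (subst nn_integral_distr) auto
  also have "\<dots> = ennreal (\<bar>r\<bar> ^ DIM('a)) * (\<integral>\<^sup>+x. g x \<partial>lborel)"
    using g by (intro nn_integral_cmult) auto
  also have "\<dots> < \<infinity>" using fin by (simp add: ennreal_mult_less_top)
  finally show ?thesis .
qed

lemma usc_on_rescaled:
  fixes \<phi> :: "complex^'n \<Rightarrow> ereal"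
  assumes usc: "usc_on \<Omega> \<phi>" and \<Omega>: "open \<Omega>"
    and sub: "\<And>z. z \<in> punctured_ball \<Longrightarrow> of_real r *s z \<in> \<Omega> \<and> \<phi> (of_real r *s z) = ereal (u z)"
  shows "usc_real_on punctured_ball u"
  unfolding usc_real_on_def
proof (intro ballI allI impI)
  fix z c assume z: "z \<in> punctured_ball" and c: "u z < c"
  have "openin (top_of_set \<Omega>) {z\<in>\<Omega>. \<phi> z < ereal c}" using usc by (simp add: usc_on_def)
  then have "open {z\<in>\<Omega>. \<phi> z < ereal c}" using \<Omega> by (simp add: openin_open_eq)
  moreover have "continuous_on UNIV (\<lambda>z. complex_of_real r *s (z::complex^'n))" by (intro continuous_intros)
  ultimately have "open ((\<lambda>z. complex_of_real r *s z) -` {z\<in>\<Omega>. \<phi> z < ereal c})" by (rule open_vimage)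
  moreover have "z \<in> (\<lambda>z. complex_of_real r *s z) -` {z\<in>\<Omega>. \<phi> z < ereal c}" using sub[OF z] c by simp
  ultimately obtain d where d: "0 < d" "\<And>y. dist y z < d \<Longrightarrow> \<phi> (of_real r *s y) < ereal c"
    unfolding open_dist by blast
  show "\<exists>d>0. \<forall>x'\<in>punctured_ball. dist x' z < d \<longrightarrow> u x' < c"
  proof (intro exI[of _ d] conjI ballI impI)
    show "0 < d" by (rule d(1))
    fix x' assume x': "x' \<in> punctured_ball" "dist x' z < d"
    show "u x' < c" using d(2)[OF x'(2)] sub[OF x'(1)] by simp
  qed
qed

text \<open>For a nonpositive function the circle mean of extended real values, a difference of two
  nonnegative integrals, has vanishing positive part and becomes an ordinary integral.\<close>
lemma circle_mean_nonpos:
  assumes eq: "\<And>\<theta>. v (c + rcis r \<theta>) = ereal (g \<theta>)" and g: "\<And>\<theta>. g \<theta> \<le> 0"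
    and int: "set_integrable lborel {0..2*pi} g"
  shows "circle_mean v c r = ereal ((LINT \<theta>:{0..2*pi}|lborel. g \<theta>) / (2 * pi))"
proof -
  have 1: "(\<integral>\<^sup>+\<theta>\<in>{0..2*pi}. e2ennreal (v (c + rcis r \<theta>)) \<partial>lborel) = 0"
    unfolding eq using g by (simp add: e2ennreal_neg ennreal_neg)
  have "(\<integral>\<^sup>+\<theta>\<in>{0..2*pi}. e2ennreal (- v (c + rcis r \<theta>)) \<partial>lborel) = (\<integral>\<^sup>+\<theta>. ennreal (indicator {0..2*pi} \<theta> *\<^sub>R (- g \<theta>)) \<partial>lborel)"
    unfolding eq by (intro nn_integral_cong) (auto simp: indicator_def ennreal_def e2ennreal_neg)
  also have "\<dots> = ennreal (LINT \<theta>:{0..2*pi}|lborel. - g \<theta>)"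
    unfolding set_lebesgue_integral_def
  proof (rule nn_integral_eq_integral)
    show "integrable lborel (\<lambda>\<theta>. indicator {0..2*pi} \<theta> *\<^sub>R (- g \<theta>))" using int unfolding set_integrable_def by simp
    show "AE \<theta> in lborel. 0 \<le> indicator {0..2*pi} \<theta> *\<^sub>R (- g \<theta>)" using g by (intro AE_I2) (simp add: indicator_def)
  qed
  also have "(LINT \<theta>:{0..2*pi}|lborel. - g \<theta>) = - (LINT \<theta>:{0..2*pi}|lborel. g \<theta>)"
    unfolding set_lebesgue_integral_def by simp
  finally have 2: "(\<integral>\<^sup>+\<theta>\<in>{0..2*pi}. e2ennreal (- v (c + rcis r \<theta>)) \<partial>lborel) = ennreal (- (LINT \<theta>:{0..2*pi}|lborel. g \<theta>))" .
  have "0 \<le> (LINT \<theta>:{0..2*pi}|lborel. - g \<theta>)"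
    unfolding set_lebesgue_integral_def using g by (intro integral_nonneg_AE AE_I2) (simp add: indicator_def)
  then have neg: "0 \<le> - (LINT \<theta>:{0..2*pi}|lborel. g \<theta>)" unfolding set_lebesgue_integral_def by simp
  show ?thesis unfolding circle_mean_def 1 2 using neg by (simp add: enn2ereal_ennreal zero_ennreal.rep_eq zero_ereal_def)
qed

theorem theorem1p3:
  fixes \<Omega> :: "(complex^'n) set" and \<phi> :: "complex^'n \<Rightarrow> ereal" and a b t :: real
  assumes "bounded_hyperconvex_domain \<Omega>"
    and "0 \<in> \<Omega>"
    and "\<phi> \<in> cegrell_E \<Omega>"
    and "lelong_number \<phi> > 0"
    and "\<And>l. complex_line_through_0 l \<Longrightarrow> lelong_number_on_line l \<phi> = lelong_number \<phi>"
    and "a > 0" and "b > 0"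
    and "\<And>z. z \<in> \<Omega> \<Longrightarrow> z \<noteq> 0 \<Longrightarrow> \<phi> z \<ge> ereal (a * ln (norm z) - b)"
    and "t > - real CARD('n)"
  shows "weighted_threshold t \<phi> = ereal (t + real CARD('n)) / lelong_number \<phi>"
proof -
  let ?n = "real CARD('n)"
  have \<Omega>: "open \<Omega>" using assms(1) by (simp add: bounded_hyperconvex_domain_def)
  have psh: "plurisubharmonic_on \<Omega> \<phi>" and neg: "\<And>z. z \<in> \<Omega> \<Longrightarrow> \<phi> z < 0"
    using assms(3) by (auto simp: cegrell_E_def negative_psh_on_def)
  define f where "f = (\<lambda>z. real_of_ereal (\<phi> z))"
  have \<phi>f: "\<phi> z = ereal (f z)" "f z < 0" "a * ln (norm z) - b \<le> f z" if "z \<in> \<Omega>" "z \<noteq> 0" for z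
  proof -
    show eq: "\<phi> z = ereal (f z)" using neg[OF that(1)] assms(8)[OF that] unfolding f_def by (cases "\<phi> z") auto
    show "f z < 0" using neg[OF that(1)] eq by simp
    show "a * ln (norm z) - b \<le> f z" using assms(8)[OF that] eq by simp
  qed
  obtain e0 where e0: "0 < e0" "ball 0 e0 \<subseteq> \<Omega>" using \<Omega> assms(2) open_contains_ball by blast
  define r where "r = min (e0 / 2) 1"
  have r: "0 < r" "r \<le> 1" "2 * r \<le> e0" using e0 by (auto simp: r_def)
  \<comment> \<open>The Lelong number is finite because of the logarithmic lower bound.\<close>
  have "lelong_number \<phi> \<le> ereal (a + 1)"
  proof (rule ccontr)
    assume "\<not> ?thesis"
    then have "ereal (a + 1) < Liminf (at 0) (\<lambda>z. \<phi> z / ereal (ln (norm z)))" by (simp add: lelong_number_def)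
    then have "eventually (\<lambda>z. ereal (a + 1) < \<phi> z / ereal (ln (norm z))) (at 0)" by (rule less_LiminfD)
    then obtain d where d: "0 < d" "\<And>z. z \<noteq> 0 \<Longrightarrow> dist z 0 < d \<Longrightarrow> ereal (a + 1) < \<phi> z / ereal (ln (norm z))"
      unfolding eventually_at by auto
    define e where "e = min (min (d / 2) (e0 / 2)) (min (1 / 2) (exp (- b - 1)))"
    have e: "0 < e" "e < d" "e < e0" "e < 1" "e \<le> exp (- b - 1)"
      using d(1) e0(1) unfolding e_def by (auto simp: min_less_iff_disj)
    obtain z :: "complex^'n" where nz: "norm z = e" using e(1) by (rule vector_choose_size[OF less_imp_le])
    have z: "z \<in> \<Omega>" "z \<noteq> 0" using nz e e0(2) by auto
    have ln: "ln e < 0" "ln e \<le> - b - 1"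
    proof -
      show "ln e < 0" using e by simp
      have "ln e \<le> ln (exp (- b - 1))" using e(1,5) by (subst ln_le_cancel_iff) auto
      then show "ln e \<le> - b - 1" by simp
    qed
    have "ereal (a + 1) < \<phi> z / ereal (ln (norm z))" using d(2)[OF z(2)] nz e by simp
    then have "a + 1 < f z / ln e" unfolding \<phi>f(1)[OF z] nz using ln by simp
    then have "f z < (a + 1) * ln e" using ln(1) by (simp add: neg_less_divide_eq)
    moreover have "a * ln e - b \<le> f z" using \<phi>f(3)[OF z] nz by simp
    ultimately show False using ln(2) by (simp add: algebra_simps)
  qed
  then obtain \<nu> where \<nu>: "lelong_number \<phi> = ereal \<nu>" "0 < \<nu>"
    using assms(4) by (cases "lelong_number \<phi>") auto
  have below: "\<exists>\<delta>>0. \<forall>z. z \<noteq> 0 \<longrightarrow> norm z < \<delta> \<longrightarrow> z \<in> \<Omega> \<and> norm z < 1 \<and> f z \<le> \<nu>' * ln (norm z)" if "\<nu>' < \<nu>" for \<nu>'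
  proof -
    have "ereal \<nu>' < Liminf (at 0) (\<lambda>z. \<phi> z / ereal (ln (norm z)))" using that \<nu>(1) by (simp add: lelong_number_def)
    then have "eventually (\<lambda>z. ereal \<nu>' < \<phi> z / ereal (ln (norm z))) (at 0)" by (rule less_LiminfD)
    then obtain d where d: "0 < d" "\<And>z. z \<noteq> 0 \<Longrightarrow> dist z 0 < d \<Longrightarrow> ereal \<nu>' < \<phi> z / ereal (ln (norm z))"
      unfolding eventually_at by auto
    show ?thesis
    proof (intro exI[of _ "min d (min e0 1)"] conjI allI impI)
      show "0 < min d (min e0 1)" using d(1) e0(1) by simp
      fix z :: "complex^'n" assume z: "z \<noteq> 0" "norm z < min d (min e0 1)"
      show z\<Omega>: "z \<in> \<Omega>" using z(2) e0(2) by auto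
      show z1: "norm z < 1" using z(2) by simp
      have "ln (norm z) < 0" using z z1 by simp
      moreover have "ereal \<nu>' < \<phi> z / ereal (ln (norm z))" using d(2)[OF z(1)] z(2) by simp
      ultimately have "\<nu>' < f z / ln (norm z)" unfolding \<phi>f(1)[OF z\<Omega> z(1)] by simp
      then show "f z \<le> \<nu>' * ln (norm z)" using \<open>ln (norm z) < 0\<close> by (simp add: neg_less_divide_eq)
    qed
  qed
  \<comment> \<open>After rescaling, the ball of radius 2 lies in the domain.\<close>
  define u where "u = (\<lambda>z. f (of_real r *s z))"
  have rz: "of_real r *s z \<in> \<Omega>" "of_real r *s z \<noteq> 0" "norm (of_real r *s z) = r * norm z" if "z \<in> punctured_ball" for z
  proof -
    show nr: "norm (of_real r *s z) = r * norm z" unfolding norm_vector_scalar using r(1) by simp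
    have p: "0 < norm z" "norm z < 2" using that by blast+
    have "r * norm z < r * 2" using p r(1) by (intro mult_strict_left_mono)
    then show "of_real r *s z \<in> \<Omega>" using nr r(3) e0(2) by auto
    have "0 < r * norm z" using p(1) r(1) by simp
    then show "of_real r *s z \<noteq> 0" using nr by auto
  qed
  have \<phi>u: "of_real r *s z \<in> \<Omega> \<and> \<phi> (of_real r *s z) = ereal (u z)" if "z \<in> punctured_ball" for z
    using rz[OF that] \<phi>f(1) by (simp add: u_def)
  have ulow: "a * ln (r * norm z) - b \<le> u z" if "z \<in> punctured_ball" for z
    using \<phi>f(3)[OF rz(1,2)[OF that]] unfolding rz(3)[OF that] u_def .
  have uneg: "u z \<le> 0" if "z \<in> punctured_ball" for z
    using \<phi>f(2)[OF rz(1,2)[OF that]] by (simp add: u_def)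
  have uscu: "usc_real_on punctured_ball u"
    using psh unfolding plurisubharmonic_on_def by (intro usc_on_rescaled[OF _ \<Omega> \<phi>u]) auto
  have bdu: "\<exists>N. \<forall>z\<in>K. \<bar>u z\<bar> \<le> N" if K: "K \<subseteq> punctured_ball" "compact K" for K
  proof (cases "K = {}")
    case False
    have "continuous_on K norm" by (intro continuous_intros)
    then obtain z0 where z0: "z0 \<in> K" "\<forall>z\<in>K. norm z0 \<le> norm z" using continuous_attains_inf[OF K(2) False] by blast
    have p0: "0 < r * norm z0" using z0(1) K(1) r(1) by auto
    show ?thesis
    proof (intro exI[of _ "\<bar>a * ln (r * norm z0) - b\<bar>"] ballI)
      fix z assume z: "z \<in> K"
      then have zp: "z \<in> punctured_ball" using K(1) by blast
      have "r * norm z0 \<le> r * norm z" using z0(2) z r(1) by (intro mult_left_mono) auto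
      then have "ln (r * norm z0) \<le> ln (r * norm z)" using p0 by (subst ln_le_cancel_iff) linarith+
      then have "a * ln (r * norm z0) \<le> a * ln (r * norm z)" using assms(6) by (intro mult_left_mono) auto
      then show "\<bar>u z\<bar> \<le> \<bar>a * ln (r * norm z0) - b\<bar>" using ulow[OF zp] uneg[OF zp] by linarith
    qed
  qed simp
  have meanu: "u z \<le> (LINT \<theta>:{0..2*pi}|lborel. u (z + cis \<theta> *s v)) / (2 * pi)"
    if sub: "\<forall>x\<in>cball 0 1. z + x *s v \<in> punctured_ball" for z v
  proof -
    let ?S = "{\<zeta>. of_real r *s z + \<zeta> *s (of_real r *s v) \<in> \<Omega>}"
    let ?v = "\<lambda>\<zeta>. \<phi> (of_real r *s z + \<zeta> *s (of_real r *s v))"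
    have eq: "of_real r *s z + x *s (of_real r *s v) = of_real r *s (z + x *s v)" for x
      by (simp add: vec_eq_iff algebra_simps)
    have inb: "z + x *s v \<in> punctured_ball" if "norm x \<le> 1" for x using sub that by auto
    have "subharmonic_on ?S ?v" using psh unfolding plurisubharmonic_on_def by blast
    moreover have "cball 0 1 \<subseteq> ?S" using \<phi>u[OF inb] unfolding eq by auto
    ultimately have "?v 0 \<le> circle_mean ?v 0 1" unfolding subharmonic_on_def by (metis zero_less_one)
    also have "\<dots> = ereal ((LINT \<theta>:{0..2*pi}|lborel. u (z + cis \<theta> *s v)) / (2 * pi))"
    proof (rule circle_mean_nonpos)
      show "?v (0 + rcis 1 \<theta>) = ereal (u (z + cis \<theta> *s v))" for \<theta>
        unfolding eq using \<phi>u[OF inb, of "cis \<theta>"] by (simp add: rcis_def del: vector_add_ldistrib)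
      show "u (z + cis \<theta> *s v) \<le> 0" for \<theta> by (rule uneg[OF inb]) simp
      show "set_integrable lborel {0..2*pi} (\<lambda>\<theta>. u (z + cis \<theta> *s v))"
        by (rule usc_circle_integrable[OF open_punctured_ball uscu bdu inb]) simp_all
    qed
    also have "?v 0 = ereal (u z)" using \<phi>u[OF inb, of 0] by simp
    finally show ?thesis by simp
  qed
  interpret isotropic_psh u \<nu> a "b + a * \<bar>ln r\<bar>"
  proof
    show "bounded_psh_on punctured_ball u"
      unfolding bounded_psh_on_def using uscu bdu meanu by blast
    show "u z \<le> 0" if "0 < norm z" "norm z < 2" for z using uneg that by blast
    show "a * ln (norm z) - (b + a * \<bar>ln r\<bar>) \<le> u z" if z: "0 < norm z" "norm z \<le> 1" for z
    proof -
      have "z \<in> punctured_ball" using z by auto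
      moreover have "ln (r * norm z) = ln r + ln (norm z)" using z r by (simp add: ln_mult)
      moreover have "a * (- \<bar>ln r\<bar>) \<le> a * ln r" using assms(6) by (intro mult_left_mono) auto
      ultimately show ?thesis using ulow[of z] by (simp add: algebra_simps)
    qed
    show "\<exists>\<delta>>0. \<forall>z. 0 < norm z \<longrightarrow> norm z < \<delta> \<longrightarrow> u z \<le> \<nu>' * ln (norm z)" if \<nu>': "\<nu>' < \<nu>" for \<nu>'
    proof -
      define \<nu>2 where "\<nu>2 = max \<nu>' (\<nu> / 2)"
      have \<nu>2: "\<nu>2 < \<nu>" "\<nu>' \<le> \<nu>2" "0 \<le> \<nu>2" using \<nu>' \<nu>(2) by (auto simp: \<nu>2_def)
      obtain \<delta> where \<delta>: "0 < \<delta>" "\<And>z. z \<noteq> 0 \<Longrightarrow> norm z < \<delta> \<Longrightarrow> z \<in> \<Omega> \<and> norm z < 1 \<and> f z \<le> \<nu>2 * ln (norm z)"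
        using below[OF \<nu>2(1)] by blast
      show ?thesis
      proof (intro exI[of _ "min \<delta> 1"] conjI allI impI)
        show "0 < min \<delta> 1" using \<delta>(1) by simp
        fix z :: "complex^'n" assume z: "0 < norm z" "norm z < min \<delta> 1"
        then have zp: "z \<in> punctured_ball" by auto
        have "r * norm z \<le> 1 * norm z" using r by (intro mult_right_mono) auto
        then have rle: "r * norm z \<le> norm z" by simp
        have "u z \<le> \<nu>2 * ln (r * norm z)"
          using \<delta>(2)[OF rz(2)[OF zp]] rle z(2) unfolding rz(3)[OF zp] u_def by simp
        also have "\<dots> \<le> \<nu>2 * ln (norm z)"
          using rle r(1) z(1) \<nu>2(3) by (intro mult_left_mono) auto
        also have "\<dots> \<le> \<nu>' * ln (norm z)" using \<nu>2(2) z by (intro mult_right_mono_neg) auto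
        finally show "u z \<le> \<nu>' * ln (norm z)" .
      qed
    qed
    show "\<exists>\<zeta>. 0 < norm \<zeta> \<and> norm \<zeta> < \<delta> \<and> \<mu> * ln (norm \<zeta>) \<le> u (\<zeta> *s w)"
      if w: "w \<noteq> 0" and \<mu>: "\<nu> < \<mu>" and \<delta>: "0 < \<delta>" for w \<mu> \<delta>
    proof -
      define l where "l = range (\<lambda>\<zeta>. \<zeta> *s w)"
      have "complex_line_through_0 l" unfolding complex_line_through_0_def l_def using w by blast
      then have L: "Liminf (at 0 within l) (\<lambda>z. \<phi> z / ereal (ln (norm z))) = ereal \<nu>"
        using assms(5) \<nu>(1) by (simp add: lelong_number_on_line_def)
      define \<mu>' where "\<mu>' = (\<nu> + \<mu>) / 2"
      have \<mu>': "\<nu> < \<mu>'" "\<mu>' < \<mu>" "0 < \<mu>'" using \<mu> \<nu>(2) by (auto simp: \<mu>'_def)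
      have not_ev: "\<not> eventually (\<lambda>z. ereal \<mu>' \<le> \<phi> z / ereal (ln (norm z))) (at 0 within l)"
      proof
        assume "eventually (\<lambda>z. ereal \<mu>' \<le> \<phi> z / ereal (ln (norm z))) (at 0 within l)"
        then have "ereal \<mu>' \<le> ereal \<nu>" unfolding L[symmetric] by (rule Liminf_bounded)
        then show False using \<mu>'(1) by simp
      qed
      define Q where "Q = \<mu>' * \<bar>ln (r * norm w)\<bar> / (\<mu> - \<mu>')"
      define \<delta>1 where "\<delta>1 = min (min \<delta> 1) (min (exp (- Q)) (1 / norm w))"
      have nw: "0 < norm w" using w by simp
      have \<delta>1: "0 < \<delta>1" using \<delta> nw by (simp add: \<delta>1_def)
      have "0 < \<delta>1 * (r * norm w)" using \<delta>1 r(1) nw by simp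
      then obtain z where z: "z \<in> l" "z \<noteq> 0" "dist z 0 < \<delta>1 * (r * norm w)" "\<not> ereal \<mu>' \<le> \<phi> z / ereal (ln (norm z))"
        using not_ev unfolding eventually_at by blast
      obtain \<zeta>' where \<zeta>': "z = \<zeta>' *s w" using z(1) by (auto simp: l_def)
      define \<zeta> where "\<zeta> = \<zeta>' / of_real r"
      have zr: "z = of_real r *s (\<zeta> *s w)" using r(1) by (simp add: \<zeta>_def \<zeta>')
      have nz: "norm z = norm \<zeta> * (r * norm w)"
        unfolding zr norm_vector_scalar using r(1) by (simp add: mult_ac)
      have \<zeta>: "0 < norm \<zeta>" "norm \<zeta> < \<delta>1"
      proof -
        show "0 < norm \<zeta>" using z(2) unfolding zr by auto
        have "norm \<zeta> * (r * norm w) < \<delta>1 * (r * norm w)" using z(3) nz by simp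
        then show "norm \<zeta> < \<delta>1" using r(1) nw by (simp add: mult_less_cancel_right_pos)
      qed
      have zw1: "norm (\<zeta> *s w) < 1"
      proof -
        have "norm \<zeta> < 1 / norm w" using \<zeta>(2) by (simp add: \<delta>1_def)
        then show ?thesis unfolding norm_vector_scalar using nw by (simp add: pos_less_divide_eq)
      qed
      have "0 < norm (\<zeta> *s w)" unfolding norm_vector_scalar using \<zeta>(1) nw by simp
      then have zp: "\<zeta> *s w \<in> punctured_ball" using zw1 by auto
      have z1: "norm z < 1" "0 < norm z"
      proof -
        have "r * norm (\<zeta> *s w) \<le> 1 * norm (\<zeta> *s w)" using r by (intro mult_right_mono) auto
        then show "norm z < 1" using zw1 unfolding zr rz(3)[OF zp] by linarith
        show "0 < norm z" using z(2) by simp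
      qed
      have lnz: "ln (norm z) < 0" using z1 by simp
      have z\<Omega>: "z \<in> \<Omega>" using rz(1)[OF zp] zr by simp
      have "f z / ln (norm z) < \<mu>'" using z(4) lnz unfolding \<phi>f(1)[OF z\<Omega> z(2)] by simp
      then have "\<mu>' * ln (norm z) < f z" using lnz by (simp add: neg_divide_less_eq)
      moreover have "f z = u (\<zeta> *s w)" by (simp add: u_def zr)
      moreover have "ln (norm z) = ln (norm \<zeta>) + ln (r * norm w)"
        unfolding nz using \<zeta>(1) r(1) nw by (subst ln_mult) auto
      ultimately have low: "\<mu>' * ln (norm \<zeta>) + \<mu>' * ln (r * norm w) < u (\<zeta> *s w)" by (simp add: distrib_left)
      have "norm \<zeta> \<le> exp (- Q)" using \<zeta>(2) by (simp add: \<delta>1_def)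
      then have "ln (norm \<zeta>) \<le> ln (exp (- Q))" using \<zeta>(1) by (subst ln_le_cancel_iff) auto
      then have "Q \<le> - ln (norm \<zeta>)" by simp
      then have "\<mu>' * \<bar>ln (r * norm w)\<bar> \<le> - ln (norm \<zeta>) * (\<mu> - \<mu>')"
        using \<mu>'(2) by (simp add: Q_def pos_divide_le_eq)
      moreover have "- (\<mu>' * \<bar>ln (r * norm w)\<bar>) \<le> \<mu>' * ln (r * norm w)"
      proof -
        have "\<mu>' * (- \<bar>ln (r * norm w)\<bar>) \<le> \<mu>' * ln (r * norm w)" using \<mu>'(3) by (intro mult_left_mono) auto
        then show ?thesis by simp
      qed
      ultimately have "\<mu> * ln (norm \<zeta>) \<le> \<mu>' * ln (norm \<zeta>) + \<mu>' * ln (r * norm w)" by (simp add: algebra_simps)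
      then show ?thesis using low \<zeta> by (intro exI[of _ \<zeta>]) (simp add: \<delta>1_def)
    qed
    show "0 < b + a * \<bar>ln r\<bar>" using assms(6,7) by (simp add: add_pos_nonneg)
  qed (use \<nu> assms in auto)
  let ?good = "\<lambda>c. c \<ge> 0 \<and> (\<exists>U. open U \<and> 0 \<in> U \<and>
        (\<integral>\<^sup>+z\<in>U. ennreal (norm z powr (2 * t)) * ereal_exp (ereal (- 2 * c) * \<phi> z) \<partial>lborel) < \<infinity>)"
  have expf: "ereal_exp (ereal (- 2 * c) * \<phi> z) = ennreal (exp (- 2 * c * f z))" if "z \<in> \<Omega>" "z \<noteq> 0" for c z
    unfolding \<phi>f(1)[OF that] ereal_exp_def by simp
  have tn: "0 < t + ?n" using assms(9) by simp
  have upper: "c \<le> (t + ?n) / \<nu>" if good: "?good c" for c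
  proof (rule ccontr)
    assume "\<not> c \<le> (t + ?n) / \<nu>"
    then have c: "(t + ?n) / \<nu> < c" by simp
    have "0 < (t + ?n) / \<nu>" using tn \<nu>(2) by simp
    then have c0: "0 < c" using c by linarith
    have "(t + ?n) / c < \<nu>" using c c0 \<nu>(2) by (simp add: pos_divide_less_eq mult.commute)
    then obtain \<nu>' where \<nu>': "(t + ?n) / c < \<nu>'" "\<nu>' < \<nu>" using dense by blast
    have cn: "t + ?n < c * \<nu>'" using \<nu>'(1) c0 by (simp add: pos_divide_less_eq mult.commute)
    obtain U where U: "open U" "0 \<in> U"
      "(\<integral>\<^sup>+z\<in>U. ennreal (norm z powr (2 * t)) * ereal_exp (ereal (- 2 * c) * \<phi> z) \<partial>lborel) < \<infinity>" using good by blast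
    obtain \<delta> where \<delta>: "0 < \<delta>" "\<And>z. z \<noteq> 0 \<Longrightarrow> norm z < \<delta> \<Longrightarrow> z \<in> \<Omega> \<and> norm z < 1 \<and> f z \<le> \<nu>' * ln (norm z)"
      using below[OF \<nu>'(2)] by blast
    obtain e where e: "0 < e" "ball 0 e \<subseteq> U" using U(1,2) open_contains_ball by blast
    define d where "d = min \<delta> e"
    have d: "0 < d" using \<delta>(1) e(1) by (simp add: d_def)
    have "(\<integral>\<^sup>+z. indicator (ball 0 d) z * ennreal (norm (z::complex^'n) powr (- 2 * ?n)) \<partial>lborel)
        \<le> (\<integral>\<^sup>+z\<in>U. ennreal (norm z powr (2 * t)) * ereal_exp (ereal (- 2 * c) * \<phi> z) \<partial>lborel)"
    proof (rule nn_integral_mono)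
      fix z :: "complex^'n"
      show "indicator (ball 0 d) z * ennreal (norm z powr (- 2 * ?n))
          \<le> ennreal (norm z powr (2 * t)) * ereal_exp (ereal (- 2 * c) * \<phi> z) * indicator U z"
      proof (cases "z \<in> ball 0 d \<and> z \<noteq> 0")
        case False
        then show ?thesis by (auto simp: indicator_def)
      next
        case True
        have z: "z \<in> \<Omega>" "norm z < 1" "f z \<le> \<nu>' * ln (norm z)" using \<delta>(2)[of z] True by (auto simp: d_def)
        have zU: "z \<in> U" using True e(2) by (auto simp: d_def)
        have ln: "ln (norm z) < 0" using True z(2) by simp
        have "c * f z \<le> c * (\<nu>' * ln (norm z))" using z(3) c0 by (intro mult_left_mono) auto
        moreover have "(c * \<nu>') * ln (norm z) \<le> (t + ?n) * ln (norm z)" using cn ln by (intro mult_right_mono_neg) auto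
        ultimately have "- 2 * ?n * ln (norm z) \<le> 2 * t * ln (norm z) + - 2 * c * f z" by (simp add: algebra_simps)
        then have "exp (- 2 * ?n * ln (norm z)) \<le> exp (2 * t * ln (norm z)) * exp (- 2 * c * f z)"
          unfolding exp_add[symmetric] by simp
        then have "norm z powr (- 2 * ?n) \<le> norm z powr (2 * t) * exp (- 2 * c * f z)" using True by (simp add: powr_def)
        then have "ennreal (norm z powr (- 2 * ?n)) \<le> ennreal (norm z powr (2 * t)) * ennreal (exp (- 2 * c * f z))"
          by (subst ennreal_mult[symmetric]) (auto intro: ennreal_leI)
        then show ?thesis using True zU expf[OF z(1)] by simp
      qed
    qed
    then show False using U(3) unfolding nn_integral_norm_power_diverges[OF d] by simp
  qed
  have lower_good: "?good c" if c: "0 < c" "c < (t + ?n) / \<nu>" for c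
  proof
    show "0 \<le> c" using c by simp
    have "c * \<nu> < t + ?n" using c(2) \<nu>(2) by (simp add: pos_less_divide_eq)
    then obtain \<delta> where \<delta>: "0 < \<delta>" "\<delta> \<le> 1"
      "(\<integral>\<^sup>+z. indicator (ball 0 \<delta>) z * ennreal (norm z powr (2 * t) * exp (- 2 * c * u z)) \<partial>lborel) < \<infinity>"
      using integrable_near_0[OF c(1)] by blast
    define g where "g = (\<lambda>z. ennreal (r powr (2 * t)) * (indicator (ball 0 \<delta>) z * ennreal (norm z powr (2 * t) * exp (- 2 * c * (indicator punctured_ball z * u z)))))"
    have um: "(\<lambda>z. indicator punctured_ball z * u z) \<in> borel_measurable borel"
      by (rule usc_real_on_borel_measurable[OF open_punctured_ball usc])
    have gm0: "(\<lambda>z. indicator (ball 0 \<delta>) z * ennreal (norm z powr (2 * t) * exp (- 2 * c * (indicator punctured_ball z * u z)))) \<in> borel_measurable borel"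
    proof (intro borel_measurable_times_ennreal borel_measurable_indicator)
      have "(\<lambda>z. norm (z::complex^'n) powr (2 * t)) \<in> borel_measurable borel" by measurable
      moreover have "(\<lambda>z. exp (- 2 * c * (indicator punctured_ball z * u z))) \<in> borel_measurable borel"
        by (rule measurable_compose[OF borel_measurable_times[OF borel_measurable_const um] borel_measurable_exp])
      ultimately show "(\<lambda>z. ennreal (norm z powr (2 * t) * exp (- 2 * c * (indicator punctured_ball z * u z)))) \<in> borel_measurable borel"
        by (intro measurable_compose[OF _ measurable_ennreal] borel_measurable_times)
    qed simp
    then have gm: "g \<in> borel_measurable borel" unfolding g_def by measurable
    have same: "indicator (ball 0 \<delta>) z * ennreal (norm z powr (2 * t) * exp (- 2 * c * (indicator punctured_ball z * u z)))
        = indicator (ball 0 \<delta>) z * ennreal (norm z powr (2 * t) * exp (- 2 * c * u z))" for z :: "complex^'n"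
    proof (cases "z = 0")
      case False
      then show ?thesis using \<delta>(2) by (auto simp: indicator_def)
    qed simp
    have "(\<integral>\<^sup>+z. g z \<partial>lborel) = ennreal (r powr (2 * t)) * (\<integral>\<^sup>+z. indicator (ball 0 \<delta>) z * ennreal (norm z powr (2 * t) * exp (- 2 * c * u z)) \<partial>lborel)"
      unfolding g_def same[symmetric] using gm0 by (intro nn_integral_cmult) simp
    also have "\<dots> < \<infinity>" using \<delta>(3) by (simp add: ennreal_mult_less_top)
    finally have "(\<integral>\<^sup>+z. g ((1 / r) *\<^sub>R z) \<partial>lborel) < \<infinity>" by (rule nn_integral_scale_finite[OF gm r(1)])
    moreover have "ennreal (norm z powr (2 * t)) * ereal_exp (ereal (- 2 * c) * \<phi> z) * indicator (ball 0 (r * \<delta>)) z = g ((1 / r) *\<^sub>R z)" for z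
    proof (cases "z \<in> ball 0 (r * \<delta>) \<and> z \<noteq> 0")
      case False
      then show ?thesis using r(1) by (auto simp: g_def indicator_def pos_divide_less_eq mult.commute)
    next
      case True
      define y where "y = (1 / r) *\<^sub>R z"
      have ny: "norm y = norm z / r" using r(1) by (simp add: y_def)
      have zy: "z = of_real r *s y" using r(1) by (simp add: y_def vec_eq_iff) (simp add: scaleR_conv_of_real)
      have yd: "norm y < \<delta>" "0 < norm y" using True r(1) unfolding ny by (auto simp: pos_divide_less_eq mult.commute)
      have yp: "y \<in> punctured_ball" using yd \<delta>(2) by auto
      have "norm z powr (2 * t) = r powr (2 * t) * norm y powr (2 * t)"
        unfolding zy norm_vector_scalar using r(1) by (simp add: powr_mult)
      moreover have "f z = u y" by (simp add: u_def zy)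
      moreover have "z \<in> \<Omega>" using rz(1)[OF yp] zy by simp
      ultimately have "ennreal (norm z powr (2 * t)) * ereal_exp (ereal (- 2 * c) * \<phi> z)
          = ennreal (r powr (2 * t)) * ennreal (norm y powr (2 * t) * exp (- 2 * c * u y))"
        using expf[of z c] True by (simp add: ennreal_mult mult.assoc)
      then show ?thesis using True yd yp unfolding g_def y_def[symmetric] by simp
    qed
    ultimately have "(\<integral>\<^sup>+z\<in>ball 0 (r * \<delta>). ennreal (norm z powr (2 * t)) * ereal_exp (ereal (- 2 * c) * \<phi> z) \<partial>lborel) < \<infinity>" by simp
    then show "\<exists>U. open U \<and> 0 \<in> U \<and> (\<integral>\<^sup>+z\<in>U. ennreal (norm z powr (2 * t)) * ereal_exp (ereal (- 2 * c) * \<phi> z) \<partial>lborel) < \<infinity>"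
      using r(1) \<delta>(1) by (intro exI[of _ "ball 0 (r * \<delta>)"]) auto
  qed
  have "weighted_threshold t \<phi> = ereal ((t + ?n) / \<nu>)"
  proof (rule antisym)
    show "weighted_threshold t \<phi> \<le> ereal ((t + ?n) / \<nu>)"
      unfolding weighted_threshold_def by (rule Sup_least) (use upper in \<open>force simp del: mult_minus_left\<close>)
    show "ereal ((t + ?n) / \<nu>) \<le> weighted_threshold t \<phi>"
    proof (rule dense_le_bounded[of 0])
      show "0 < ereal ((t + ?n) / \<nu>)" using tn \<nu>(2) by simp
      fix x :: ereal assume x: "0 < x" "x < ereal ((t + ?n) / \<nu>)"
      then obtain c where c: "x = ereal c" by (cases x) auto
      then have "?good c" using x by (intro lower_good) auto
      then show "x \<le> weighted_threshold t \<phi>" unfolding weighted_threshold_def c by (intro Sup_upper) blast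
    qed
  qed
  then show ?thesis using \<nu> by simp
qed

end
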